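(* The $\mathbb{C}(v)$-algebra morphism $\varphi\colon U_v^{>}(\widehat{\mathfrak{sl}}(2|1))\to\Lambda$ determined by $p_i\mapsto x^i\in\Lambda_{1,0}$ and $q_j\mapsto y^j\in\Lambda_{0,1}$ $(i,j\in\mathbb{Z})$ is an isomorphism.
   Context: $v$ is an indeterminate and $\mathbb{N}$ includes $0$. $U_v^{>}(\widehat{\mathfrak{sl}}(2|1))$ (for the simple root system with both simple roots odd) is the $\mathbb{C}(v)$-superalgebra generated by odd elements $p_i,q_i$ ($i\in\mathbb{Z}$) with relations, for all $i,j\in\mathbb{Z}$, $$p_ip_j+p_jp_i=0,\qquad q_iq_j+q_jq_i=0,\qquad p_{i+1}q_j+vq_jp_{i+1}=-vp_iq_{j+1}-q_{j+1}p_i.$$ Shuffle algebra: $\Lambda=\bigoplus_{n,m\in\mathbb{N}}\Lambda_{n,m}$, where $\Lambda_{n,m}$ is the $\mathbb{C}(v)$-space of rational functions $F$ in $x_1,\dots,x_n,y_1,\dots,y_m$ that are skew-symmetric in $\{x_i\}$ and skew-symmetric in $\{y_j\}$ and have the form $F=\frac{f}{\prod_{1\leqslant i\leqslant n,\,1\leqslant j\leqslant m}(x_i-y_j)}$ with $f\in\mathbb{C}(v)[x_i^{\pm1},y_j^{\pm1}]$ a Laurent polynomial. For $F\in\Lambda_{k_1,l_1}$, $G\in\Lambda_{k_2,l_2}$ the shuffle product $F\star G\in\Lambda_{k_1+k_2,l_1+l_2}$ is $$F\star G=\mathrm{ASym}_{\mathfrak{S}_{k_1+k_2}\times\mathfrak{S}_{l_1+l_2}}\Big(F(\{x_i,y_j\}_{1\leqslant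 i\leqslant k_1}^{1\leqslant j\leqslant l_1})\,G(\{x_i,y_j\}_{k_1<i\leqslant k_1+k_2}^{l_1<j\leqslant l_1+l_2})\prod_{1\leqslant i\leqslant k_1}^{l_1<j\leqslant l_1+l_2}\frac{x_i+v^{-1}y_j}{x_i-y_j}\prod_{k_1<i\leqslant k_1+k_2}^{1\leqslant j\leqslant l_1}\frac{y_j+v^{-1}x_i}{y_j-x_i}\Big),$$ where $\mathrm{ASym}_{\mathfrak{S}_n\times\mathfrak{S}_m}(f)=\frac{1}{n!m!}\sum_{\sigma\in\mathfrak{S}_n,\tau\in\mathfrak{S}_m}\mathrm{sign}(\sigma)\mathrm{sign}(\tau)f(x_{\sigma(1)},\dots,x_{\sigma(n)},y_{\tau(1)},\dots,y_{\tau(m)})$. With $\star$, $\Lambda$ is an associative $\mathbb{C}(v)$-algebra. Here $x^i$ denotes $x_1^i\in\Lambda_{1,0}$ and $y^j$ denotes $y_1^j\in\Lambda_{0,1}$. *)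

theory Defs
  imports
    "HOL-Library.Poly_Mapping"
    "HOL-Library.Product_Plus"
    "HOL-Computational_Algebra.Fraction_Field"
    "HOL-Computational_Algebra.Polynomial"
    "HOL-Combinatorics.Permutations"
    "HOL-Algebra.QuotRing"
    "HOL-Algebra.Module"
begin

section \<open>The ground field and algebras over it\<close>

type_synonym Cv = "complex poly fract"

definition v_indet :: Cv
  where "v_indet = Fraction_Field.Fract [:0, 1:] 1"

text \<open>An associative algebra over a field is carried by the record of modules over it. The library
  locale of algebras requires commutativity, hence the separate notions of algebra morphism and
  quotient here; ideals and quotients of the underlying rings are those of the library, and its
  ideals are two-sided.\<close>

definition algebra_hom ::
    "('k, 'a, 'm) module_scheme \<Rightarrow> ('k, 'b, 'n) module_scheme \<Rightarrow> ('a \<Rightarrow> 'b) set"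
  where "algebra_hom A B =
    {h \<in> ring_hom A B. \<forall>c. \<forall>a\<in>carrier A. h (c \<odot>\<^bsub>A\<^esub> a) = c \<odot>\<^bsub>B\<^esub> h a}"

definition algebra_iso ::
    "('k, 'a, 'm) module_scheme \<Rightarrow> ('k, 'b, 'n) module_scheme \<Rightarrow> ('a \<Rightarrow> 'b) set"
  where "algebra_iso A B = {h \<in> algebra_hom A B. bij_betw h (carrier A) (carrier B)}"

definition quotient_algebra ::
    "('k, 'a, 'm) module_scheme \<Rightarrow> 'a set \<Rightarrow> ('k, 'a set) module"
  where "quotient_algebra A I =
    \<lparr>carrier = carrier (A Quot I), mult = mult (A Quot I), one = one (A Quot I),
     zero = zero (A Quot I), add = add (A Quot I),
     smult = (\<lambda>c C. \<Union>a\<in>C. I +>\<^bsub>A\<^esub> (c \<odot>\<^bsub>A\<^esub> a))\<rparr>"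


section \<open>The algebra given by generators and relations\<close>

datatype generator = Pgen int | Qgen int

text \<open>Words form a monoid under concatenation, so the convolution product of finitely supported
  functions on words is the product of the free algebra.\<close>

datatype word = Word (letters: "generator list")

instantiation word :: monoid_add
begin

definition zero_word :: word
  where "0 = Word []"

definition plus_word :: "word \<Rightarrow> word \<Rightarrow> word"
  where "a + b = Word (letters a @ letters b)"

instance
  by standard (simp_all add: zero_word_def plus_word_def)

end

type_synonym free = "word \<Rightarrow>\<^sub>0 Cv"

definition free_scalar :: "Cv \<Rightarrow> free"
  where "free_scalar c = Poly_Mapping.single 0 c"

definition p_free :: "int \<Rightarrow> free"
  where "p_free i = Poly_Mapping.single (Word [Pgen i]) 1"

definition q_free :: "int \<Rightarrow> free"
  where "q_free j = Poly_Mapping.single (Word [Qgen j]) 1"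

definition free_algebra :: "(Cv, free) module"
  where "free_algebra =
    \<lparr>carrier = UNIV, mult = times, one = 1, zero = 0, add = plus,
     smult = (\<lambda>c a. free_scalar c * a)\<rparr>"

definition relators :: "free set"
  where "relators =
    {p_free i * p_free j + p_free j * p_free i | i j. True} \<union>
    {q_free i * q_free j + q_free j * q_free i | i j. True} \<union>
    {(p_free (i + 1) * q_free j + free_scalar v_indet * (q_free j * p_free (i + 1)))
      - (- free_scalar v_indet * (p_free i * q_free (j + 1)) - q_free (j + 1) * p_free i) | i j. True}"

definition relation_ideal :: "free set"
  where "relation_ideal = Idl\<^bsub>free_algebra\<^esub> relators"

text \<open>The relators are homogeneous in the number of letters. Declaring all generators odd therefore
  makes the quotient a superalgebra, with the parity of a word given by its length; this does not
  affect the underlying algebra, which is the one defined here.\<close>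

definition U_pos :: "(Cv, free set) module"
  where "U_pos = quotient_algebra free_algebra relation_ideal"

definition U_p :: "int \<Rightarrow> free set"
  where "U_p i = relation_ideal +>\<^bsub>free_algebra\<^esub> p_free i"

definition U_q :: "int \<Rightarrow> free set"
  where "U_q j = relation_ideal +>\<^bsub>free_algebra\<^esub> q_free j"

lemma ring_free_algebra: "ring free_algebra"
proof (rule ringI)
  show "abelian_group free_algebra"
  proof (rule abelian_groupI)
    show "\<exists>b\<in>carrier free_algebra. b \<oplus>\<^bsub>free_algebra\<^esub> a = \<zero>\<^bsub>free_algebra\<^esub>" for a
      by (rule bexI[of _ "- a"]) (simp_all add: free_algebra_def)
  qed (simp_all add: free_algebra_def add.assoc add.commute)
  show "monoid free_algebra"
    by (rule monoidI) (simp_all add: free_algebra_def mult.assoc)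
qed (simp_all add: free_algebra_def distrib_left distrib_right)

lemma ideal_relation_ideal: "ideal relation_ideal free_algebra"
  unfolding relation_ideal_def
  by (rule ring.genideal_ideal[OF ring_free_algebra]) (simp add: free_algebra_def)

lemma ring_U_pos: "ring U_pos"
proof -
  let ?R = "free_algebra Quot relation_ideal"
  interpret R: ring ?R
    by (rule ideal.quotient_is_ring[OF ideal_relation_ideal])
  have "ring (U_pos\<lparr>zero := id \<zero>\<^bsub>?R\<^esub>\<rparr>)"
    by (rule R.ring_iso_imp_img_ring)
      (simp add: ring_iso_def ring_hom_def U_pos_def quotient_algebra_def bij_betw_def)
  then show ?thesis
    by (simp add: U_pos_def quotient_algebra_def)
qed


section \<open>Rational functions in two families of variables\<close>

datatype xyvar = XV nat | YV nat

text \<open>The order on the variables serves only to obtain, from the library, that Laurent polynomials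
  form an integral domain.\<close>

fun var_code :: "xyvar \<Rightarrow> nat"
  where
    "var_code (XV i) = 2 * i"
  | "var_code (YV j) = 2 * j + 1"

lemma var_code_inj: "var_code a = var_code b \<Longrightarrow> a = b"
  by (cases a; cases b) (simp_all, presburger+)

instantiation xyvar :: linorder
begin

definition less_eq_xyvar :: "xyvar \<Rightarrow> xyvar \<Rightarrow> bool"
  where "a \<le> b \<longleftrightarrow> var_code a \<le> var_code b"

definition less_xyvar :: "xyvar \<Rightarrow> xyvar \<Rightarrow> bool"
  where "a < b \<longleftrightarrow> var_code a < var_code b"

instance
  by standard (auto simp: less_eq_xyvar_def less_xyvar_def intro: var_code_inj)

end

text \<open>Monomials have integer exponents. All rational functions live in the fraction field of the
  Laurent polynomials in the variables with indices in \<^typ>\<open>nat\<close>; those in use are numbered from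
  1.\<close>

type_synonym laurent = "(xyvar \<Rightarrow>\<^sub>0 int) \<Rightarrow>\<^sub>0 Cv"

type_synonym ratfun = "laurent fract"

definition laurent_in :: "nat \<Rightarrow> nat \<Rightarrow> laurent set"
  where "laurent_in n m =
    {f. \<forall>e\<in>Poly_Mapping.keys f. Poly_Mapping.keys e \<subseteq> XV ` {1..n} \<union> YV ` {1..m}}"

definition of_laurent :: "laurent \<Rightarrow> ratfun"
  where "of_laurent f = Fraction_Field.Fract f 1"

definition rat_const :: "Cv \<Rightarrow> ratfun"
  where "rat_const c = of_laurent (Poly_Mapping.single 0 c)"

definition rat_var :: "xyvar \<Rightarrow> ratfun"
  where "rat_var z = of_laurent (Poly_Mapping.single (Poly_Mapping.single z 1) 1)"

abbreviation xvar :: "nat \<Rightarrow> ratfun"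
  where "xvar i \<equiv> rat_var (XV i)"

abbreviation yvar :: "nat \<Rightarrow> ratfun"
  where "yvar j \<equiv> rat_var (YV j)"


subsection \<open>Substitution of variables\<close>

definition push_keys :: "('a \<Rightarrow> 'b) \<Rightarrow> ('a \<Rightarrow>\<^sub>0 'c) \<Rightarrow> ('b \<Rightarrow>\<^sub>0 'c::comm_monoid_add)"
  where "push_keys g f =
    (\<Sum>k\<in>Poly_Mapping.keys f. Poly_Mapping.single (g k) (Poly_Mapping.lookup f k))"

lemma push_keys_superset:
  assumes "finite S" "Poly_Mapping.keys f \<subseteq> S"
  shows "push_keys g f = (\<Sum>k\<in>S. Poly_Mapping.single (g k) (Poly_Mapping.lookup f k))"
  unfolding push_keys_def
  by (rule sum.mono_neutral_left) (use assms in \<open>auto simp: in_keys_iff\<close>)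

lemma push_keys_zero [simp]: "push_keys g 0 = 0"
  by (simp add: push_keys_def)

lemma push_keys_single [simp]:
  "push_keys g (Poly_Mapping.single k c) = Poly_Mapping.single (g k) c"
  by (simp add: push_keys_def)

lemma push_keys_add: "push_keys g (f + h) = push_keys g f + push_keys g h"
proof -
  let ?S = "Poly_Mapping.keys f \<union> Poly_Mapping.keys h"
  have "push_keys g (f + h)
      = (\<Sum>k\<in>?S. Poly_Mapping.single (g k) (Poly_Mapping.lookup (f + h) k))"
    by (rule push_keys_superset) (use Poly_Mapping.keys_add[of f h] in auto)
  also have "\<dots> = (\<Sum>k\<in>?S. Poly_Mapping.single (g k) (Poly_Mapping.lookup f k))
      + (\<Sum>k\<in>?S. Poly_Mapping.single (g k) (Poly_Mapping.lookup h k))"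
    by (simp add: lookup_add single_add sum.distrib)
  also have "\<dots> = push_keys g f + push_keys g h"
    by (simp add: push_keys_superset[of ?S f] push_keys_superset[of ?S h])
  finally show ?thesis .
qed

lemma push_keys_sum: "push_keys g (sum F A) = (\<Sum>a\<in>A. push_keys g (F a))"
  by (induction A rule: infinite_finite_induct) (simp_all add: push_keys_add)

lemma push_keys_id: "push_keys (\<lambda>k. k) f = f"
  unfolding push_keys_def
  by (rule poly_mapping_eqI)
    (simp add: lookup_sum lookup_single when_def in_keys_iff)

lemma push_keys_mult:
  fixes f h :: "'a::monoid_add \<Rightarrow>\<^sub>0 'c::semiring_0" and g :: "'a \<Rightarrow> 'b::monoid_add"
  assumes "\<And>a b. g (a + b) = g a + g b"
  shows "push_keys g (f * h) = push_keys g f * push_keys g h"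
proof -
  let ?s = "\<lambda>f k. Poly_Mapping.single k (Poly_Mapping.lookup f k)"
  have *: "f = (\<Sum>k\<in>Poly_Mapping.keys f. ?s f k)" for f :: "'a \<Rightarrow>\<^sub>0 'c"
    using push_keys_id[of f] by (simp add: push_keys_def)
  have "f * h = (\<Sum>k\<in>Poly_Mapping.keys f. ?s f k) * (\<Sum>l\<in>Poly_Mapping.keys h. ?s h l)"
    by (rule arg_cong2[where f = times, OF * *])
  also have "\<dots> = (\<Sum>k\<in>Poly_Mapping.keys f. \<Sum>l\<in>Poly_Mapping.keys h. ?s f k * ?s h l)"
    by (rule sum_product)
  finally have "push_keys g (f * h)
      = (\<Sum>k\<in>Poly_Mapping.keys f. \<Sum>l\<in>Poly_Mapping.keys h. push_keys g (?s f k * ?s h l))"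
    by (simp only: push_keys_sum)
  then show ?thesis
    by (simp only: push_keys_def[of g f] push_keys_def[of g h] sum_product mult_single
        push_keys_single assms)
qed

lemma lookup_push_keys:
  assumes "inj g"
  shows "Poly_Mapping.lookup (push_keys g f) (g k) = Poly_Mapping.lookup f k"
  using assms
  by (simp add: push_keys_def lookup_sum lookup_single when_def inj_eq in_keys_iff)

lemma inj_push_keys:
  assumes "inj g"
  shows "inj (push_keys g :: ('a \<Rightarrow>\<^sub>0 'c::comm_monoid_add) \<Rightarrow> _)"
proof (rule injI, rule poly_mapping_eqI)
  fix f h :: "'a \<Rightarrow>\<^sub>0 'c" and k
  assume "push_keys g f = push_keys g h"
  then have "Poly_Mapping.lookup (push_keys g f) (g k) = Poly_Mapping.lookup (push_keys g h) (g k)"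
    by (rule arg_cong)
  then show "Poly_Mapping.lookup f k = Poly_Mapping.lookup h k"
    by (simp only: lookup_push_keys[OF assms])
qed

definition rename_laurent :: "(xyvar \<Rightarrow> xyvar) \<Rightarrow> laurent \<Rightarrow> laurent"
  where "rename_laurent \<rho> = push_keys (push_keys \<rho>)"

lemma rename_laurent_mult:
  "rename_laurent \<rho> (f * h) = rename_laurent \<rho> f * rename_laurent \<rho> h"
  unfolding rename_laurent_def by (rule push_keys_mult) (rule push_keys_add)

lemma rename_laurent_eq_0_iff:
  assumes "inj \<rho>"
  shows "rename_laurent \<rho> f = 0 \<longleftrightarrow> f = 0"
proof -
  have "inj (rename_laurent \<rho>)"
    unfolding rename_laurent_def by (intro inj_push_keys assms)
  then have "rename_laurent \<rho> f = rename_laurent \<rho> 0 \<longleftrightarrow> f = 0"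
    by (rule inj_eq)
  then show ?thesis
    by (simp add: rename_laurent_def)
qed

text \<open>\<open>rename \<rho> F\<close> is \<open>F\<close> with every variable \<open>z\<close> replaced by \<open>\<rho> z\<close>. For a map \<open>\<rho>\<close> that is not
  injective the substitution could annihilate a denominator; such maps never occur below, and the
  value 0 is a dummy.\<close>

lift_definition rename :: "(xyvar \<Rightarrow> xyvar) \<Rightarrow> ratfun \<Rightarrow> ratfun"
  is "\<lambda>\<rho> q. if inj \<rho> then (rename_laurent \<rho> (fst q), rename_laurent \<rho> (snd q)) else (0, 1)"
proof -
  fix \<rho> :: "xyvar \<Rightarrow> xyvar" and p q :: "laurent \<times> laurent"
  assume pq: "fractrel p q"
  then have "rename_laurent \<rho> (fst p * snd q) = rename_laurent \<rho> (fst q * snd p)"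
    by simp
  then show "fractrel (if inj \<rho> then (rename_laurent \<rho> (fst p), rename_laurent \<rho> (snd p)) else (0, 1))
     (if inj \<rho> then (rename_laurent \<rho> (fst q), rename_laurent \<rho> (snd q)) else (0, 1))"
    using pq by (simp add: rename_laurent_eq_0_iff rename_laurent_mult)
qed

lemma rename_Fract:
  assumes "inj \<rho>" "b \<noteq> 0"
  shows "rename \<rho> (Fraction_Field.Fract a b)
    = Fraction_Field.Fract (rename_laurent \<rho> a) (rename_laurent \<rho> b)"
  using assms by (simp add: Fraction_Field.Fract.abs_eq rename.abs_eq rename_laurent_eq_0_iff)

lemma rename_rat_var:
  assumes "inj \<rho>"
  shows "rename \<rho> (rat_var z) = rat_var (\<rho> z)"
proof -
  have "rename_laurent \<rho> (Poly_Mapping.single 0 1) = Poly_Mapping.single 0 1"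
    by (simp add: rename_laurent_def del: single_one)
  then have "rename_laurent \<rho> 1 = 1"
    by simp
  with assms show ?thesis
    by (simp add: rat_var_def of_laurent_def rename_Fract) (simp add: rename_laurent_def)
qed

definition rename_xy :: "(nat \<Rightarrow> nat) \<Rightarrow> (nat \<Rightarrow> nat) \<Rightarrow> ratfun \<Rightarrow> ratfun"
  where "rename_xy \<sigma> \<tau> = rename (\<lambda>z. case z of XV i \<Rightarrow> XV (\<sigma> i) | YV j \<Rightarrow> YV (\<tau> j))"

lemma rename_xy_vars:
  assumes "inj \<sigma>" "inj \<tau>"
  shows "rename_xy \<sigma> \<tau> (xvar i) = xvar (\<sigma> i)" "rename_xy \<sigma> \<tau> (yvar j) = yvar (\<tau> j)"
proof -
  have "inj (\<lambda>z. case z of XV i \<Rightarrow> XV (\<sigma> i) | YV j \<Rightarrow> YV (\<tau> j))"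
    by (rule injI) (auto split: xyvar.split_asm dest: injD[OF assms(1)] injD[OF assms(2)])
  then show "rename_xy \<sigma> \<tau> (xvar i) = xvar (\<sigma> i)" "rename_xy \<sigma> \<tau> (yvar j) = yvar (\<tau> j)"
    by (simp_all add: rename_xy_def rename_rat_var)
qed


section \<open>The shuffle algebra\<close>

definition skew_symmetric :: "nat \<Rightarrow> nat \<Rightarrow> ratfun \<Rightarrow> bool"
  where "skew_symmetric n m F \<longleftrightarrow>
    (\<forall>\<sigma>. \<sigma> permutes {1..n} \<longrightarrow> rename_xy \<sigma> id F = of_int (sign \<sigma>) * F) \<and>
    (\<forall>\<tau>. \<tau> permutes {1..m} \<longrightarrow> rename_xy id \<tau> F = of_int (sign \<tau>) * F)"

definition Lambda_comp :: "nat \<Rightarrow> nat \<Rightarrow> ratfun set"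
  where "Lambda_comp n m =
    {F. skew_symmetric n m F \<and>
        (\<exists>f\<in>laurent_in n m.
           F = of_laurent f / (\<Prod>i\<in>{1..n}. \<Prod>j\<in>{1..m}. xvar i - yvar j))}"

definition ASym :: "nat \<Rightarrow> nat \<Rightarrow> ratfun \<Rightarrow> ratfun"
  where "ASym n m F =
    (\<Sum>\<sigma> | \<sigma> permutes {1..n}. \<Sum>\<tau> | \<tau> permutes {1..m}.
       of_int (sign \<sigma>) * of_int (sign \<tau>) * rename_xy \<sigma> \<tau> F) / of_nat (fact n * fact m)"

definition shuffle_comp :: "nat \<times> nat \<Rightarrow> nat \<times> nat \<Rightarrow> ratfun \<Rightarrow> ratfun \<Rightarrow> ratfun"
  where "shuffle_comp = (\<lambda>(k1, l1) (k2, l2) F G.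
    ASym (k1 + k2) (l1 + l2)
      (F * rename_xy (\<lambda>i. k1 + i) (\<lambda>j. l1 + j) G
       * (\<Prod>i\<in>{1..k1}. \<Prod>j\<in>{l1<..l1 + l2}.
            (xvar i + rat_const (inverse v_indet) * yvar j) / (xvar i - yvar j))
       * (\<Prod>i\<in>{k1<..k1 + k2}. \<Prod>j\<in>{1..l1}.
            (yvar j + rat_const (inverse v_indet) * xvar i) / (yvar j - xvar i))))"

text \<open>An element of the direct sum is a finitely supported family indexed by bidegrees, and the
  product extends the product of homogeneous elements bilinearly.\<close>

type_synonym graded = "(nat \<times> nat) \<Rightarrow>\<^sub>0 ratfun"

definition shuffle :: "graded \<Rightarrow> graded \<Rightarrow> graded"  (infixl \<open>\<star>\<close> 70)
  where "F \<star> G =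
    (\<Sum>d\<in>Poly_Mapping.keys F. \<Sum>e\<in>Poly_Mapping.keys G.
       Poly_Mapping.single (d + e)
         (shuffle_comp d e (Poly_Mapping.lookup F d) (Poly_Mapping.lookup G e)))"

definition Lambda :: "(Cv, graded) module"
  where "Lambda =
    \<lparr>carrier = {F. \<forall>n m. Poly_Mapping.lookup F (n, m) \<in> Lambda_comp n m},
     mult = shuffle, one = Poly_Mapping.single (0, 0) 1, zero = 0, add = plus,
     smult = (\<lambda>c. Poly_Mapping.map (\<lambda>F. rat_const c * F))\<rparr>"

definition Lambda_x :: "int \<Rightarrow> graded"
  where "Lambda_x i = Poly_Mapping.single (1, 0) (xvar 1 powi i)"

definition Lambda_y :: "int \<Rightarrow> graded"
  where "Lambda_y j = Poly_Mapping.single (0, 1) (yvar 1 powi j)"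

end

theory Submission
  imports Defs
begin

text \<open>
  Clearing denominators turns \<open>\<Lambda>\<^sub>n\<^sub>,\<^sub>m\<close> into skew-symmetric Laurent polynomials, with a shuffle
  product whose kernel is \<open>\<kappa>(x,y) = x + v\<inverse>y\<close>, \<open>\<kappa>(y,x) = -(y + v\<inverse>x)\<close> and \<open>\<kappa> = \<plusminus>1\<close> for variables
  of equal type. For a finite set \<open>S\<close> of variables let \<open>A\<^sub>z = \<Prod>\<^bsub>z' \<in> S - {z}\<^esub> \<kappa>(z,z')\<close>
  (\<open>front S z\<close> below) for \<open>z \<in> S\<close>. These
  generate the unit ideal: in a prime ideal containing all of them every variable would be congruent
  to \<open>-v\<inverse>\<close> times another one, and a cycle of such congruences is impossible because \<open>v\<close> is not a root of
  unity. A partition of unity \<open>1 = \<Sum> c\<^sub>z A\<^sub>z\<close> gives surjectivity by induction on the number of variables,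
  since the antisymmetrization of \<open>A\<^sub>z f\<close> is a sum of shuffle products with a generator on the left. It
  also gives a left inverse: functions from exponents to \<open>U\<close> form a module over the Laurent
  polynomials, and the recursion \<open>E\<^sub>S = \<Sum> c\<^sub>z (z \<circ> E\<^bsub>S - {z}\<^esub>)\<close> yields a family (\<open>dual\<close>) with
  \<open>A\<^sub>z E\<^sub>S = z \<circ> E\<^bsub>S - {z}\<^esub>\<close> for every \<open>z\<close>, by the defining relations alone. Pairing a numerator with
  \<open>E\<^sub>S\<close> sends the image of a word back to that word, which proves injectivity.
\<close>

section \<open>Laurent polynomials\<close>

text \<open>Morally \<open>dual S\<close> is the product of the generating currents attached to the
  variables in S, taken in any order and divided by the matching product of kernels. The relations
  say that this quotient does not depend on the order, but the kernels are not invertible, so the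
  division itself makes no sense in U. The partition of unity replaces it: the family is glued from
  the local candidates "z \<circ> E_{S-{z}} divided by A_z", and the relations supply the
  compatibility A_z (t \<circ> E_{S-{t}}) = A_t (z \<circ> E_{S-{z}}) that gluing demands. The price
  is a sign. Exchanging two variables of equal type must change the sign of E_S, whereas a set S
  carries no order. \<open>swap_sign\<close> therefore borrows the fixed linear order on the
  variables, and \<open>order_sign\<close> records how a renaming disturbs it; for type-preserving
  permutations of S this is the usual sign.\<close>

definition lconst :: "Cv \<Rightarrow> laurent"
  where "lconst c = Poly_Mapping.single 0 c"

definition lmon :: "(xyvar \<Rightarrow>\<^sub>0 int) \<Rightarrow> laurent"
  where "lmon e = Poly_Mapping.single e 1"

abbreviation lvar :: "xyvar \<Rightarrow> laurent"
  where "lvar z \<equiv> lmon (Poly_Mapping.single z 1)"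

definition lvars :: "laurent \<Rightarrow> xyvar set"
  where "lvars f = (\<Union>e\<in>Poly_Mapping.keys f. Poly_Mapping.keys e)"

lemma lconst_0 [simp]: "lconst 0 = 0"
  and lconst_1 [simp]: "lconst 1 = 1"
  and lconst_add: "lconst (a + b) = lconst a + lconst b"
  and lconst_mult: "lconst (a * b) = lconst a * lconst b"
  and lconst_uminus: "lconst (- a) = - lconst a"
  and lconst_diff: "lconst (a - b) = lconst a - lconst b"
  by (simp_all add: lconst_def single_add mult_single single_uminus single_diff)

lemma lconst_of_int: "lconst (of_int k) = of_int k"
  by (simp add: lconst_def)

lemma lmon_0 [simp]: "lmon 0 = 1"
  and lmon_add: "lmon (a + b) = lmon a * lmon b"
  by (simp_all add: lmon_def mult_single)

lemma lconst_times_lmon: "lconst c * lmon e = Poly_Mapping.single e c"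
  by (simp add: lconst_def lmon_def mult_single)

lemma laurent_expand:
  "f = (\<Sum>e\<in>Poly_Mapping.keys f. lconst (Poly_Mapping.lookup f e) * lmon e)"
  using push_keys_id[of f] by (simp add: push_keys_def lconst_times_lmon)

lemma laurent_induct [case_names add monomial]:
  assumes "\<And>f g. P f \<Longrightarrow> P g \<Longrightarrow> P (f + g)"
    and "\<And>c e. P (lconst c * lmon e)"
  shows "P (f :: laurent)"
proof -
  have "P 0" using assms(2)[of 0] by simp
  then have "P (\<Sum>e\<in>A. lconst (Poly_Mapping.lookup f e) * lmon e)" for A
    by (induction A rule: infinite_finite_induct) (auto intro: assms)
  then show ?thesis by (subst laurent_expand)
qed

lemma laurent_in_iff: "f \<in> laurent_in n m \<longleftrightarrow> lvars f \<subseteq> XV ` {1..n} \<union> YV ` {1..m}"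
  unfolding laurent_in_def lvars_def by blast

lemma lvars_0 [simp]: "lvars 0 = {}"
  and lvars_1 [simp]: "lvars 1 = {}"
  and lvars_lconst [simp]: "lvars (lconst c) = {}"
  and lvars_lmon [simp]: "lvars (lmon e) = Poly_Mapping.keys e"
  by (auto simp: lvars_def lconst_def lmon_def)

lemma lvars_add: "lvars (f + g) \<subseteq> lvars f \<union> lvars g"
  unfolding lvars_def using Poly_Mapping.keys_add[of f g] by blast

lemma lvars_mult: "lvars (f * g) \<subseteq> lvars f \<union> lvars g"
proof
  fix z assume "z \<in> lvars (f * g)"
  then obtain e where e: "e \<in> Poly_Mapping.keys (f * g)" "z \<in> Poly_Mapping.keys e"
    by (auto simp: lvars_def)
  then obtain a b where ab: "e = a + b" "a \<in> Poly_Mapping.keys f" "b \<in> Poly_Mapping.keys g"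
    using Poly_Mapping.keys_mult[of f g] by blast
  then have "z \<in> Poly_Mapping.keys a \<union> Poly_Mapping.keys b"
    using e(2) Poly_Mapping.keys_add[of a b] by blast
  then show "z \<in> lvars f \<union> lvars g"
    using ab unfolding lvars_def by blast
qed

lemma lvars_add_le: "lvars f \<subseteq> S \<Longrightarrow> lvars g \<subseteq> S \<Longrightarrow> lvars (f + g) \<subseteq> S"
  and lvars_mult_le: "lvars f \<subseteq> S \<Longrightarrow> lvars g \<subseteq> S \<Longrightarrow> lvars (f * g) \<subseteq> S"
  using lvars_add lvars_mult by blast+

lemma lvars_sum_le: "(\<And>a. a \<in> A \<Longrightarrow> lvars (F a) \<subseteq> S) \<Longrightarrow> lvars (sum F A) \<subseteq> S"
  by (induction A rule: infinite_finite_induct) (simp_all add: lvars_add_le)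

lemma lvars_prod_le: "(\<And>a. a \<in> A \<Longrightarrow> lvars (F a) \<subseteq> S) \<Longrightarrow> lvars (prod F A) \<subseteq> S"
  by (induction A rule: infinite_finite_induct) (simp_all add: lvars_mult_le)

lemma lvars_of_int [simp]: "lvars (of_int k) = {}"
  using lvars_lconst[of "of_int k"] by (simp only: lconst_of_int)

section \<open>Renaming the variables of Laurent polynomials\<close>

lemma push_keys_comp: "push_keys g (push_keys h f) = push_keys (g \<circ> h) f"
  unfolding push_keys_def[of h f] by (simp add: push_keys_sum) (simp add: push_keys_def)

lemma push_keys_cong:
  "(\<And>k. k \<in> Poly_Mapping.keys f \<Longrightarrow> g k = h k) \<Longrightarrow> push_keys g f = push_keys h f"
  unfolding push_keys_def by simp

lemma rename_laurent_add: "rename_laurent \<rho> (f + g) = rename_laurent \<rho> f + rename_laurent \<rho> g"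
  and rename_laurent_0 [simp]: "rename_laurent \<rho> 0 = 0"
  and rename_laurent_lconst [simp]: "rename_laurent \<rho> (lconst c) = lconst c"
  and rename_laurent_lmon: "rename_laurent \<rho> (lmon e) = lmon (push_keys \<rho> e)"
  by (simp_all add: rename_laurent_def push_keys_add lconst_def lmon_def)

lemma rename_laurent_1 [simp]: "rename_laurent \<rho> 1 = 1"
  using rename_laurent_lconst[of \<rho> 1] by simp

lemma rename_laurent_of_int [simp]: "rename_laurent \<rho> (of_int k) = of_int k"
  using rename_laurent_lconst[of \<rho> "of_int k"] by (simp only: lconst_of_int)

lemma rename_laurent_uminus: "rename_laurent \<rho> (- f) = - rename_laurent \<rho> f"
  using rename_laurent_mult[of \<rho> "of_int (-1)" f] by (simp del: rename_laurent_of_int add: rename_laurent_of_int[of _ "-1", simplified])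

lemma rename_laurent_sum: "rename_laurent \<rho> (sum F A) = (\<Sum>a\<in>A. rename_laurent \<rho> (F a))"
  by (induction A rule: infinite_finite_induct) (simp_all add: rename_laurent_add)

lemma rename_laurent_prod: "rename_laurent \<rho> (prod F A) = (\<Prod>a\<in>A. rename_laurent \<rho> (F a))"
  by (induction A rule: infinite_finite_induct) (simp_all add: rename_laurent_mult)

lemma rename_laurent_comp:
  "rename_laurent \<rho> (rename_laurent \<rho>' f) = rename_laurent (\<rho> \<circ> \<rho>') f"
  by (simp add: rename_laurent_def push_keys_comp comp_def)

lemma rename_laurent_lvar [simp]: "rename_laurent \<rho> (lvar z) = lvar (\<rho> z)"
  by (simp add: rename_laurent_lmon)

lemma rename_laurent_cong:
  assumes "\<And>z. z \<in> lvars f \<Longrightarrow> \<rho> z = \<rho>' z"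
  shows "rename_laurent \<rho> f = rename_laurent \<rho>' f"
  unfolding rename_laurent_def
  by (intro push_keys_cong) (use assms in \<open>auto simp: lvars_def\<close>)

lemma rename_laurent_id [simp]: "rename_laurent (\<lambda>z. z) f = f" "rename_laurent id f = f"
  by (simp_all add: rename_laurent_def push_keys_id id_def ext[where f="push_keys (\<lambda>x. x)" and g="\<lambda>x. x", OF push_keys_id])

lemma keys_push_keys: "Poly_Mapping.keys (push_keys g f) \<subseteq> g ` Poly_Mapping.keys f"
  unfolding push_keys_def by (rule order.trans[OF keys_sum]) (auto split: if_splits)

lemma lvars_rename: "lvars (rename_laurent \<rho> f) \<subseteq> \<rho> ` lvars f"
proof
  fix z assume "z \<in> lvars (rename_laurent \<rho> f)"
  then obtain e where e: "e \<in> Poly_Mapping.keys (rename_laurent \<rho> f)" "z \<in> Poly_Mapping.keys e"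
    by (auto simp: lvars_def)
  then obtain d where "d \<in> Poly_Mapping.keys f" "e = push_keys \<rho> d"
    using keys_push_keys[of "push_keys \<rho>" f] unfolding rename_laurent_def by blast
  then show "z \<in> \<rho> ` lvars f"
    using e(2) keys_push_keys[of \<rho> d] unfolding lvars_def by blast
qed

section \<open>The kernel of the shuffle product\<close>

primrec is_X :: "xyvar \<Rightarrow> bool"
  where "is_X (XV i) = True" | "is_X (YV j) = False"

text \<open>The sign for \<open>z\<close> of type Y turns the denominator y - x of the shuffle
  kernel into x - y, so that all denominators multiply up to the common one.\<close>

definition kernel_xy :: "xyvar \<Rightarrow> xyvar \<Rightarrow> laurent"
  where "kernel_xy z z' =
    (if is_X z = is_X z' then 1
     else of_int (if is_X z then 1 else - 1) * (lvar z + lconst (inverse v_indet) * lvar z'))"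

definition swap_sign :: "xyvar \<Rightarrow> xyvar \<Rightarrow> int"
  where "swap_sign z z' = (if is_X z = is_X z' \<and> z' < z then - 1 else 1)"

text \<open>The sign makes the relation \<open>kernel_signed z z' \<cdot> z' \<circ> z = kernel_signed z' z \<cdot> z \<circ> z'\<close>, which is
  the mixed relation for variables of different type, express anticommutativity for variables of
  the same type.\<close>

definition kernel_signed :: "xyvar \<Rightarrow> xyvar \<Rightarrow> laurent"
  where "kernel_signed z z' = of_int (swap_sign z z') * kernel_xy z z'"

definition front :: "xyvar set \<Rightarrow> xyvar \<Rightarrow> laurent"
  where "front S z = (\<Prod>z'\<in>S - {z}. kernel_signed z z')"

definition type_preserving :: "(xyvar \<Rightarrow> xyvar) \<Rightarrow> bool"
  where "type_preserving \<rho> \<longleftrightarrow> (\<forall>z. is_X (\<rho> z) = is_X z)"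

lemma type_preservingD [simp]: "type_preserving \<rho> \<Longrightarrow> is_X (\<rho> z) = is_X z"
  by (simp add: type_preserving_def)

lemma rename_kernel_xy:
  "type_preserving \<rho> \<Longrightarrow> rename_laurent \<rho> (kernel_xy z z') = kernel_xy (\<rho> z) (\<rho> z')"
  by (simp add: kernel_xy_def rename_laurent_mult rename_laurent_add rename_laurent_uminus)

lemma lvars_kernel_xy: "lvars (kernel_xy z z') \<subseteq> {z, z'}"
proof -
  have "lvars (of_int k * (lvar z + lconst (inverse v_indet) * lvar z')) \<subseteq> {z, z'}" for k
    by (intro lvars_mult_le lvars_add_le) simp_all
  then show ?thesis by (simp only: kernel_xy_def split: if_split) simp
qed

lemma lvars_kernel_signed: "lvars (kernel_signed z z') \<subseteq> {z, z'}"
  unfolding kernel_signed_def by (intro lvars_mult_le lvars_kernel_xy) simp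

lemma lvars_front: "z \<in> S \<Longrightarrow> lvars (front S z) \<subseteq> S"
  unfolding front_def by (intro lvars_prod_le) (use lvars_kernel_signed in fastforce)

lemma front_remove:
  assumes "finite S" "z' \<in> S" "z' \<noteq> z"
  shows "front S z = kernel_signed z z' * front (S - {z'}) z"
proof -
  have "S - {z'} - {z} = S - {z} - {z'}" by blast
  with assms show ?thesis
    unfolding front_def by (simp add: prod.remove[of "S - {z}" z'])
qed

section \<open>A partition of unity\<close>

definition ideal_set :: "laurent set \<Rightarrow> bool"
  where "ideal_set I \<longleftrightarrow> 0 \<in> I \<and> (\<forall>a\<in>I. \<forall>b\<in>I. a + b \<in> I) \<and> (\<forall>a\<in>I. \<forall>r. r * a \<in> I)"

definition adjoin :: "laurent set \<Rightarrow> laurent \<Rightarrow> laurent set"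
  where "adjoin I a = {i + r * a | i r. i \<in> I}"

lemma ideal_adjoin:
  assumes "ideal_set I" shows "ideal_set (adjoin I a)" "I \<subseteq> adjoin I a" "a \<in> adjoin I a"
proof -
  have "x + y \<in> adjoin I a" if xy: "x \<in> adjoin I a" "y \<in> adjoin I a" for x y
  proof -
    from xy obtain i r j s where "x = i + r * a" "y = j + s * a" "i \<in> I" "j \<in> I"
      by (auto simp: adjoin_def)
    then have "x + y = (i + j) + (r + s) * a" "i + j \<in> I"
      using assms by (auto simp: algebra_simps ideal_set_def)
    then show ?thesis by (auto simp: adjoin_def)
  qed
  moreover have "t * x \<in> adjoin I a" if x: "x \<in> adjoin I a" for x t
  proof -
    from x obtain i r where "x = i + r * a" "i \<in> I" by (auto simp: adjoin_def)
    then have "t * x = t * i + (t * r) * a" "t * i \<in> I"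
      using assms by (auto simp: algebra_simps ideal_set_def)
    then show ?thesis by (auto simp: adjoin_def)
  qed
  moreover show sub: "I \<subseteq> adjoin I a"
  proof
    fix i assume "i \<in> I"
    then show "i \<in> adjoin I a" unfolding adjoin_def by (intro CollectI exI[of _ i] exI[of _ 0]) simp
  qed
  moreover have "0 \<in> I" using assms by (simp add: ideal_set_def)
  ultimately show "ideal_set (adjoin I a)" by (auto simp: ideal_set_def)
  show "a \<in> adjoin I a"
    using \<open>0 \<in> I\<close> unfolding adjoin_def by (intro CollectI exI[of _ 0] exI[of _ 1]) simp
qed

text \<open>If every \<open>adjoin I (a t)\<close> contained 1, multiplying the equations 1 = i + r
  * a t would put 1 into I plus multiples of the whole product, hence into I. This plays the role of
  primality: a proper ideal containing a product can be enlarged by one of the factors and stay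
  proper.\<close>

lemma adjoin_factor:
  assumes I: "ideal_set I" and "finite T" "(\<Prod>t\<in>T. a t) \<in> I" "1 \<notin> I"
  shows "\<exists>t\<in>T. 1 \<notin> adjoin I (a t)"
proof (rule ccontr)
  assume "\<not> ?thesis"
  then have *: "1 \<in> adjoin I (a t)" if "t \<in> T" for t using that by blast
  have "\<exists>i\<in>I. \<exists>r. 1 = i + r * (\<Prod>t\<in>T'. a t)" if "T' \<subseteq> T" for T'
    using finite_subset[OF that \<open>finite T\<close>] that
  proof (induction T' rule: finite_induct)
    case empty
    have "0 \<in> I" using I by (simp add: ideal_set_def)
    then show ?case by (intro bexI[of _ 0] exI[of _ 1]) simp_all
  next
    case (insert t T')
    then obtain i r where ir: "i \<in> I" "1 = i + r * prod a T'" by auto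
    have "1 \<in> adjoin I (a t)" using * insert.prems by simp
    then obtain j s where js: "j \<in> I" "1 = j + s * a t"
      unfolding adjoin_def by blast
    have "1 = (i + r * prod a T') * (j + s * a t)" by (simp flip: ir(2) js(2))
    also have "\<dots> = ((j + s * a t) * i + (r * prod a T') * j) + (r * s) * (a t * prod a T')"
      by (simp add: algebra_simps)
    finally show ?case using I ir(1) js(1) insert.hyps
      by (intro bexI[of _ "(j + s * a t) * i + (r * prod a T') * j"] exI[of _ "r * s"])
        (auto simp: ideal_set_def)
  qed
  then obtain i r where "i \<in> I" "1 = i + r * prod a T" by blast
  with I assms(3) have "1 \<in> I" by (metis ideal_set_def)
  with assms(4) show False ..
qed

lemma v_indet_power_neq:
  assumes "k > 0" shows "(- inverse v_indet) ^ k \<noteq> 1"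
proof
  assume *: "(- inverse v_indet) ^ k = 1"
  have pow: "v_indet ^ k = Fraction_Field.Fract (monom 1 k) 1" for k
  proof (induction k)
    case 0
    show ?case by (simp add: One_fract_def monom_0 flip: one_pCons)
  next
    case (Suc k)
    then show ?case by (simp add: v_indet_def monom_Suc)
  qed
  have "v_indet \<noteq> 0" by (simp add: v_indet_def Zero_fract_def eq_fract)
  then have "(- 1) ^ k = ((- inverse v_indet) ^ k) * v_indet ^ k"
    by (simp flip: power_mult_distrib)
  then have "v_indet ^ k = (- 1) ^ k" using * by simp
  \<comment> \<open>Squaring removes the sign (-1)^k and leaves an equation between 1 and a monomial
    of degree 2k.\<close>
  moreover have "v_indet ^ (2 * k) = (v_indet ^ k) ^ 2" "((- 1 :: Cv) ^ k) ^ 2 = 1"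
    by (simp_all add: mult.commute flip: power_mult)
  ultimately have "v_indet ^ (2 * k) = 1" by simp
  then have "monom 1 (2 * k) = (1 :: complex poly)"
    by (simp add: pow One_fract_def eq_fract)
  then have "degree (monom (1::complex) (2 * k)) = 0" by simp
  with assms show False by (simp add: degree_monom_eq)
qed

text \<open>Only finitely many products have to be split, so the prime ideal is replaced by a proper
  ideal J, enlarged once for each \<open>z\<close> by a factor of \<open>front S z\<close>.\<close>

lemma ideal_set_fronts:
  assumes "finite S" "S \<noteq> {}" and I: "ideal_set I" and fronts: "\<And>z. z \<in> S \<Longrightarrow> front S z \<in> I"
  shows "1 \<in> I"
proof (rule ccontr)
  assume "1 \<notin> I"
  have "\<exists>J. ideal_set J \<and> I \<subseteq> J \<and> 1 \<notin> J \<and> (\<forall>z\<in>Z. \<exists>z'\<in>S - {z}. kernel_signed z z' \<in> J)"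
    if "Z \<subseteq> S" for Z
    using finite_subset[OF that \<open>finite S\<close>] that
  proof (induction Z rule: finite_induct)
    case empty
    then show ?case using I \<open>1 \<notin> I\<close> by blast
  next
    case (insert z Z)
    then obtain J where J: "ideal_set J" "I \<subseteq> J" "1 \<notin> J"
      "\<forall>z\<in>Z. \<exists>z'\<in>S - {z}. kernel_signed z z' \<in> J" by auto
    have "(\<Prod>z'\<in>S - {z}. kernel_signed z z') \<in> J"
      using fronts[of z] insert.prems J(2) by (auto simp: front_def)
    from adjoin_factor[OF J(1) _ this J(3)] \<open>finite S\<close>
    obtain z' where "z' \<in> S - {z}" "1 \<notin> adjoin J (kernel_signed z z')" by auto
    with J ideal_adjoin[OF J(1), of "kernel_signed z z'"] show ?case
      by (intro exI[of _ "adjoin J (kernel_signed z z')"]) blast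
  qed
  from this[OF order.refl] obtain J where J: "ideal_set J" "1 \<notin> J"
    and ex: "\<forall>z\<in>S. \<exists>z'\<in>S - {z}. kernel_signed z z' \<in> J" by blast
  have mult: "r * a \<in> J" if "a \<in> J" for r a using J(1) that by (simp add: ideal_set_def)
  have add: "a + b \<in> J" if "a \<in> J" "b \<in> J" for a b using J(1) that by (simp add: ideal_set_def)
  let ?c = "lconst (inverse v_indet)"
  have "\<exists>z'\<in>S. lvar z + ?c * lvar z' \<in> J" if "z \<in> S" for z
  proof -
    from ex that obtain z' where z': "z' \<in> S" "z' \<noteq> z" "kernel_signed z z' \<in> J" by blast
    have sq: "of_int (swap_sign z z') * kernel_signed z z' = kernel_xy z z'"
      by (simp add: kernel_signed_def swap_sign_def)
    then have k: "kernel_xy z z' \<in> J" using mult[OF z'(3)] by metis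
    \<comment> \<open>The kernel between variables of equal type is 1, which J does not
      contain.\<close>
    with J(2) have ne: "is_X z \<noteq> is_X z'" by (cases "is_X z = is_X z'") (simp_all add: kernel_xy_def)
    then have "of_int (if is_X z then 1 else - 1) * kernel_xy z z' = lvar z + ?c * lvar z'"
      by (simp add: kernel_xy_def)
    then show ?thesis using mult[OF k] z'(1) by metis
  qed
  then obtain nxt where nxt: "\<And>z. z \<in> S \<Longrightarrow> nxt z \<in> S"
    "\<And>z. z \<in> S \<Longrightarrow> lvar z + ?c * lvar (nxt z) \<in> J" by metis
  from \<open>S \<noteq> {}\<close> obtain z0 where "z0 \<in> S" by blast
  then have in_S: "(nxt ^^ k) z0 \<in> S" for k by (induction k) (auto intro: nxt)
  have step: "lvar z - lconst ((- inverse v_indet) ^ k) * lvar ((nxt ^^ k) z) \<in> J" if "z \<in> S" for z k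
  proof (induction k)
    case 0
    then show ?case using J(1) by (simp add: ideal_set_def)
  next
    case (Suc k)
    have "(nxt ^^ k) z \<in> S" using that by (induction k) (auto intro: nxt)
    from add[OF Suc mult[OF nxt(2)[OF this], of "lconst ((- inverse v_indet) ^ k)"]]
    show ?case by (simp add: algebra_simps lconst_mult lconst_uminus)
  qed
  \<comment> \<open>Iterating \<open>nxt\<close> stays inside the finite set S, so some iterate
    repeats and yields a cycle of length \<open>k\<close> through \<open>z\<close>.\<close>
  have "\<not> inj (\<lambda>k. (nxt ^^ k) z0)"
    using finite_subset[of "range (\<lambda>k. (nxt ^^ k) z0)" S] in_S \<open>finite S\<close> finite_imageD by blast
  then obtain a b where "a < b" "(nxt ^^ a) z0 = (nxt ^^ b) z0"
    unfolding inj_def by (metis linorder_neqE_nat)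
  then obtain k where k: "k > 0" "(nxt ^^ (a + k)) z0 = (nxt ^^ a) z0"
    by (metis add_diff_inverse_nat less_imp_not_less zero_less_diff)
  define z where "z = (nxt ^^ a) z0"
  have "z \<in> S" using in_S by (simp add: z_def)
  moreover have "(nxt ^^ k) z = z" using k(2) by (simp add: z_def add.commute[of a] funpow_add)
  ultimately have "lvar z - lconst ((- inverse v_indet) ^ k) * lvar z \<in> J"
    using step by metis
  then have "lconst (1 - (- inverse v_indet) ^ k) * lvar z \<in> J"
    by (simp add: lconst_diff left_diff_distrib)
  \<comment> \<open>The constant is invertible because (-1/v)^k is not 1, and every monomial is
    invertible, so J contains a unit.\<close>
  from mult[OF this, of "lconst (inverse (1 - (- inverse v_indet) ^ k)) * lmon (- Poly_Mapping.single z 1)"]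
  have "lconst (inverse (1 - (- inverse v_indet) ^ k) * (1 - (- inverse v_indet) ^ k))
      * lmon (- Poly_Mapping.single z 1 + Poly_Mapping.single z 1) \<in> J"
    by (simp only: lconst_mult lmon_add ac_simps)
  then have "1 \<in> J" using v_indet_power_neq[OF k(1)] by simp
  with J(2) show False ..
qed

text \<open>The retraction substitutes 1 for every variable outside S: \<open>res\<close> forgets
  the exponents outside S, and monomials that become equal are added. It serves to confine the
  coefficients of a partition of unity to the variables in S.\<close>

lemma restrict_laurent:
  "\<exists>r :: laurent \<Rightarrow> laurent. (\<forall>f g. r (f + g) = r f + r g) \<and> (\<forall>f g. r (f * g) = r f * r g)
    \<and> (\<forall>f. lvars (r f) \<subseteq> S) \<and> (\<forall>f. lvars f \<subseteq> S \<longrightarrow> r f = f)"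
proof -
  define res :: "(xyvar \<Rightarrow>\<^sub>0 int) \<Rightarrow> (xyvar \<Rightarrow>\<^sub>0 int)"
    where "res = Poly_Mapping.mapp (\<lambda>z k. k when z \<in> S)"
  have lookup_res: "Poly_Mapping.lookup (res e) z = (Poly_Mapping.lookup e z when z \<in> S)" for e z
    by (auto simp: res_def lookup_mapp when_def in_keys_iff)
  then have add: "res (a + b) = res a + res b" for a b
    by (intro poly_mapping_eqI) (auto simp: lookup_add when_def)
  have sub: "Poly_Mapping.keys (res e) \<subseteq> S" for e
    by (auto simp: in_keys_iff lookup_res when_def split: if_splits)
  have eq: "res e = e" if "Poly_Mapping.keys e \<subseteq> S" for e
    using that by (intro poly_mapping_eqI) (auto simp: lookup_res when_def in_keys_iff)
  show ?thesis
  proof (intro exI[of _ "push_keys res"] conjI allI impI)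
    show "push_keys res (f + g) = push_keys res f + push_keys res g" for f g :: laurent
      by (rule push_keys_add)
    show "push_keys res (f * g) = push_keys res f * push_keys res g" for f g :: laurent
      by (rule push_keys_mult) (rule add)
    show "lvars (push_keys res f) \<subseteq> S" for f
      using keys_push_keys[of res f] sub unfolding lvars_def by blast
    show "push_keys res f = f" if "lvars f \<subseteq> S" for f
    proof -
      have "push_keys res f = push_keys (\<lambda>k. k) f"
        by (rule push_keys_cong, rule eq) (use that in \<open>auto simp: lvars_def\<close>)
      then show ?thesis by (simp add: push_keys_id)
    qed
  qed
qed

lemma partition_of_unity:
  assumes "finite S" "S \<noteq> {}"
  shows "\<exists>c. (\<Sum>z\<in>S. c z * front S z) = 1 \<and> (\<forall>z. lvars (c z) \<subseteq> S)"
proof -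
  define I where "I = {\<Sum>z\<in>S. c z * front S z | c. True}"
  have "ideal_set I"
    unfolding ideal_set_def
  proof (intro conjI ballI allI)
    show "0 \<in> I" unfolding I_def by (intro CollectI exI[of _ "\<lambda>_. 0"]) simp
  next
    fix a b assume "a \<in> I" "b \<in> I"
    then obtain c d where "a = (\<Sum>z\<in>S. c z * front S z)" "b = (\<Sum>z\<in>S. d z * front S z)"
      by (auto simp: I_def)
    then show "a + b \<in> I" unfolding I_def
      by (intro CollectI exI[of _ "\<lambda>z. c z + d z"]) (simp add: sum.distrib algebra_simps)
  next
    fix a r assume "a \<in> I"
    then obtain c where "a = (\<Sum>z\<in>S. c z * front S z)" by (auto simp: I_def)
    then show "r * a \<in> I" unfolding I_def
      by (intro CollectI exI[of _ "\<lambda>z. r * c z"]) (simp add: sum_distrib_left mult.assoc)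
  qed
  moreover have "front S z \<in> I" if "z \<in> S" for z
    unfolding I_def using \<open>finite S\<close> that
    by (intro CollectI exI[of _ "\<lambda>t. if t = z then 1 else 0"]) (simp add: if_distrib[of "\<lambda>x. x * _"] cong: if_cong)
  ultimately have "1 \<in> I" by (rule ideal_set_fronts[OF assms])
  then obtain c where c: "1 = (\<Sum>z\<in>S. c z * front S z)"
    unfolding I_def mem_Collect_eq by (elim exE conjE)
  obtain r :: "laurent \<Rightarrow> laurent" where r: "\<forall>f g. r (f + g) = r f + r g"
    "\<forall>f g. r (f * g) = r f * r g" "\<forall>f. lvars (r f) \<subseteq> S" "\<forall>f. lvars f \<subseteq> S \<longrightarrow> r f = f"
    using restrict_laurent[of S] by (elim exE conjE)
  have r_sum: "r (sum F A) = (\<Sum>a\<in>A. r (F a))" for F and A :: "xyvar set"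
    by (induction A rule: infinite_finite_induct) (simp_all add: r(1,4))
  \<comment> \<open>The retraction fixes 1 and each \<open>front S z\<close>, so applying it changes
    only the coefficients.\<close>
  have "1 = r 1" by (simp add: r(4))
  also have "r 1 = r (\<Sum>z\<in>S. c z * front S z)" by (rule arg_cong[OF c])
  also have "\<dots> = (\<Sum>z\<in>S. r (c z) * front S z)"
    unfolding r_sum by (rule sum.cong) (simp_all add: r(2,4) lvars_front)
  finally show ?thesis using r(3) by (intro exI[of _ "\<lambda>z. r (c z)"]) simp
qed

section \<open>Type-preserving permutations\<close>

definition type_perms :: "xyvar set \<Rightarrow> (xyvar \<Rightarrow> xyvar) set"
  where "type_perms S = {\<pi>. \<pi> permutes S \<and> type_preserving \<pi>}"

definition perm_X :: "(xyvar \<Rightarrow> xyvar) \<Rightarrow> xyvar \<Rightarrow> xyvar"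
  where "perm_X \<pi> z = (if is_X z then \<pi> z else z)"

definition perm_Y :: "(xyvar \<Rightarrow> xyvar) \<Rightarrow> xyvar \<Rightarrow> xyvar"
  where "perm_Y \<pi> z = (if is_X z then z else \<pi> z)"

lemma type_perms_split:
  assumes "\<pi> \<in> type_perms S" "finite S"
  shows "perm_X \<pi> permutes {z\<in>S. is_X z}" "perm_Y \<pi> permutes {z\<in>S. \<not> is_X z}"
    "\<pi> = perm_X \<pi> \<circ> perm_Y \<pi>"
proof -
  have p: "\<pi> permutes S" "\<And>z. is_X (\<pi> z) = is_X z"
    using assms by (auto simp: type_perms_def)
  have inj: "\<pi> z = \<pi> z' \<Longrightarrow> z = z'" for z z'
    using injD[OF permutes_inj[OF p(1)]] .
  have S: "z \<in> S \<Longrightarrow> \<pi> z \<in> S" "z \<notin> S \<Longrightarrow> \<pi> z = z" for z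
    by (simp only: permutes_in_image[OF p(1)], rule permutes_not_in[OF p(1)])
  show "perm_X \<pi> permutes {z\<in>S. is_X z}"
    by (rule inj_imp_permutes) (auto simp: perm_X_def inj_on_def assms(2) p(2) S dest: inj)
  show "perm_Y \<pi> permutes {z\<in>S. \<not> is_X z}"
    by (rule inj_imp_permutes) (auto simp: perm_Y_def inj_on_def assms(2) p(2) S dest: inj)
  show "\<pi> = perm_X \<pi> \<circ> perm_Y \<pi>"
    using p(2) by (auto simp: fun_eq_iff perm_X_def perm_Y_def)
qed

lemma transpose_type_perms:
  assumes "a \<in> S" "b \<in> S" "is_X a = is_X b"
  shows "transpose a b \<in> type_perms S"
proof -
  have "is_X (transpose a b z) = is_X z" for z
    using assms(3) by (cases "z = a"; cases "z = b") (auto simp: transpose_def)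
  then show ?thesis
    using assms by (simp add: type_perms_def permutes_swap_id type_preserving_def)
qed

lemma type_perms_comp: "\<pi> \<in> type_perms S \<Longrightarrow> \<pi>' \<in> type_perms S \<Longrightarrow> \<pi> \<circ> \<pi>' \<in> type_perms S"
  by (simp add: type_perms_def permutes_compose type_preserving_def)

lemma type_perms_id: "id \<in> type_perms S"
  by (simp add: type_perms_def type_preserving_def permutes_id)

text \<open>Transpositions within a type generate the group. The Y part is built up first from
  \<open>id\<close>, then the X part on top of it.\<close>

lemma type_perms_induct [consumes 2, case_names id swap]:
  assumes "\<pi> \<in> type_perms S" "finite S" and id: "P id"
    and swap: "\<And>a b p. a \<in> S \<Longrightarrow> b \<in> S \<Longrightarrow> a \<noteq> b \<Longrightarrow> is_X a = is_X b \<Longrightarrow> p \<in> type_perms S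
      \<Longrightarrow> P p \<Longrightarrow> P (transpose a b \<circ> p)"
  shows "P \<pi>"
proof -
  note split = type_perms_split[OF assms(1,2)]
  have *: "q \<circ> p \<in> type_perms S \<and> P (q \<circ> p)"
    if q: "q permutes {z\<in>S. is_X z = t}" and p: "p \<in> type_perms S" "P p" for q p t
  proof -
    have "finite {z\<in>S. is_X z = t}" using \<open>finite S\<close> by simp
    with q show ?thesis
    proof (induction q rule: permutes_induct)
      case id
      then show ?case using p by simp
    next
      case (swap a b q)
      then have ab: "a \<in> S" "b \<in> S" "is_X a = is_X b" by auto
      from swap have IH: "q \<circ> p \<in> type_perms S" "P (q \<circ> p)" by blast+
      have "transpose a b \<circ> (q \<circ> p) \<in> type_perms S \<and> P (transpose a b \<circ> (q \<circ> p))"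
        using type_perms_comp[OF transpose_type_perms[OF ab] IH(1)] assms(4)[OF ab(1,2) \<open>a \<noteq> b\<close> ab(3) IH]
        by blast
      then show ?case by (simp only: comp_assoc)
    qed
  qed
  have "perm_Y \<pi> \<circ> id \<in> type_perms S \<and> P (perm_Y \<pi> \<circ> id)"
    by (rule *[of _ False]) (use split(2) id in \<open>auto simp: type_perms_id\<close>)
  then have "perm_X \<pi> \<circ> perm_Y \<pi> \<in> type_perms S \<and> P (perm_X \<pi> \<circ> perm_Y \<pi>)"
    by (intro *[of _ True]) (use split(1) in auto)
  then show ?thesis using split(3) by simp
qed

section \<open>The dual family of an algebra satisfying the relations\<close>

lemma swap_sign_square: "swap_sign z z' * swap_sign z z' = 1"
  by (simp add: swap_sign_def)

lemma swap_sign_swap: "z \<noteq> z' \<Longrightarrow> is_X z = is_X z' \<Longrightarrow> swap_sign z' z = - swap_sign z z'"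
  by (auto simp: swap_sign_def)

text \<open>Each sign is its own inverse, so the product is the quotient of the signs after and
  before renaming.\<close>

definition order_ratio :: "(xyvar \<Rightarrow> xyvar) \<Rightarrow> xyvar \<Rightarrow> xyvar \<Rightarrow> int"
  where "order_ratio \<rho> z z' = swap_sign (\<rho> z) (\<rho> z') * swap_sign z z'"

text \<open>For an injective type-preserving renaming this is (-1) to the number of pairs of equal
  type in S whose order is reversed.\<close>

definition order_sign :: "(xyvar \<Rightarrow> xyvar) \<Rightarrow> xyvar set \<Rightarrow> int"
  where "order_sign \<rho> S = (\<Prod>(a, b)\<in>{(a, b)\<in>S \<times> S. a < b}. order_ratio \<rho> a b)"

text \<open>Exchanging two distinct arguments changes both signs for equal types and neither for
  different types.\<close>

lemma order_ratio_commute: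
  assumes "inj \<rho>" "type_preserving \<rho>"
  shows "order_ratio \<rho> z z' = order_ratio \<rho> z' z"
proof (cases "z = z'")
  case False
  then have "\<rho> z \<noteq> \<rho> z'" using assms(1) by (auto dest: injD)
  then show ?thesis
    using False assms(2) swap_sign_swap[of z z'] swap_sign_swap[of "\<rho> z" "\<rho> z'"]
    by (cases "is_X z = is_X z'") (auto simp: order_ratio_def swap_sign_def)
qed simp

text \<open>In the ordered pairs through \<open>z\<close> this element may come first or second; the
  symmetry of \<open>order_ratio\<close> allows all of them to be written with \<open>z\<close>
  first.\<close>

lemma order_sign_remove:
  assumes "inj \<rho>" "type_preserving \<rho>" "finite S" "z \<in> S"
  shows "order_sign \<rho> S = order_sign \<rho> (S - {z}) * (\<Prod>z'\<in>S - {z}. order_ratio \<rho> z z')"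
proof -
  let ?r = "\<lambda>(a, b). order_ratio \<rho> a b"
  let ?L = "{z'\<in>S - {z}. z' < z}" and ?R = "{z'\<in>S - {z}. z < z'}"
  let ?A = "{(a, b)\<in>(S - {z}) \<times> (S - {z}). a < b}"
  let ?B = "(\<lambda>z'. (z', z)) ` ?L" and ?C = "(\<lambda>z'. (z, z')) ` ?R"
  have fin: "finite ?A" "finite ?B" "finite ?C"
    using \<open>finite S\<close> by (auto intro: finite_subset[of _ "S \<times> S"])
  have eq: "{(a, b)\<in>S \<times> S. a < b} = ?A \<union> (?B \<union> ?C)"
    using \<open>z \<in> S\<close> by auto
  have "order_sign \<rho> S = prod ?r ?A * (prod ?r ?B * prod ?r ?C)"
    unfolding order_sign_def eq
    by (subst prod.union_disjoint[OF fin(1) finite_UnI[OF fin(2,3)]]; (subst prod.union_disjoint[OF fin(2,3)])?)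
      auto
  also have "prod ?r ?B = (\<Prod>z'\<in>?L. order_ratio \<rho> z z')"
    by (subst prod.reindex) (auto simp: inj_on_def intro!: prod.cong order_ratio_commute assms)
  also have "prod ?r ?C = (\<Prod>z'\<in>?R. order_ratio \<rho> z z')"
    by (subst prod.reindex) (auto simp: inj_on_def)
  also have "(\<Prod>z'\<in>?L. order_ratio \<rho> z z') * (\<Prod>z'\<in>?R. order_ratio \<rho> z z')
      = (\<Prod>z'\<in>?L \<union> ?R. order_ratio \<rho> z z')"
    using \<open>finite S\<close> by (intro prod.union_disjoint[symmetric]) auto
  also have "?L \<union> ?R = S - {z}" by auto
  finally show ?thesis by (simp add: order_sign_def)
qed

lemma order_sign_1:
  assumes "\<And>z z'. z \<in> S \<Longrightarrow> z' \<in> S \<Longrightarrow> z < z' \<Longrightarrow> is_X z = is_X z' \<Longrightarrow> \<rho> z < \<rho> z'" "type_preserving \<rho>"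
  shows "order_sign \<rho> S = 1"
  unfolding order_sign_def
proof (rule prod.neutral, safe)
  fix a b assume "a \<in> S" "b \<in> S" "a < b"
  then show "order_ratio \<rho> a b = 1"
    using assms(1)[of a b] assms(2) by (auto simp: order_ratio_def swap_sign_def)
qed

text \<open>Pairs avoiding both \<open>a\<close> and \<open>b\<close> contribute 1, the two pairs
  with a common third variable cancel, and the pair of \<open>a\<close> and \<open>b\<close> itself
  is reversed.\<close>

lemma order_sign_transpose:
  assumes "finite S" "a \<in> S" "b \<in> S" "a \<noteq> b" "is_X a = is_X b"
  shows "order_sign (transpose a b) S = - 1"
proof -
  let ?t = "transpose a b"
  have t: "inj ?t" "type_preserving ?t"
    using transpose_type_perms[OF assms(2,3,5)] by (auto simp: type_perms_def)
  have rest: "order_sign ?t (S - {a} - {b}) = 1"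
    by (rule order_sign_1) (auto simp: transpose_def t)
  have "order_sign ?t S = order_sign ?t (S - {a} - {b})
      * (\<Prod>z'\<in>S - {a} - {b}. order_ratio ?t b z') * (\<Prod>z'\<in>S - {a}. order_ratio ?t a z')"
    using assms by (simp add: order_sign_remove[OF t, of S a] order_sign_remove[OF t, of "S - {a}" b])
  also have "(\<Prod>z'\<in>S - {a}. order_ratio ?t a z')
      = order_ratio ?t a b * (\<Prod>z'\<in>S - {a} - {b}. order_ratio ?t a z')"
    using assms by (intro prod.remove) auto
  also have "order_sign ?t (S - {a} - {b}) * (\<Prod>z'\<in>S - {a} - {b}. order_ratio ?t b z') *
      (order_ratio ?t a b * (\<Prod>z'\<in>S - {a} - {b}. order_ratio ?t a z'))
    = order_ratio ?t a b * (\<Prod>z'\<in>S - {a} - {b}. order_ratio ?t a z' * order_ratio ?t b z')"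
    by (simp add: rest prod.distrib ac_simps)
  also have "(\<Prod>z'\<in>S - {a} - {b}. order_ratio ?t a z' * order_ratio ?t b z') = 1"
  proof (intro prod.neutral ballI)
    fix z' assume "z' \<in> S - {a} - {b}"
    then have "order_ratio ?t a z' * order_ratio ?t b z'
        = (swap_sign a z' * swap_sign a z') * (swap_sign b z' * swap_sign b z')"
      by (simp add: order_ratio_def ac_simps)
    then show "order_ratio ?t a z' * order_ratio ?t b z' = 1"
      by (simp only: swap_sign_square mult_1)
  qed
  also have "order_ratio ?t a b = - 1"
    using swap_sign_square[of a b] swap_sign_swap[OF assms(4,5)] by (simp add: order_ratio_def)
  finally show ?thesis by simp
qed

lemma rename_kernel_signed:
  assumes "type_preserving \<rho>"
  shows "rename_laurent \<rho> (kernel_signed z z')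
    = of_int (order_ratio \<rho> z z') * kernel_signed (\<rho> z) (\<rho> z')"
proof -
  have "swap_sign z z' = order_ratio \<rho> z z' * swap_sign (\<rho> z) (\<rho> z')"
    using swap_sign_square[of "\<rho> z" "\<rho> z'"] by (simp add: order_ratio_def ac_simps)
  then have "of_int (swap_sign z z') = (of_int (order_ratio \<rho> z z') * of_int (swap_sign (\<rho> z) (\<rho> z')) :: laurent)"
    by (simp only: of_int_mult)
  then show ?thesis
    using assms by (simp add: kernel_signed_def rename_laurent_mult rename_kernel_xy mult.assoc)
qed

lemma rename_front:
  assumes "inj \<rho>" "type_preserving \<rho>"
  shows "rename_laurent \<rho> (front S z)
    = of_int (\<Prod>z'\<in>S - {z}. order_ratio \<rho> z z') * front (\<rho> ` S) (\<rho> z)"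
proof -
  have "\<rho> ` S - {\<rho> z} = \<rho> ` (S - {z})" using assms(1) by (auto dest: injD)
  moreover have "inj_on \<rho> (S - {z})" using assms(1) by (rule inj_on_subset) simp
  ultimately have "front (\<rho> ` S) (\<rho> z) = (\<Prod>z'\<in>S - {z}. kernel_signed (\<rho> z) (\<rho> z'))"
    by (simp add: front_def prod.reindex)
  then show ?thesis
    by (simp add: front_def rename_laurent_prod rename_kernel_signed[OF assms(2)] prod.distrib)
qed

section \<open>Construction of the dual family\<close>

definition coef :: "xyvar set \<Rightarrow> xyvar \<Rightarrow> laurent"
  where "coef S = (SOME c. (\<Sum>z\<in>S. c z * front S z) = 1 \<and> (\<forall>z. lvars (c z) \<subseteq> S))"

lemma coef:
  assumes "finite S" "S \<noteq> {}"
  shows "(\<Sum>z\<in>S. coef S z * front S z) = 1" "lvars (coef S z) \<subseteq> S"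
  using someI_ex[OF partition_of_unity[OF assms]] unfolding coef_def by blast+

text \<open>The left inverse is built over an arbitrary algebra whose elements \<open>P i\<close>
  and \<open>Q j\<close> obey the defining relations; U enters only later, as an instance.\<close>

locale odd_generators =
  fixes sc :: "Cv \<Rightarrow> 'a::ring_1" and P Q :: "int \<Rightarrow> 'a"
  assumes sc_add: "sc (c + d) = sc c + sc d"
    and sc_mult: "sc (c * d) = sc c * sc d"
    and sc_1: "sc 1 = 1"
    and sc_central: "sc c * a = a * sc c"
    and PP: "P i * P j = - (P j * P i)"
    and QQ: "Q i * Q j = - (Q j * Q i)"
    and PQ: "P (i + 1) * Q j + sc v_indet * (Q j * P (i + 1))
      = - (sc v_indet * (P i * Q (j + 1))) - Q (j + 1) * P i"
begin

definition gen :: "xyvar \<Rightarrow> int \<Rightarrow> 'a"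
  where "gen z i = (if is_X z then P i else Q i)"

text \<open>A monomial acts by translating the argument. If \<Phi> lists the values of a linear map
  on monomials, then \<open>act f \<Phi> 0\<close> is the value of that map at
  \<open>f\<close>.\<close>

definition act :: "laurent \<Rightarrow> ((xyvar \<Rightarrow>\<^sub>0 int) \<Rightarrow> 'a) \<Rightarrow> (xyvar \<Rightarrow>\<^sub>0 int) \<Rightarrow> 'a"
  where "act f \<Phi> e = (\<Sum>d\<in>Poly_Mapping.keys f. sc (Poly_Mapping.lookup f d) * \<Phi> (d + e))"

text \<open>The operation written z \<circ> E in the overview: left multiplication by the current of
  \<open>z\<close>, whose mode is read off the exponent of \<open>z\<close>.\<close>

definition lmul :: "xyvar \<Rightarrow> ((xyvar \<Rightarrow>\<^sub>0 int) \<Rightarrow> 'a) \<Rightarrow> (xyvar \<Rightarrow>\<^sub>0 int) \<Rightarrow> 'a"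
  where "lmul z \<Phi> e = gen z (Poly_Mapping.lookup e z) * \<Phi> e"

lemma sc_0: "sc 0 = 0"
  using sc_add[of 0 0] by simp

lemma act_superset:
  assumes "finite S" "Poly_Mapping.keys f \<subseteq> S"
  shows "act f \<Phi> e = (\<Sum>d\<in>S. sc (Poly_Mapping.lookup f d) * \<Phi> (d + e))"
  unfolding act_def
  by (rule sum.mono_neutral_left) (use assms in \<open>auto simp: in_keys_iff sc_0\<close>)

lemma act_add: "act (f + g) \<Phi> e = act f \<Phi> e + act g \<Phi> e"
proof -
  let ?S = "Poly_Mapping.keys f \<union> Poly_Mapping.keys g"
  have "act (f + g) \<Phi> e = (\<Sum>d\<in>?S. sc (Poly_Mapping.lookup (f + g) d) * \<Phi> (d + e))"
    by (rule act_superset) (use Poly_Mapping.keys_add[of f g] in auto)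
  then show ?thesis
    by (simp add: act_superset[of ?S f] act_superset[of ?S g] lookup_add sc_add distrib_right sum.distrib)
qed

lemma act_monomial: "act (lconst c * lmon d) \<Phi> e = sc c * \<Phi> (d + e)"
  by (simp add: lconst_times_lmon act_def sc_0)

lemma act_lmon: "act (lmon d) \<Phi> e = \<Phi> (d + e)"
  using act_monomial[of 1] by (simp add: sc_1)

lemma act_1: "act 1 \<Phi> = \<Phi>"
  using act_lmon[of 0] by (simp add: fun_eq_iff)

lemma act_lconst: "act (lconst c) \<Phi> e = sc c * \<Phi> e"
  using act_monomial[of c 0] by simp

lemma act_0: "act 0 \<Phi> e = 0"
  by (simp add: act_def)

lemma act_sum: "act (sum F A) \<Phi> e = (\<Sum>a\<in>A. act (F a) \<Phi> e)"
  by (induction A rule: infinite_finite_induct) (simp_all add: act_0 act_add)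

lemma act_mult: "act (f * g) \<Phi> = act f (act g \<Phi>)"
proof
  fix e
  show "act (f * g) \<Phi> e = act f (act g \<Phi>) e"
  proof (induction f rule: laurent_induct)
    case (add f1 f2)
    then show ?case by (simp add: distrib_right act_add)
  next
    case (monomial c d)
    show ?case
    proof (induction g rule: laurent_induct)
      case (add g1 g2)
      then show ?case by (simp add: distrib_left act_add act_monomial)
    next
      case (monomial c' d')
      have "lconst c * lmon d * (lconst c' * lmon d') = lconst (c * c') * lmon (d' + d)"
        by (simp add: lconst_mult lmon_add ac_simps)
      then show ?case by (simp only: act_monomial) (simp add: sc_mult mult.assoc add.assoc)
    qed
  qed
qed

lemma act_sum_right: "act f (\<lambda>e. \<Sum>a\<in>A. \<Phi> a e) e = (\<Sum>a\<in>A. act f (\<Phi> a) e)"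
  unfolding act_def sum_distrib_left by (rule sum.swap)

lemma act_of_int_right: "act f (\<lambda>e. of_int k * \<Phi> e) e = of_int k * act f \<Phi> e"
  by (simp add: act_def sum_distrib_left mult.assoc flip: mult.assoc mult_of_int_commute)

lemma sc_of_int: "sc (of_int k) = of_int k"
proof -
  have nat: "sc (of_nat n) = of_nat n" for n
    by (induction n) (simp_all add: sc_0 sc_1 sc_add)
  have "sc (- c) = - sc c" for c
    using sc_add[of c "- c"] by (simp add: sc_0 eq_neg_iff_add_eq_0 add.commute)
  then show ?thesis using nat by (cases k rule: int_diff_cases) (simp add: sc_add flip: uminus_add_conv_diff)
qed

lemma act_of_int: "act (of_int k) \<Phi> e = of_int k * \<Phi> e"
  using act_lconst[of "of_int k"] by (simp only: lconst_of_int sc_of_int)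

text \<open>Translation by exponents free of \<open>z\<close> leaves the mode of the current
  unchanged, and scalars are central.\<close>

lemma act_lmul:
  assumes "z \<notin> lvars f"
  shows "act f (lmul z \<Phi>) = lmul z (act f \<Phi>)"
proof
  fix e
  have "sc (Poly_Mapping.lookup f d) * lmul z \<Phi> (d + e)
      = gen z (Poly_Mapping.lookup e z) * (sc (Poly_Mapping.lookup f d) * \<Phi> (d + e))"
    if "d \<in> Poly_Mapping.keys f" for d
  proof -
    have "Poly_Mapping.lookup d z = 0" using assms that by (auto simp: lvars_def in_keys_iff)
    then show ?thesis
      by (simp add: lmul_def lookup_add sc_central[of _ "gen _ _"] flip: mult.assoc)
  qed
  then show "act f (lmul z \<Phi>) e = lmul z (act f \<Phi>) e"
    by (simp add: act_def sum_distrib_left lmul_def[of z "\<lambda>e. sum _ _"] lmul_def[of z "act f \<Phi>"])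
qed

text \<open>The number is a counter that makes the recursion primitive; only its value
  \<open>card S\<close> is meant.\<close>

primrec dual_rec :: "nat \<Rightarrow> xyvar set \<Rightarrow> (xyvar \<Rightarrow>\<^sub>0 int) \<Rightarrow> 'a"
  where "dual_rec 0 S = (\<lambda>e. 1)"
  | "dual_rec (Suc n) S = (\<lambda>e. \<Sum>z\<in>S. act (coef S z) (lmul z (dual_rec n (S - {z}))) e)"

definition dual :: "xyvar set \<Rightarrow> (xyvar \<Rightarrow>\<^sub>0 int) \<Rightarrow> 'a"
  where "dual S = dual_rec (card S) S"

lemma dual_empty: "dual {} = (\<lambda>e. 1)"
  by (simp add: dual_def)

lemma dual_step:
  assumes "finite S" "S \<noteq> {}"
  shows "dual S = (\<lambda>e. \<Sum>z\<in>S. act (coef S z) (lmul z (dual (S - {z}))) e)"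
proof -
  obtain n where n: "card S = Suc n"
    using assms by (metis card_eq_0_iff not0_implies_Suc)
  have "card (S - {z}) = n" if "z \<in> S" for z using n that assms(1) by simp
  then show ?thesis by (simp add: dual_def n)
qed

text \<open>Both sides of the recursion are translated by the same exponents, so agreement on S
  persists. This makes \<open>dual (S - {z, t})\<close> blind to the exponents at \<open>z\<close>
  and \<open>t\<close>, which is the hypothesis of \<open>swap_relation\<close>.\<close>

lemma dual_cong:
  assumes "finite S" "\<And>z. z \<in> S \<Longrightarrow> Poly_Mapping.lookup e z = Poly_Mapping.lookup e' z"
  shows "dual S e = dual S e'"
  using assms
proof (induction "card S" arbitrary: S e e' rule: less_induct)
  case less
  show ?case
  proof (cases "S = {}")
    case True
    then show ?thesis by (simp add: dual_empty)
  next
    case False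
    have "lmul z (dual (S - {z})) (d + e) = lmul z (dual (S - {z})) (d + e')" if "z \<in> S" for z d
    proof -
      have "card (S - {z}) < card S" using that less.prems(1) by (intro psubset_card_mono) auto
      then have "dual (S - {z}) (d + e) = dual (S - {z}) (d + e')"
        by (rule less.hyps) (use less.prems in \<open>auto simp: lookup_add\<close>)
      then show ?thesis using less.prems(2)[OF that] by (simp add: lmul_def lookup_add)
    qed
    then show ?thesis by (simp add: dual_step[OF less.prems(1) False] act_def)
  qed
qed

text \<open>The mixed relation divided by v, brought into the shape of the kernel: x + y/v applied
  to the products Q P against y + x/v applied to the products P Q.\<close>

lemma PQ':
  "Q b * P (a + 1) + sc (inverse v_indet) * (Q (b + 1) * P a)
    = - (P a * Q (b + 1) + sc (inverse v_indet) * (P (a + 1) * Q b))"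
proof -
  have "v_indet \<noteq> 0" by (simp add: v_indet_def Zero_fract_def eq_fract)
  then have v: "sc (inverse v_indet) * (sc v_indet * u) = u" for u
    by (simp add: sc_1 flip: mult.assoc sc_mult)
  from PQ[of a b] have "sc (inverse v_indet) * (P (a + 1) * Q b + sc v_indet * (Q b * P (a + 1)))
      = sc (inverse v_indet) * (- (sc v_indet * (P a * Q (b + 1))) - Q (b + 1) * P a)" by simp
  then have "sc (inverse v_indet) * (P (a + 1) * Q b) + Q b * P (a + 1)
      = - (P a * Q (b + 1)) - sc (inverse v_indet) * (Q (b + 1) * P a)"
    by (simp only: distrib_left right_diff_distrib mult_minus_right v)
  then show ?thesis by (simp add: algebra_simps)
qed

text \<open>Values are compared at each exponent. Since \<Phi> ignores the exponents at
  \<open>z\<close> and \<open>z'\<close>, it factors out on the right, and a quadratic relation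
  between generators remains.\<close>

lemma swap_relation:
  fixes \<Phi> :: "(xyvar \<Rightarrow>\<^sub>0 int) \<Rightarrow> 'a"
  assumes "z \<noteq> z'"
    and indep: "\<And>e e'. (\<And>t. t \<noteq> z \<Longrightarrow> t \<noteq> z' \<Longrightarrow> Poly_Mapping.lookup e t = Poly_Mapping.lookup e' t)
      \<Longrightarrow> \<Phi> e = \<Phi> e'"
  shows "act (kernel_signed z z') (lmul z' (lmul z \<Phi>)) = act (kernel_signed z' z) (lmul z (lmul z' \<Phi>))"
proof
  fix e :: "xyvar \<Rightarrow>\<^sub>0 int"
  let ?a = "Poly_Mapping.lookup e z" and ?b = "Poly_Mapping.lookup e z'"
  show "act (kernel_signed z z') (lmul z' (lmul z \<Phi>)) e = act (kernel_signed z' z) (lmul z (lmul z' \<Phi>)) e"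
  proof (cases "is_X z = is_X z'")
    case True
    have "gen z' ?b * gen z ?a = - (gen z ?a * gen z' ?b)"
      using True PP[of ?b ?a] QQ[of ?b ?a] by (auto simp: gen_def)
    then have "lmul z' (lmul z \<Phi>) e = - lmul z (lmul z' \<Phi>) e"
      by (simp add: lmul_def flip: mult.assoc)
    then show ?thesis
      using True by (simp add: kernel_signed_def kernel_xy_def act_of_int swap_sign_swap[OF assms(1)] del: of_int_minus)
        (simp)
  next
    case False
    have \<Phi>: "\<Phi> (Poly_Mapping.single z 1 + e) = \<Phi> e" "\<Phi> (Poly_Mapping.single z' 1 + e) = \<Phi> e"
      "\<Phi> (e + Poly_Mapping.single z 1) = \<Phi> e" "\<Phi> (e + Poly_Mapping.single z' 1) = \<Phi> e"
      by (rule indep; simp add: lookup_add lookup_single)+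
    have ks: "kernel_signed s t = of_int (if is_X s then 1 else - 1) * (lvar s + lconst (inverse v_indet) * lvar t)"
      if "is_X s \<noteq> is_X t" for s t
      using that by (simp add: kernel_signed_def kernel_xy_def swap_sign_def)
    have L: "act (lvar z + lconst (inverse v_indet) * lvar z') (lmul z' (lmul z \<Phi>)) e
      = (gen z' ?b * gen z (?a + 1) + sc (inverse v_indet) * (gen z' (?b + 1) * gen z ?a)) * \<Phi> e"
      using assms(1)
      by (simp add: act_add act_monomial act_lmon lmul_def \<Phi> lookup_add lookup_single algebra_simps)
    have R: "act (lvar z' + lconst (inverse v_indet) * lvar z) (lmul z (lmul z' \<Phi>)) e
      = (gen z ?a * gen z' (?b + 1) + sc (inverse v_indet) * (gen z (?a + 1) * gen z' ?b)) * \<Phi> e"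
      using assms(1)
      by (simp add: act_add act_monomial act_lmon lmul_def \<Phi> lookup_add lookup_single algebra_simps)
    have "gen z' ?b * gen z (?a + 1) + sc (inverse v_indet) * (gen z' (?b + 1) * gen z ?a)
      = - (gen z ?a * gen z' (?b + 1) + sc (inverse v_indet) * (gen z (?a + 1) * gen z' ?b))"
    proof (cases "is_X z")
      case True
      then show ?thesis using False PQ'[of ?b ?a] by (simp add: gen_def)
    next
      case X: False
      \<comment> \<open>With \<open>z\<close> of type Y the roles are exchanged, and
        \<open>PQ'\<close> is read from right to left.\<close>
      have "x = - y \<Longrightarrow> y = - x" for x y :: 'a by simp
      from this[OF PQ'[of ?a ?b]] X show ?thesis using False by (simp add: gen_def)
    qed
    note rel = this
    have z': "is_X z' = (\<not> is_X z)" using False by blast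
    have sgn: "x = - y \<Longrightarrow> of_int (if b then 1 else - 1) * (x * w) = of_int (if \<not> b then 1 else - 1) * (y * w)"
      for x y w :: 'a and b by simp
    show ?thesis
      unfolding ks[OF False] ks[OF False[symmetric]] act_mult act_of_int L R z' by (rule sgn[OF rel])
  qed
qed

text \<open>Compatibility of the glued candidates: multiplying \<open>dual_step\<close> by
  \<open>front S z\<close> turns the summand of \<open>t\<close> into
  \<open>coef S t * front S t\<close> acting on one and the same function, and these factors sum to
  1.\<close>

theorem act_front:
  assumes "finite S" "z \<in> S"
  shows "act (front S z) (dual S) = lmul z (dual (S - {z}))"
  using assms
proof (induction "card S" arbitrary: S z rule: less_induct)
  case less
  \<comment> \<open>Splitting off the kernel of \<open>s\<close> and \<open>t\<close> leaves
    \<open>front (S - {t}) s\<close>, which is free of \<open>t\<close> and hence passes through to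
    the smaller dual, where the induction hypothesis applies.\<close>
  have half: "act (front S s) (lmul t (dual (S - {t})))
      = act (kernel_signed s t) (lmul t (lmul s (dual (S - {s, t}))))"
    if st: "s \<in> S" "t \<in> S" "s \<noteq> t" for s t
  proof -
    have "card (S - {t}) < card S" using that less.prems(1) by (intro psubset_card_mono) auto
    then have IH: "act (front (S - {t}) s) (dual (S - {t})) = lmul s (dual (S - {t} - {s}))"
      by (rule less.hyps) (use less.prems st in auto)
    have "t \<notin> lvars (front (S - {t}) s)" using lvars_front[of s "S - {t}"] st by auto
    then have "act (front (S - {t}) s) (lmul t (dual (S - {t}))) = lmul t (lmul s (dual (S - {t} - {s})))"
      by (simp add: act_lmul IH)
    moreover have "S - {t} - {s} = S - {s, t}" by auto
    ultimately show ?thesis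
      using st less.prems(1) by (simp add: front_remove[of S t s] act_mult)
  qed
  \<comment> \<open>This is the compatibility on overlaps; the defining relations enter here and
    nowhere else.\<close>
  have swap: "act (front S z) (lmul t (dual (S - {t}))) = act (front S t) (lmul z (dual (S - {z})))"
    if "t \<in> S" for t
  proof (cases "t = z")
    case False
    have "act (kernel_signed z t) (lmul t (lmul z (dual (S - {z, t}))))
      = act (kernel_signed t z) (lmul z (lmul t (dual (S - {z, t}))))"
      by (rule swap_relation) (use False less.prems in \<open>auto intro!: dual_cong\<close>)
    then show ?thesis
      using half[of z t] half[of t z] False that less.prems(2) by (simp add: insert_commute)
  qed simp
  show ?case
  proof
    fix e
    have "S \<noteq> {}" using less.prems(2) by blast
    have "act (front S z) (dual S) e
        = (\<Sum>t\<in>S. act (coef S t) (act (front S z) (lmul t (dual (S - {t})))) e)"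
      unfolding dual_step[OF less.prems(1) \<open>S \<noteq> {}\<close>] act_sum_right
      by (simp add: mult.commute flip: act_mult)
    also have "\<dots> = (\<Sum>t\<in>S. act (coef S t * front S t) (lmul z (dual (S - {z}))) e)"
      by (rule sum.cong) (simp_all add: swap act_mult)
    also have "\<dots> = lmul z (dual (S - {z})) e"
      by (simp add: coef(1)[OF less.prems(1) \<open>S \<noteq> {}\<close>] act_1 flip: act_sum)
    finally show "act (front S z) (dual S) e = lmul z (dual (S - {z})) e" .
  qed
qed

section \<open>Renaming the dual family, and the pairing\<close>

lemma act_rename: "act (rename_laurent \<rho> f) \<Phi> (push_keys \<rho> e) = act f (\<lambda>e. \<Phi> (push_keys \<rho> e)) e"
proof (induction f rule: laurent_induct)
  case (add f g)
  then show ?case by (simp add: rename_laurent_add act_add)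
next
  case (monomial c d)
  show ?case
    by (simp only: rename_laurent_mult rename_laurent_lconst rename_laurent_lmon act_monomial push_keys_add)
qed

text \<open>The arbitrary choices of \<open>coef\<close> for S and for its image are unrelated, so
  the two recursions cannot be compared term by term. Instead the renamed partition of unity of S
  acts on the dual of the image, and \<open>act_front\<close> evaluates each term.\<close>

lemma dual_rename:
  assumes \<rho>: "inj \<rho>" "type_preserving \<rho>" and "finite S"
  shows "dual (\<rho> ` S) (push_keys \<rho> e) = of_int (order_sign \<rho> S) * dual S e"
  using \<open>finite S\<close>
proof (induction "card S" arbitrary: S e rule: less_induct)
  case less
  show ?case
  proof (cases "S = {}")
    case True
    then show ?thesis by (simp add: dual_empty order_sign_def)
  next
    case False
    have step: "act (rename_laurent \<rho> (coef S z * front S z)) (dual (\<rho> ` S)) (push_keys \<rho> e)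
        = of_int (order_sign \<rho> S) * act (coef S z) (lmul z (dual (S - {z}))) e" if z: "z \<in> S" for z
    proof -
      let ?r = "\<Prod>z'\<in>S - {z}. order_ratio \<rho> z z'"
      have "card (S - {z}) < card S" using that less.prems(1) by (intro psubset_card_mono) auto
      then have IH: "dual (\<rho> ` (S - {z})) (push_keys \<rho> e) = of_int (order_sign \<rho> (S - {z})) * dual (S - {z}) e" for e
        by (rule less.hyps) (use less.prems in auto)
      have im: "\<rho> ` S - {\<rho> z} = \<rho> ` (S - {z})" using \<rho>(1) by (auto dest: injD)
      have "act (rename_laurent \<rho> (front S z)) (dual (\<rho> ` S)) (push_keys \<rho> e)
          = of_int (order_sign \<rho> S) * lmul z (dual (S - {z})) e" for e
      proof -
        have "act (rename_laurent \<rho> (front S z)) (dual (\<rho> ` S)) (push_keys \<rho> e)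
          = of_int ?r * lmul (\<rho> z) (dual (\<rho> ` (S - {z}))) (push_keys \<rho> e)"
          using act_front[of "\<rho> ` S" "\<rho> z"] z less.prems
          by (simp only: rename_front[OF \<rho>] act_mult act_of_int im) simp
        also have "\<dots> = of_int ?r * (gen z (Poly_Mapping.lookup e z) * (of_int (order_sign \<rho> (S - {z})) * dual (S - {z}) e))"
          using \<rho>(2) by (simp only: lmul_def IH gen_def lookup_push_keys[OF \<rho>(1)] type_preservingD)
        also have "\<dots> = of_int (?r * order_sign \<rho> (S - {z})) * lmul z (dual (S - {z})) e"
        proof -
          have "g * (of_int k * x) = of_int k * (g * x)" for g x :: 'a and k
            by (simp add: mult_of_int_commute[of k g] flip: mult.assoc)
          from this[of "gen z (Poly_Mapping.lookup e z)"] show ?thesis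
            by (simp only: lmul_def of_int_mult mult.assoc)
        qed
        finally show ?thesis
          using order_sign_remove[OF \<rho> less.prems z] by (simp only: mult.commute)
      qed
      then show ?thesis
        by (simp only: rename_laurent_mult act_mult act_rename[of \<rho> "coef S z"] act_of_int_right)
    qed
    have "dual (\<rho> ` S) (push_keys \<rho> e)
        = act (rename_laurent \<rho> (\<Sum>z\<in>S. coef S z * front S z)) (dual (\<rho> ` S)) (push_keys \<rho> e)"
      by (simp add: coef(1)[OF less.prems False] act_1)
    also have "\<dots> = of_int (order_sign \<rho> S) * (\<Sum>z\<in>S. act (coef S z) (lmul z (dual (S - {z}))) e)"
      by (simp add: rename_laurent_sum act_sum step sum_distrib_left)
    also have "\<dots> = of_int (order_sign \<rho> S) * dual S e"
      using fun_cong[OF dual_step[OF less.prems False], of e] by simp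
    finally show ?thesis .
  qed
qed

definition pairing :: "xyvar set \<Rightarrow> laurent \<Rightarrow> 'a"
  where "pairing S f = act f (dual S) 0"

lemma pairing_rename:
  assumes "inj \<rho>" "type_preserving \<rho>" "finite S"
  shows "pairing (\<rho> ` S) (rename_laurent \<rho> f) = of_int (order_sign \<rho> S) * pairing S f"
  using act_rename[of \<rho> f "dual (\<rho> ` S)" 0]
  by (simp add: pairing_def dual_rename[OF assms] act_of_int_right)

text \<open>A transposition within a type maps S to itself and has order sign -1, so each generating
  transposition contributes its sign.\<close>

lemma pairing_perm:
  assumes "\<pi> \<in> type_perms S" "finite S"
  shows "pairing S (rename_laurent \<pi> f) = of_int (sign \<pi>) * pairing S f"
  using assms
proof (induction \<pi> rule: type_perms_induct)
  case id
  then show ?case by simp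
next
  case (swap a b p)
  let ?t = "transpose a b"
  have t: "inj ?t" "type_preserving ?t" "?t permutes S"
    using transpose_type_perms[OF swap(1,2,4)] by (auto simp: type_perms_def)
  have "pairing S (rename_laurent (?t \<circ> p) f) = pairing (?t ` S) (rename_laurent ?t (rename_laurent p f))"
    using permutes_image[OF t(3)] by (simp add: rename_laurent_comp)
  also have "\<dots> = - of_int (sign p) * pairing S f"
    using swap assms(2) pairing_rename[OF t(1,2), of S] by (simp add: order_sign_transpose)
  also have "- sign p = sign (?t \<circ> p)"
    using swap assms(2) by (subst sign_compose) 
      (auto simp: sign_swap_id permutation_swap_id type_perms_def intro: permutation_permutes[THEN iffD2])
  then have "- of_int (sign p) = (of_int (sign (?t \<circ> p)) :: 'a)" by (metis of_int_minus)
  finally show ?case .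
qed

end

section \<open>Antisymmetrization of Laurent polynomials\<close>

definition alternate :: "xyvar set \<Rightarrow> laurent \<Rightarrow> laurent"
  where "alternate S f = lconst (inverse (of_nat (card (type_perms S))))
    * (\<Sum>\<pi>\<in>type_perms S. of_int (sign \<pi>) * rename_laurent \<pi> f)"

lemma finite_type_perms: "finite S \<Longrightarrow> finite (type_perms S)"
  unfolding type_perms_def by (rule finite_subset[OF _ finite_permutations]) auto

lemma of_nat_Cv_neq_0: "n \<noteq> 0 \<Longrightarrow> (of_nat n :: Cv) \<noteq> 0"
proof -
  have "(of_nat n :: Cv) = Fraction_Field.Fract (of_nat n) 1"
    by (induction n) (simp_all add: Zero_fract_def One_fract_def algebra_simps)
  then show "n \<noteq> 0 \<Longrightarrow> (of_nat n :: Cv) \<noteq> 0" by (simp add: Zero_fract_def eq_fract)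
qed

lemma card_type_perms: "finite S \<Longrightarrow> card (type_perms S) \<noteq> 0"
  using finite_type_perms type_perms_id by (metis card_0_eq empty_iff)

lemma type_perms_permutation: "\<pi> \<in> type_perms S \<Longrightarrow> finite S \<Longrightarrow> permutation \<pi>"
  unfolding type_perms_def permutation_permutes by blast

lemma type_perms_inv:
  assumes "\<pi> \<in> type_perms S"
  shows "inv_into UNIV \<pi> \<in> type_perms S"
proof -
  have p: "\<pi> permutes S" "type_preserving \<pi>" using assms by (auto simp: type_perms_def)
  have "is_X (inv_into UNIV \<pi> z) = is_X z" for z
    using type_preservingD[OF p(2), of "inv_into UNIV \<pi> z"] permutes_inverses(1)[OF p(1), of z] by simp
  then show ?thesis by (simp add: type_perms_def type_preserving_def permutes_inv[OF p(1)])
qed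

lemma alternate_0 [simp]: "alternate S 0 = 0"
  and alternate_add: "alternate S (f + g) = alternate S f + alternate S g"
  by (simp_all add: alternate_def rename_laurent_add distrib_left sum.distrib)

lemma alternate_sum: "alternate S (sum F A) = (\<Sum>a\<in>A. alternate S (F a))"
  by (induction A rule: infinite_finite_induct) (simp_all add: alternate_add)

lemma alternate_lconst: "alternate S (lconst c * f) = lconst c * alternate S f"
  by (simp add: alternate_def rename_laurent_mult sum_distrib_left ac_simps)

lemma alternate_of_int: "alternate S (of_int k * f) = of_int k * alternate S f"
  using alternate_lconst[of S "of_int k" f] by (simp only: lconst_of_int)

lemma alternate_rename:
  assumes "\<pi> \<in> type_perms S" "finite S"
  shows "alternate S (rename_laurent \<pi> f) = of_int (sign \<pi>) * alternate S f"
proof -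
  have inv: "\<pi> \<circ> inv_into UNIV \<pi> = id" "inv_into UNIV \<pi> \<circ> \<pi> = id"
    using assms(1) by (auto simp: type_perms_def permutes_inv_o)
  have bij: "bij_betw (\<lambda>\<sigma>. \<sigma> \<circ> \<pi>) (type_perms S) (type_perms S)"
    by (rule bij_betw_byWitness[where f' = "\<lambda>\<sigma>. \<sigma> \<circ> inv_into UNIV \<pi>"])
      (use assms(1) inv in \<open>auto simp: comp_assoc intro: type_perms_comp type_perms_inv\<close>)
  have "(\<Sum>\<sigma>\<in>type_perms S. of_int (sign \<sigma>) * rename_laurent \<sigma> (rename_laurent \<pi> f))
      = (\<Sum>\<sigma>\<in>type_perms S. of_int (sign \<pi>) * (of_int (sign (\<sigma> \<circ> \<pi>)) * rename_laurent (\<sigma> \<circ> \<pi>) f))"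
  proof (rule sum.cong[OF refl])
    fix \<sigma> assume "\<sigma> \<in> type_perms S"
    then have "sign \<sigma> = sign \<pi> * sign (\<sigma> \<circ> \<pi>)"
      using assms by (simp add: sign_compose type_perms_permutation ac_simps)
    then have "(of_int (sign \<sigma>) :: laurent) = of_int (sign \<pi>) * of_int (sign (\<sigma> \<circ> \<pi>))"
      by (metis of_int_mult)
    then show "of_int (sign \<sigma>) * rename_laurent \<sigma> (rename_laurent \<pi> f)
        = of_int (sign \<pi>) * (of_int (sign (\<sigma> \<circ> \<pi>)) * rename_laurent (\<sigma> \<circ> \<pi>) f)"
      by (simp only: rename_laurent_comp mult.assoc)
  qed
  also have "\<dots> = of_int (sign \<pi>) * (\<Sum>\<sigma>\<in>type_perms S. of_int (sign \<sigma>) * rename_laurent \<sigma> f)"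
    unfolding sum_distrib_left[symmetric]
    by (subst sum.reindex_bij_betw[OF bij, of "\<lambda>\<sigma>. of_int (sign \<sigma>) * rename_laurent \<sigma> f"]) simp
  finally show ?thesis by (simp add: alternate_def ac_simps)
qed

lemma rename_alternate:
  assumes "\<pi> \<in> type_perms S" "finite S"
  shows "rename_laurent \<pi> (alternate S f) = of_int (sign \<pi>) * alternate S f"
proof -
  have inv: "\<pi> \<circ> inv_into UNIV \<pi> = id" "inv_into UNIV \<pi> \<circ> \<pi> = id"
    using assms(1) by (auto simp: type_perms_def permutes_inv_o)
  have bij: "bij_betw (\<lambda>\<sigma>. \<pi> \<circ> \<sigma>) (type_perms S) (type_perms S)"
    by (rule bij_betw_byWitness[where f' = "\<lambda>\<sigma>. inv_into UNIV \<pi> \<circ> \<sigma>"])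
      (use assms(1) inv in \<open>auto simp flip: comp_assoc intro: type_perms_comp type_perms_inv\<close>)
  have "(\<Sum>\<sigma>\<in>type_perms S. of_int (sign \<sigma>) * rename_laurent \<pi> (rename_laurent \<sigma> f))
      = (\<Sum>\<sigma>\<in>type_perms S. of_int (sign \<pi>) * (of_int (sign (\<pi> \<circ> \<sigma>)) * rename_laurent (\<pi> \<circ> \<sigma>) f))"
  proof (rule sum.cong[OF refl])
    fix \<sigma> assume "\<sigma> \<in> type_perms S"
    then have "sign \<sigma> = sign \<pi> * sign (\<pi> \<circ> \<sigma>)"
      using assms by (simp add: sign_compose type_perms_permutation)
    then have "(of_int (sign \<sigma>) :: laurent) = of_int (sign \<pi>) * of_int (sign (\<pi> \<circ> \<sigma>))"
      by (metis of_int_mult)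
    then show "of_int (sign \<sigma>) * rename_laurent \<pi> (rename_laurent \<sigma> f)
        = of_int (sign \<pi>) * (of_int (sign (\<pi> \<circ> \<sigma>)) * rename_laurent (\<pi> \<circ> \<sigma>) f)"
      by (simp only: rename_laurent_comp mult.assoc)
  qed
  also have "\<dots> = of_int (sign \<pi>) * (\<Sum>\<sigma>\<in>type_perms S. of_int (sign \<sigma>) * rename_laurent \<sigma> f)"
    unfolding sum_distrib_left[symmetric]
    by (subst sum.reindex_bij_betw[OF bij, of "\<lambda>\<sigma>. of_int (sign \<sigma>) * rename_laurent \<sigma> f"]) simp
  finally show ?thesis
    by (simp add: alternate_def rename_laurent_mult rename_laurent_sum ac_simps)
qed

lemma lconst_card:
  assumes "finite S"
  shows "lconst (inverse (of_nat (card (type_perms S)))) * (of_nat (card (type_perms S)) * f) = f"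
proof -
  let ?c = "of_nat (card (type_perms S)) :: Cv"
  have "?c \<noteq> 0" using card_type_perms[OF assms] by (rule of_nat_Cv_neq_0)
  have "(of_nat (card (type_perms S)) :: laurent) = lconst ?c"
    using lconst_of_int[of "int (card (type_perms S))"] by simp
  then have "lconst (inverse ?c) * (of_nat (card (type_perms S)) * f) = lconst (inverse ?c * ?c) * f"
    by (simp add: lconst_mult mult.assoc)
  then show ?thesis using \<open>?c \<noteq> 0\<close> by simp
qed

lemma alternate_skew:
  assumes "finite S" "\<And>\<pi>. \<pi> \<in> type_perms S \<Longrightarrow> rename_laurent \<pi> f = of_int (sign \<pi>) * f"
  shows "alternate S f = f"
proof -
  have "(\<Sum>\<pi>\<in>type_perms S. of_int (sign \<pi>) * rename_laurent \<pi> f)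
      = (\<Sum>\<pi>\<in>type_perms S. of_int (sign \<pi> * sign \<pi>) * f)"
    by (rule sum.cong) (simp_all add: assms(2) del: sign_idempotent)
  then show ?thesis using lconst_card[OF assms(1)] by (simp add: alternate_def)
qed

text \<open>Because \<open>h\<close> is invariant under the smaller group, each summand of
  \<open>alternate T f * h\<close> is, up to sign and normalization, a renaming of
  \<open>f * h\<close> by an element of the larger group. Alternation over S sends all of them to
  the same value.\<close>

lemma alternate_absorb:
  assumes "finite S" "T \<subseteq> S" "\<And>\<pi>. \<pi> \<in> type_perms T \<Longrightarrow> rename_laurent \<pi> h = h"
  shows "alternate S (alternate T f * h) = alternate S (f * h)"
proof -
  have T: "finite T" using assms(1,2) finite_subset by blast
  have "alternate S (of_int (sign \<pi>) * (rename_laurent \<pi> f * h)) = alternate S (f * h)"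
    if "\<pi> \<in> type_perms T" for \<pi>
  proof -
    have "\<pi> \<in> type_perms S" using that assms(2) by (auto simp: type_perms_def intro: permutes_subset)
    then have "alternate S (of_int (sign \<pi>) * rename_laurent \<pi> (f * h))
        = of_int (sign \<pi> * sign \<pi>) * alternate S (f * h)"
      by (simp only: alternate_of_int alternate_rename[OF _ assms(1)] of_int_mult mult.assoc)
    then show ?thesis by (simp add: rename_laurent_mult assms(3)[OF that])
  qed
  then have "alternate S (\<Sum>\<pi>\<in>type_perms T. of_int (sign \<pi>) * (rename_laurent \<pi> f * h))
      = of_nat (card (type_perms T)) * alternate S (f * h)"
    by (simp add: alternate_sum)
  moreover have "alternate T f * h = lconst (inverse (of_nat (card (type_perms T))))
      * (\<Sum>\<pi>\<in>type_perms T. of_int (sign \<pi>) * (rename_laurent \<pi> f * h))"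
    by (simp add: alternate_def sum_distrib_right mult.assoc)
  ultimately show ?thesis by (simp add: alternate_lconst lconst_card[OF T])
qed

text \<open>\<open>map_permutation S \<rho>\<close> is conjugation by \<rho>, extended by the
  identity outside the image. This form suits the shifts, which are injective but not
  surjective.\<close>

lemma bij_betw_map_type_perms:
  assumes "inj \<rho>" "type_preserving \<rho>"
  shows "bij_betw (map_permutation S \<rho>) (type_perms S) (type_perms (\<rho> ` S))"
proof -
  have bij: "bij_betw \<rho> S (\<rho> ` S)"
    using assms(1) inj_on_subset[of \<rho> UNIV S] by (simp add: bij_betw_def)
  have inv: "bij_betw (inv_into UNIV \<rho>) (\<rho> ` S) S"
    using bij_betw_byWitness[of "\<rho> ` S" \<rho> "(inv_into UNIV \<rho>)" S] assms(1) by auto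
  have fwd: "map_permutation S \<rho> \<pi> \<in> type_perms (\<rho> ` S)" if "\<pi> \<in> type_perms S" for \<pi>
  proof -
    have p: "\<pi> permutes S" "type_preserving \<pi>" using that by (auto simp: type_perms_def)
    have perm: "map_permutation S \<rho> \<pi> permutes \<rho> ` S" by (rule map_permutation_permutes[OF bij p(1)])
    have "is_X (map_permutation S \<rho> \<pi> z) = is_X z" for z
    proof (cases "z \<in> \<rho> ` S")
      case True
      then obtain s where s: "s \<in> S" "z = \<rho> s" by blast
      have "map_permutation S \<rho> \<pi> z = \<rho> (\<pi> s)"
        unfolding s(2) by (rule map_permutation_apply[OF bij_betw_imp_inj_on[OF bij] s(1)])
      then show ?thesis using s(2) assms(2) p(2) by simp
    next
      case False
      then show ?thesis by (simp add: permutes_not_in[OF perm])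
    qed
    with perm show ?thesis by (simp add: type_perms_def type_preserving_def)
  qed
  have bwd: "map_permutation (\<rho> ` S) (inv_into UNIV \<rho>) \<pi> \<in> type_perms S" if "\<pi> \<in> type_perms (\<rho> ` S)" for \<pi>
  proof -
    have p: "\<pi> permutes \<rho> ` S" "type_preserving \<pi>" using that by (auto simp: type_perms_def)
    have perm: "map_permutation (\<rho> ` S) (inv_into UNIV \<rho>) \<pi> permutes S"
      by (rule map_permutation_permutes[OF inv p(1)])
    have "is_X (map_permutation (\<rho> ` S) (inv_into UNIV \<rho>) \<pi> s) = is_X s" for s
    proof (cases "s \<in> S")
      case True
      then have s: "\<rho> s \<in> \<rho> ` S" by blast
      have "map_permutation (\<rho> ` S) (inv_into UNIV \<rho>) \<pi> ((inv_into UNIV \<rho>) (\<rho> s)) = (inv_into UNIV \<rho>) (\<pi> (\<rho> s))"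
        by (rule map_permutation_apply[OF bij_betw_imp_inj_on[OF inv] s])
      then have eq: "map_permutation (\<rho> ` S) (inv_into UNIV \<rho>) \<pi> s = (inv_into UNIV \<rho>) (\<pi> (\<rho> s))"
        using assms(1) by simp
      have "\<pi> (\<rho> s) \<in> \<rho> ` S" using s permutes_in_image[OF p(1)] by blast
      then obtain t where "\<pi> (\<rho> s) = \<rho> t" by blast
      then have "(inv_into UNIV \<rho>) (\<pi> (\<rho> s)) = t" "is_X (\<rho> t) = is_X (\<rho> s)"
        using assms(1) p(2) by (auto dest: sym)
      then show ?thesis using eq assms(2) by simp
    next
      case False
      then show ?thesis by (simp add: permutes_not_in[OF perm])
    qed
    with perm show ?thesis by (simp add: type_perms_def type_preserving_def)
  qed
  have right: "\<rho> (inv_into UNIV \<rho> x) = x" if "x \<in> \<rho> ` S" for x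
    using that assms(1) by auto
  show ?thesis
  proof (rule bij_betw_byWitness[where f' = "map_permutation (\<rho> ` S) (inv_into UNIV \<rho>)"])
    show "\<forall>\<pi>\<in>type_perms S. map_permutation (\<rho> ` S) (inv_into UNIV \<rho>) (map_permutation S \<rho> \<pi>) = \<pi>"
      using map_permutation_compose_inv[OF bij, of _ "(inv_into UNIV \<rho>)"] assms(1) by (auto simp: type_perms_def)
    show "\<forall>\<pi>\<in>type_perms (\<rho> ` S). map_permutation S \<rho> (map_permutation (\<rho> ` S) (inv_into UNIV \<rho>) \<pi>) = \<pi>"
      using map_permutation_compose_inv[OF inv _ right] by (auto simp: type_perms_def)
  qed (use fwd bwd in auto)
qed

text \<open>Conjugation by \<rho> preserves signs and turns each summand on the left into one on the
  right.\<close>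

lemma rename_alternate_image:
  assumes "inj \<rho>" "type_preserving \<rho>" "finite S"
  shows "rename_laurent \<rho> (alternate S f) = alternate (\<rho> ` S) (rename_laurent \<rho> f)"
proof -
  note bij = bij_betw_map_type_perms[OF assms(1,2), of S]
  have inj: "inj_on \<rho> S" using assms(1) inj_on_subset by blast
  have "(\<Sum>\<pi>\<in>type_perms S. of_int (sign \<pi>) * rename_laurent \<rho> (rename_laurent \<pi> f))
      = (\<Sum>\<pi>\<in>type_perms S. of_int (sign (map_permutation S \<rho> \<pi>))
          * rename_laurent (map_permutation S \<rho> \<pi>) (rename_laurent \<rho> f))"
  proof (rule sum.cong[OF refl])
    fix \<pi> assume "\<pi> \<in> type_perms S"
    then have p: "\<pi> permutes S" by (simp add: type_perms_def)
    have "map_permutation S \<rho> \<pi> (\<rho> z) = \<rho> (\<pi> z)" for z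
    proof (cases "z \<in> S")
      case True
      then show ?thesis by (rule map_permutation_apply[OF inj])
    next
      case False
      then have "\<rho> z \<notin> \<rho> ` S" using assms(1) by (auto dest: injD)
      moreover have "map_permutation S \<rho> \<pi> permutes \<rho> ` S"
        by (rule map_permutation_permutes[OF _ p]) (simp add: bij_betw_def inj)
      ultimately show ?thesis using False by (simp add: permutes_not_in[OF p] permutes_not_in)
    qed
    then have "\<rho> \<circ> \<pi> = map_permutation S \<rho> \<pi> \<circ> \<rho>" by (simp add: fun_eq_iff)
    then show "of_int (sign \<pi>) * rename_laurent \<rho> (rename_laurent \<pi> f)
      = of_int (sign (map_permutation S \<rho> \<pi>)) * rename_laurent (map_permutation S \<rho> \<pi>) (rename_laurent \<rho> f)"
      by (simp only: rename_laurent_comp sign_map_permutation[OF inj p assms(3)])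
  qed
  also have "\<dots> = (\<Sum>\<pi>\<in>type_perms (\<rho> ` S). of_int (sign \<pi>) * rename_laurent \<pi> (rename_laurent \<rho> f))"
    by (rule sum.reindex_bij_betw[OF bij, of "\<lambda>\<pi>. of_int (sign \<pi>) * rename_laurent \<pi> (rename_laurent \<rho> f)"])
  finally show ?thesis
    using bij_betw_same_card[OF bij]
    by (simp add: alternate_def rename_laurent_mult rename_laurent_sum)
qed

lemma lvars_alternate:
  assumes "lvars f \<subseteq> S"
  shows "lvars (alternate S f) \<subseteq> S"
  unfolding alternate_def
proof (intro lvars_mult_le lvars_sum_le)
  fix \<pi> assume "\<pi> \<in> type_perms S"
  then have "\<pi> ` S = S" by (auto simp: type_perms_def permutes_image)
  then show "lvars (rename_laurent \<pi> f) \<subseteq> S" using lvars_rename[of \<pi> f] assms by blast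
qed simp_all

section \<open>Words and labelled products\<close>

definition vars :: "nat \<times> nat \<Rightarrow> xyvar set"
  where "vars d = XV ` {1..fst d} \<union> YV ` {1..snd d}"

definition shift :: "nat \<times> nat \<Rightarrow> xyvar \<Rightarrow> xyvar"
  where "shift d z = (case z of XV i \<Rightarrow> XV (fst d + i) | YV j \<Rightarrow> YV (snd d + j))"

definition cross :: "xyvar set \<Rightarrow> xyvar set \<Rightarrow> laurent"
  where "cross S T = (\<Prod>s\<in>S. \<Prod>t\<in>T. kernel_xy s t)"

text \<open>The shuffle product before antisymmetrization; unlike the shuffle product itself it is
  associative by a direct comparison of factors.\<close>

definition lprod :: "nat \<times> nat \<Rightarrow> nat \<times> nat \<Rightarrow> laurent \<Rightarrow> laurent \<Rightarrow> laurent"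
  where "lprod d e f g = f * rename_laurent (shift d) g * cross (vars d) (shift d ` vars e)"

lemma finite_vars [simp]: "finite (vars d)"
  by (simp add: vars_def)

lemma vars_0 [simp]: "vars 0 = {}"
  by (simp add: vars_def)

lemma vars_iff [simp]: "XV i \<in> vars d \<longleftrightarrow> 1 \<le> i \<and> i \<le> fst d" "YV j \<in> vars d \<longleftrightarrow> 1 \<le> j \<and> j \<le> snd d"
  by (auto simp: vars_def)

lemma shift_simps [simp]: "shift d (XV i) = XV (fst d + i)" "shift d (YV j) = YV (snd d + j)"
  by (simp_all add: shift_def)

lemma inj_shift: "inj (shift d)"
  by (rule injI) (auto simp: shift_def split: xyvar.splits)

lemma shift_0: "shift 0 = id"
  by (auto simp: fun_eq_iff shift_def split: xyvar.splits)

lemma type_preserving_shift [simp]: "type_preserving (shift d)"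
  by (auto simp: type_preserving_def shift_def split: xyvar.splits)

lemma shift_comp: "shift d \<circ> shift e = shift (d + e)"
  by (auto simp: fun_eq_iff shift_def split: xyvar.splits)

lemma shift_vars_iff:
  "XV i \<in> shift d ` vars e \<longleftrightarrow> fst d < i \<and> i \<le> fst d + fst e"
  "YV j \<in> shift d ` vars e \<longleftrightarrow> snd d < j \<and> j \<le> snd d + snd e"
proof -
  have "XV i \<in> shift d ` vars e" if "fst d < i" "i \<le> fst d + fst e"
    by (rule image_eqI[of _ _ "XV (i - fst d)"]) (use that in auto)
  then show "XV i \<in> shift d ` vars e \<longleftrightarrow> fst d < i \<and> i \<le> fst d + fst e"
    by (auto simp: vars_def)
  have "YV j \<in> shift d ` vars e" if "snd d < j" "j \<le> snd d + snd e"
    by (rule image_eqI[of _ _ "YV (j - snd d)"]) (use that in auto)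
  then show "YV j \<in> shift d ` vars e \<longleftrightarrow> snd d < j \<and> j \<le> snd d + snd e"
    by (auto simp: vars_def)
qed

lemma vars_add: "vars (d + e) = vars d \<union> shift d ` vars e"
proof (rule Set.set_eqI)
  show "z \<in> vars (d + e) \<longleftrightarrow> z \<in> vars d \<union> shift d ` vars e" for z
    by (cases z) (auto simp: shift_vars_iff)
qed

lemma vars_shift_disjoint: "vars d \<inter> shift d ` vars e = {}"
  by (auto simp: vars_def)

lemma cross_Un_left: "finite A \<Longrightarrow> finite B \<Longrightarrow> A \<inter> B = {} \<Longrightarrow> cross (A \<union> B) C = cross A C * cross B C"
  and cross_Un_right: "finite A \<Longrightarrow> finite B \<Longrightarrow> A \<inter> B = {} \<Longrightarrow> cross C (A \<union> B) = cross C A * cross C B"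
  by (simp_all add: cross_def prod.union_disjoint prod.distrib)

lemma cross_empty [simp]: "cross {} T = 1" "cross S {} = 1"
  by (simp_all add: cross_def)

lemma rename_cross:
  assumes "inj \<rho>" "type_preserving \<rho>"
  shows "rename_laurent \<rho> (cross S T) = cross (\<rho> ` S) (\<rho> ` T)"
proof -
  have "inj_on \<rho> A" for A using assms(1) inj_on_subset by blast
  then show ?thesis
    by (simp add: cross_def rename_laurent_prod rename_kernel_xy[OF assms(2)] prod.reindex)
qed

lemma lvars_cross: "lvars (cross S T) \<subseteq> S \<union> T"
  unfolding cross_def by (intro lvars_prod_le) (use lvars_kernel_xy in fastforce)

lemma lvars_lprod:
  assumes "lvars f \<subseteq> vars d" "lvars g \<subseteq> vars e"
  shows "lvars (lprod d e f g) \<subseteq> vars (d + e)"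
  unfolding lprod_def vars_add
  by (intro lvars_mult_le order.trans[OF lvars_cross] order.trans[OF lvars_rename]) (use assms in auto)

text \<open>Both sides contain one cross factor for each pair among the three blocks of
  variables.\<close>

lemma lprod_assoc:
  "lprod d (e + h) f (lprod e h g k) = lprod (d + e) h (lprod d e f g) k"
proof -
  have im: "shift d ` shift e ` A = shift (d + e) ` A" for A
    by (simp add: image_comp shift_comp)
  have disj: "shift d ` vars e \<inter> shift (d + e) ` vars h = {}"
  proof -
    have "shift d ` (vars e \<inter> shift e ` vars h) = {}" by (simp add: vars_shift_disjoint)
    then show ?thesis by (simp only: image_Int[OF inj_shift] im)
  qed
  have "rename_laurent (shift d) (cross (vars e) (shift e ` vars h))
      = cross (shift d ` vars e) (shift (d + e) ` vars h)"
    by (simp add: rename_cross[OF inj_shift] im)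
  then show ?thesis
    by (simp add: lprod_def rename_laurent_mult rename_laurent_comp shift_comp vars_add image_Un im
        cross_Un_left cross_Un_right vars_shift_disjoint disj ac_simps)
qed

lemma lprod_1: "lprod 0 e 1 g = g"
  by (simp add: lprod_def shift_0)

lemma lprod_add_right: "lprod d e f (g + g') = lprod d e f g + lprod d e f g'"
  and lprod_lconst_right: "lprod d e f (lconst c * g) = lconst c * lprod d e f g"
  by (simp_all add: lprod_def rename_laurent_add rename_laurent_mult algebra_simps)

lemma rename_laurent_fixed:
  assumes "\<And>z. z \<in> lvars f \<Longrightarrow> \<rho> z = z"
  shows "rename_laurent \<rho> f = f"
  using rename_laurent_cong[of f \<rho> id] assms by simp

lemma rename_cross_perm:
  assumes "\<pi> \<in> type_perms S" "A \<inter> S = {} \<or> A = S" "B \<inter> S = {} \<or> B = S"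
  shows "rename_laurent \<pi> (cross A B) = cross A B"
proof -
  have p: "\<pi> permutes S" "type_preserving \<pi>" using assms(1) by (auto simp: type_perms_def)
  have "\<pi> ` C = C" if "C \<inter> S = {} \<or> C = S" for C
    using that
  proof
    assume "C \<inter> S = {}"
    then have "\<pi> z = z" if "z \<in> C" for z using permutes_not_in[OF p(1)] that by blast
    then show ?thesis by simp
  qed (simp add: permutes_image[OF p(1)])
  then show ?thesis using assms(2,3) by (simp add: rename_cross[OF permutes_inj[OF p(1)] p(2)])
qed

text \<open>Permutations inside one block fix the cross factor and the operand living on the other
  block, so \<open>alternate_absorb\<close> removes the inner alternations one at a time. Shuffle
  products can therefore be computed on numerators that are not yet alternated.\<close>

lemma alternate_lprod:
  assumes "lvars f \<subseteq> vars d" "lvars g \<subseteq> vars e"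
  shows "alternate (vars (d + e)) (lprod d e (alternate (vars d) f) (alternate (vars e) g))
    = alternate (vars (d + e)) (lprod d e f g)"
proof -
  let ?S = "vars (d + e)" and ?T = "shift d ` vars e"
  have fixed: "rename_laurent \<pi> h = h" if "\<pi> \<in> type_perms A" "lvars h \<subseteq> B" "A \<inter> B = {}" for \<pi> A B h
  proof (rule rename_laurent_fixed)
    fix z assume "z \<in> lvars h"
    then have "z \<notin> A" using that(2,3) by blast
    moreover have "\<pi> permutes A" using that(1) by (simp add: type_perms_def)
    ultimately show "\<pi> z = z" by (simp add: permutes_def)
  qed
  have disj: "vars d \<inter> ?T = {}" by (rule vars_shift_disjoint)
  have sub: "lvars (rename_laurent (shift d) h) \<subseteq> ?T" if "lvars h \<subseteq> vars e" for h
    using lvars_rename that by blast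
  have "alternate ?S (alternate (vars d) f * (rename_laurent (shift d) (alternate (vars e) g) * cross (vars d) ?T))
      = alternate ?S (f * (rename_laurent (shift d) (alternate (vars e) g) * cross (vars d) ?T))"
  proof (rule alternate_absorb)
    fix \<pi> assume \<pi>: "\<pi> \<in> type_perms (vars d)"
    have "rename_laurent \<pi> (rename_laurent (shift d) (alternate (vars e) g))
        = rename_laurent (shift d) (alternate (vars e) g)"
      by (rule fixed[OF \<pi> sub[OF lvars_alternate[OF assms(2)]] disj])
    moreover have "rename_laurent \<pi> (cross (vars d) ?T) = cross (vars d) ?T"
      by (rule rename_cross_perm[OF \<pi>]) (use disj in auto)
    ultimately show "rename_laurent \<pi> (rename_laurent (shift d) (alternate (vars e) g) * cross (vars d) ?T)
        = rename_laurent (shift d) (alternate (vars e) g) * cross (vars d) ?T"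
      by (simp only: rename_laurent_mult)
  qed (simp_all add: vars_add)
  \<comment> \<open>Renaming moves the second alternation to the shifted block, so that absorption
    applies once more.\<close>
  also have "f * (rename_laurent (shift d) (alternate (vars e) g) * cross (vars d) ?T)
      = alternate ?T (rename_laurent (shift d) g) * (f * cross (vars d) ?T)"
    by (simp add: rename_alternate_image[OF inj_shift] ac_simps)
  also have "alternate ?S \<dots> = alternate ?S (rename_laurent (shift d) g * (f * cross (vars d) ?T))"
  proof (rule alternate_absorb)
    fix \<pi> assume \<pi>: "\<pi> \<in> type_perms ?T"
    have "rename_laurent \<pi> f = f" by (rule fixed[OF \<pi> assms(1)]) (use disj in auto)
    moreover have "rename_laurent \<pi> (cross (vars d) ?T) = cross (vars d) ?T"
      by (rule rename_cross_perm[OF \<pi>]) (use disj in auto)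
    ultimately show "rename_laurent \<pi> (f * cross (vars d) ?T) = f * cross (vars d) ?T"
      by (simp only: rename_laurent_mult)
  qed (simp_all add: vars_add)
  finally show ?thesis by (simp add: lprod_def ac_simps)
qed

section \<open>Words in the generators and their labelled products\<close>

primrec letter_var :: "generator \<Rightarrow> xyvar"
  where "letter_var (Pgen i) = XV 1" | "letter_var (Qgen j) = YV 1"

primrec letter_exp :: "generator \<Rightarrow> int"
  where "letter_exp (Pgen i) = i" | "letter_exp (Qgen j) = j"

primrec letter_deg :: "generator \<Rightarrow> nat \<times> nat"
  where "letter_deg (Pgen i) = (1, 0)" | "letter_deg (Qgen j) = (0, 1)"

definition letter :: "generator \<Rightarrow> laurent"
  where "letter a = lmon (Poly_Mapping.single (letter_var a) (letter_exp a))"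

primrec word_deg :: "generator list \<Rightarrow> nat \<times> nat"
  where "word_deg [] = 0" | "word_deg (a # w) = letter_deg a + word_deg w"

primrec lword :: "generator list \<Rightarrow> laurent"
  where "lword [] = 1" | "lword (a # w) = lprod (letter_deg a) (word_deg w) (letter a) (lword w)"

lemma word_deg_append: "word_deg (u @ w) = word_deg u + word_deg w"
  by (induction u) (simp_all add: add.assoc)

lemma lword_append: "lword (u @ w) = lprod (word_deg u) (word_deg w) (lword u) (lword w)"
  by (induction u) (simp_all add: lprod_1 word_deg_append lprod_assoc)

lemma vars_letter: "vars (letter_deg a) = {letter_var a}"
  by (cases a) (auto simp: vars_def)

lemma lvars_letter: "lvars (letter a) \<subseteq> vars (letter_deg a)"
  by (simp add: letter_def vars_letter)

lemma lvars_lword: "lvars (lword w) \<subseteq> vars (word_deg w)"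
  by (induction w) (simp_all add: lvars_lprod lvars_letter)

lemma vars_remove_letter: "vars (letter_deg a + d) - {letter_var a} = shift (letter_deg a) ` vars d"
  using vars_shift_disjoint[of "letter_deg a" d] by (auto simp: vars_add vars_letter)

text \<open>The letter receives the least index of its type, so every \<open>swap_sign\<close> with
  it on the left is 1 and the signed kernel equals the plain one.\<close>

lemma front_letter:
  "front (vars (letter_deg a + d)) (letter_var a) = cross (vars (letter_deg a)) (shift (letter_deg a) ` vars d)"
proof -
  have "kernel_signed (letter_var a) z = kernel_xy (letter_var a) z" if "z \<in> shift (letter_deg a) ` vars d" for z
  proof -
    from that obtain t where "t \<in> vars d" "z = shift (letter_deg a) t" by blast
    then have "\<not> (is_X (letter_var a) = is_X z \<and> z < letter_var a)"
      by (cases a; cases t) (auto simp: less_xyvar_def)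
    then have "swap_sign (letter_var a) z = 1" unfolding swap_sign_def by (rule if_not_P)
    then show ?thesis by (simp add: kernel_signed_def)
  qed
  then show ?thesis unfolding front_def vars_remove_letter by (simp add: cross_def vars_letter)
qed

lemma lprod_letter:
  "lprod (letter_deg a) d f g
    = front (vars (letter_deg a + d)) (letter_var a) * (f * rename_laurent (shift (letter_deg a)) g)"
  unfolding lprod_def front_letter by (simp add: mult.commute mult.left_commute)

section \<open>The pairing recovers a word from its labelled product\<close>

context odd_generators
begin

primrec letter_val :: "generator \<Rightarrow> 'a"
  where "letter_val (Pgen i) = P i" | "letter_val (Qgen j) = Q j"

primrec word_val :: "generator list \<Rightarrow> 'a"
  where "word_val [] = 1" | "word_val (a # w) = letter_val a * word_val w"

lemma pairing_add: "pairing S (f + g) = pairing S f + pairing S g"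
  and pairing_lconst: "pairing S (lconst c * f) = sc c * pairing S f"
  and pairing_0 [simp]: "pairing S 0 = 0"
  by (simp_all add: pairing_def act_add act_mult act_lconst act_0)

lemma pairing_sum: "pairing S (sum F A) = (\<Sum>a\<in>A. pairing S (F a))"
  by (induction A rule: infinite_finite_induct) (simp_all add: pairing_add)

lemma pairing_of_int: "pairing S (of_int k * f) = of_int k * pairing S f"
  using pairing_lconst[of S "of_int k" f] by (simp only: lconst_of_int sc_of_int)

lemma pairing_alternate:
  assumes "finite S"
  shows "pairing S (alternate S f) = pairing S f"
proof -
  let ?c = "of_nat (card (type_perms S)) :: Cv"
  have "pairing S (\<Sum>\<pi>\<in>type_perms S. of_int (sign \<pi>) * rename_laurent \<pi> f)
      = (\<Sum>\<pi>\<in>type_perms S. of_int (sign \<pi> * sign \<pi>) * pairing S f)"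
    unfolding pairing_sum
    by (rule sum.cong) (simp_all only: pairing_of_int pairing_perm[OF _ assms] of_int_mult mult.assoc)
  also have "\<dots> = sc ?c * pairing S f"
    using sc_of_int[of "int (card (type_perms S))"] by simp
  finally have "pairing S (alternate S f) = sc (inverse ?c * ?c) * pairing S f"
    by (simp only: alternate_def pairing_lconst sc_mult mult.assoc)
  then show ?thesis using of_nat_Cv_neq_0[OF card_type_perms[OF assms]] by (simp add: sc_1)
qed

text \<open>The leading letter brings exactly the factor \<open>front\<close>, which
  \<open>act_front\<close> trades for left multiplication by the generator; the rest of the word is
  then paired with the smaller dual.\<close>

lemma pairing_lword: "pairing (vars (word_deg w)) (lword w) = word_val w"
proof (induction w)
  case Nil
  then show ?case by (simp add: pairing_def act_1 dual_empty)
next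
  case (Cons a w)
  let ?d = "letter_deg a" and ?z = "letter_var a"
  let ?S = "vars (word_deg (a # w))" and ?T = "shift ?d ` vars (word_deg w)"
  let ?r = "rename_laurent (shift ?d) (lword w)"
  let ?e = "Poly_Mapping.single ?z (letter_exp a)"
  have z: "?z \<in> ?S" by (simp add: vars_add vars_letter)
  have T: "?S - {?z} = ?T" using vars_remove_letter[of a "word_deg w"] by simp
  have "lvars ?r \<subseteq> ?T" using lvars_rename lvars_lword by blast
  then have nz: "?z \<notin> lvars ?r" using T by blast
  have "pairing ?S (lword (a # w)) = act (letter a * ?r) (act (front ?S ?z) (dual ?S)) 0"
    by (simp add: pairing_def lprod_letter mult.commute[of "front _ _"] act_mult)
  also have "\<dots> = act (letter a * ?r) (lmul ?z (dual ?T)) 0"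
    using act_front[OF _ z] T by simp
  also have "\<dots> = gen ?z (letter_exp a) * act ?r (dual ?T) ?e"
    by (simp only: act_mult act_lmul[OF nz] letter_def act_lmon) (simp add: lmul_def)
  also have "act ?r (dual ?T) ?e = act ?r (dual ?T) 0"
  proof -
    have "dual ?T (d + ?e) = dual ?T (d + 0)" for d
      by (rule dual_cong) (use T in \<open>auto simp: lookup_add lookup_single when_def\<close>)
    then show ?thesis by (simp only: act_def)
  qed
  also have "\<dots> = pairing (vars (word_deg w)) (lword w)"
  proof -
    \<comment> \<open>Shifting preserves the order within each type, so returning to unshifted
      variables costs no sign.\<close>
    have "order_sign (shift ?d) (vars (word_deg w)) = 1"
      by (rule order_sign_1) (auto simp: less_xyvar_def shift_def split: xyvar.splits)
    then show ?thesis
      using pairing_rename[OF inj_shift[of ?d] type_preserving_shift finite_vars, of "word_deg w" "lword w"]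
      by (simp add: pairing_def)
  qed
  also have "gen ?z (letter_exp a) = letter_val a" by (cases a) (simp_all add: gen_def)
  finally show ?case using Cons.IH by simp
qed

end

section \<open>Words span all skew-symmetric Laurent polynomials\<close>

text \<open>A linear span with the scalars built into the first rule; zero arises from coefficient
  0, since every bidegree contains a word.\<close>

inductive_set word_span :: "nat \<times> nat \<Rightarrow> laurent set" for d
  where word: "word_deg w = d \<Longrightarrow> lconst c * alternate (vars d) (lword w) \<in> word_span d"
  | add: "f \<in> word_span d \<Longrightarrow> g \<in> word_span d \<Longrightarrow> f + g \<in> word_span d"

lemma word_span_lconst: "f \<in> word_span d \<Longrightarrow> lconst c * f \<in> word_span d"
proof (induction rule: word_span.induct)
  case (word w b)
  then show ?case using word_span.word[of w d "c * b"] by (simp add: lconst_mult mult.assoc)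
qed (simp add: distrib_left word_span.add)

lemma word_span_of_int: "f \<in> word_span d \<Longrightarrow> of_int k * f \<in> word_span d"
  using word_span_lconst[of f d "of_int k"] by (simp only: lconst_of_int)

lemma word_exists: "\<exists>w. word_deg w = d"
proof -
  have "word_deg (replicate n (Pgen 0) @ replicate m (Qgen 0)) = (n, m)" for n m
  proof (induction n)
    case 0
    show ?case by (induction m) (simp_all add: zero_prod_def)
  qed simp
  then show ?thesis by (metis surj_pair)
qed

lemma word_span_0: "0 \<in> word_span d"
proof -
  obtain w where "word_deg w = d" using word_exists by blast
  from word_span.word[OF this, of 0] show ?thesis by simp
qed

lemma word_span_sum: "(\<And>a. a \<in> A \<Longrightarrow> F a \<in> word_span d) \<Longrightarrow> sum F A \<in> word_span d"
  by (induction A rule: infinite_finite_induct) (auto intro: word_span_0 word_span.add)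

text \<open>Left shuffle multiplication by a generator prefixes its letter to each word.\<close>

lemma word_span_letter:
  assumes "f \<in> word_span d"
  shows "alternate (vars (letter_deg a + d)) (lprod (letter_deg a) d (alternate (vars (letter_deg a)) (letter a)) f)
    \<in> word_span (letter_deg a + d)"
  using assms
proof (induction rule: word_span.induct)
  case (word w c)
  have "alternate (vars (letter_deg a + d)) (lprod (letter_deg a) d (alternate (vars (letter_deg a)) (letter a)) 
      (alternate (vars d) (lword w))) = alternate (vars (letter_deg a + d)) (lword (a # w))"
    using alternate_lprod[OF lvars_letter, of "lword w" d a] lvars_lword[of w] word by simp
  moreover have "lconst c * alternate (vars (letter_deg a + d)) (lword (a # w)) \<in> word_span (letter_deg a + d)"
    by (rule word_span.word) (simp add: word)
  ultimately show ?case by (simp add: lprod_lconst_right alternate_lconst)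
next
  case (add f g)
  then show ?case by (simp add: lprod_add_right alternate_add word_span.add)
qed

lemma push_keys_surj:
  assumes "Poly_Mapping.keys e \<subseteq> \<rho> ` A"
  obtains e' where "Poly_Mapping.keys e' \<subseteq> A" "push_keys \<rho> e' = e"
proof
  let ?i = "inv_into A \<rho>"
  show "Poly_Mapping.keys (push_keys ?i e) \<subseteq> A"
    using keys_push_keys[of ?i e] assms by (auto dest!: subsetD intro: inv_into_into)
  have "push_keys \<rho> (push_keys ?i e) = push_keys (\<lambda>k. k) e"
    unfolding push_keys_comp
    by (rule push_keys_cong) (use assms in \<open>auto simp: f_inv_into_f\<close>)
  then show "push_keys \<rho> (push_keys ?i e) = e" by (simp add: push_keys_id)
qed

text \<open>A leading letter only produces the \<open>front\<close> of the first variable of its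
  type. A multiple of another \<open>front\<close> is moved there by a transposition, at the cost of
  a sign under alternation.\<close>

theorem alternate_in_word_span:
  assumes "lvars g \<subseteq> vars d"
  shows "alternate (vars d) g \<in> word_span d"
  using assms
proof (induction "fst d + snd d" arbitrary: d g rule: less_induct)
  case less
  show ?case
  proof (cases "d = 0")
    case True
    have "lmon e = 1" if "e \<in> Poly_Mapping.keys g" for e
    proof -
      have "Poly_Mapping.keys e = {}" using less.prems that True by (auto simp: lvars_def)
      then show ?thesis by simp
    qed
    then have "g = (\<Sum>e\<in>Poly_Mapping.keys g. lconst (Poly_Mapping.lookup g e) * lword [])"
      by (subst laurent_expand) (rule sum.cong, auto)
    then have "alternate (vars d) g
        = alternate (vars d) (\<Sum>e\<in>Poly_Mapping.keys g. lconst (Poly_Mapping.lookup g e) * lword [])"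
      by (rule arg_cong)
    also have "\<dots> = (\<Sum>e\<in>Poly_Mapping.keys g. lconst (Poly_Mapping.lookup g e) * alternate (vars d) (lword []))"
      by (simp only: alternate_lconst alternate_sum)
    also have "\<dots> \<in> word_span d"
      by (intro word_span_sum word_span.word) (simp add: True)
    finally show ?thesis .
  next
    case False
    then have ne: "vars d \<noteq> {}" by (cases d) (auto simp: vars_def zero_prod_def)
    \<comment> \<open>Such a product is the labelled product of a letter with a monomial in one
      variable fewer: the exponent of the first variable becomes the mode of the letter.\<close>
    have mono: "alternate (vars d) (front (vars d) (letter_var a) * lmon e) \<in> word_span d"
      if e: "Poly_Mapping.keys e \<subseteq> vars d" and a: "letter_exp a = Poly_Mapping.lookup e (letter_var a)"
        "letter_var a \<in> vars d" for a e
    proof -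
      let ?a = "letter_deg a"
      define d' where "d' = (fst d - fst ?a, snd d - snd ?a)"
      have d: "d = ?a + d'" using a(2) by (cases a; cases d) (auto simp: d'_def)
      let ?e = "e - Poly_Mapping.single (letter_var a) (letter_exp a)"
      have "Poly_Mapping.keys ?e \<subseteq> vars d - {letter_var a}"
        using e a(1) by (auto simp: in_keys_iff lookup_minus lookup_single when_def split: if_splits)
      then have "Poly_Mapping.keys ?e \<subseteq> shift ?a ` vars d'"
        using vars_remove_letter[of a d'] d by simp
      then obtain e' where e': "Poly_Mapping.keys e' \<subseteq> vars d'" "push_keys (shift ?a) e' = ?e"
        by (rule push_keys_surj)
      have "lmon e = letter a * rename_laurent (shift ?a) (lmon e')"
        by (simp add: letter_def rename_laurent_lmon e'(2) flip: lmon_add)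
      then have "front (vars d) (letter_var a) * lmon e = lprod ?a d' (letter a) (lmon e')"
        by (simp add: lprod_letter d)
      moreover have "fst d' + snd d' < fst d + snd d" using d by (cases a) auto
      then have "alternate (vars d') (lmon e') \<in> word_span d'"
        by (rule less.hyps) (simp add: e'(1))
      then have "alternate (vars d) (lprod ?a d' (alternate (vars ?a) (letter a)) (alternate (vars d') (lmon e'))) \<in> word_span d"
        unfolding d by (rule word_span_letter)
      then have "alternate (vars d) (lprod ?a d' (letter a) (lmon e')) \<in> word_span d"
        unfolding d using alternate_lprod[OF lvars_letter, of "lmon e'" d' a] e'(1) by simp
      ultimately show ?thesis by simp
    qed
    have first: "alternate (vars d) (front (vars d) z * h) \<in> word_span d"
      if h: "lvars h \<subseteq> vars d" and z: "z \<in> vars d" "z = XV 1 \<or> z = YV 1" for z h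
    proof -
      have "alternate (vars d) (front (vars d) z * lmon e) \<in> word_span d" if "e \<in> Poly_Mapping.keys h" for e
      proof -
        have e: "Poly_Mapping.keys e \<subseteq> vars d" using h that by (auto simp: lvars_def)
        show ?thesis
          using z(2) mono[OF e, of "Pgen (Poly_Mapping.lookup e z)"] mono[OF e, of "Qgen (Poly_Mapping.lookup e z)"] z(1)
          by auto
      qed
      then have "(\<Sum>e\<in>Poly_Mapping.keys h. lconst (Poly_Mapping.lookup h e) * alternate (vars d) (front (vars d) z * lmon e)) \<in> word_span d"
        by (intro word_span_sum word_span_lconst)
      also have "(\<Sum>e\<in>Poly_Mapping.keys h. lconst (Poly_Mapping.lookup h e) * alternate (vars d) (front (vars d) z * lmon e))
          = alternate (vars d) (front (vars d) z * (\<Sum>e\<in>Poly_Mapping.keys h. lconst (Poly_Mapping.lookup h e) * lmon e))"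
        by (simp add: sum_distrib_left alternate_sum mult.left_commute[of "front _ _"] alternate_lconst)
      finally show ?thesis by (simp flip: laurent_expand)
    qed
    have any: "alternate (vars d) (front (vars d) z * h) \<in> word_span d"
      if h: "lvars h \<subseteq> vars d" and z: "z \<in> vars d" for z h
    proof -
      define z1 where "z1 = (if is_X z then XV 1 else YV 1)"
      have z1: "z1 \<in> vars d" "is_X z = is_X z1" "z1 = XV 1 \<or> z1 = YV 1"
        using z by (cases z; auto simp: z1_def)+
      let ?t = "transpose z z1"
      have t: "?t \<in> type_perms (vars d)" by (rule transpose_type_perms[OF z z1(1,2)])
      then have t': "inj ?t" "type_preserving ?t" "?t ` vars d = vars d"
        by (auto simp: type_perms_def permutes_image)
      have "lvars (rename_laurent ?t h) \<subseteq> vars d" using lvars_rename[of ?t h] h t'(3) by blast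
      \<comment> \<open>The integer \<open>k\<close> is the product of order ratios supplied by
        \<open>rename_front\<close>.\<close>
      from first[OF this z1(1,3)] obtain k :: int where
        "of_int k * alternate (vars d) (front (vars d) z1 * rename_laurent ?t h) \<in> word_span d"
        "rename_laurent ?t (front (vars d) z * h) = of_int k * (front (vars d) z1 * rename_laurent ?t h)"
        using rename_front[OF t'(1,2), of "vars d" z] t'(3)
        by (auto simp: rename_laurent_mult mult.assoc simp del: of_int_prod intro: word_span_of_int)
      then have "alternate (vars d) (rename_laurent ?t (front (vars d) z * h)) \<in> word_span d"
        by (simp add: alternate_of_int)
      then have "of_int (sign ?t * sign ?t) * alternate (vars d) (front (vars d) z * h) \<in> word_span d"
        using word_span_of_int[of _ d "sign ?t"] by (simp only: alternate_rename[OF t finite_vars] of_int_mult mult.assoc)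
      then show ?thesis by simp
    qed
    have "g = (\<Sum>z\<in>vars d. coef (vars d) z * front (vars d) z) * g"
      by (simp add: coef(1)[OF finite_vars ne])
    also have "\<dots> = (\<Sum>z\<in>vars d. front (vars d) z * (coef (vars d) z * g))"
      by (simp add: sum_distrib_left ac_simps)
    finally have "alternate (vars d) g = (\<Sum>z\<in>vars d. alternate (vars d) (front (vars d) z * (coef (vars d) z * g)))"
      by (metis alternate_sum)
    also have "\<dots> \<in> word_span d"
      by (intro word_span_sum any lvars_mult_le coef(2)[OF finite_vars ne] less.prems)
    finally show ?thesis .
  qed
qed

section \<open>Numerators\<close>

lemma of_laurent_0 [simp]: "of_laurent 0 = 0"
  and of_laurent_1 [simp]: "of_laurent 1 = 1"
  and of_laurent_add: "of_laurent (f + g) = of_laurent f + of_laurent g"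
  and of_laurent_mult: "of_laurent (f * g) = of_laurent f * of_laurent g"
  and of_laurent_uminus: "of_laurent (- f) = - of_laurent f"
  and of_laurent_diff: "of_laurent (f - g) = of_laurent f - of_laurent g"
  and of_laurent_eq_iff [simp]: "of_laurent f = of_laurent g \<longleftrightarrow> f = g"
  by (simp_all add: of_laurent_def Zero_fract_def One_fract_def eq_fract)

lemma of_laurent_eq_0_iff [simp]: "of_laurent f = 0 \<longleftrightarrow> f = 0"
  using of_laurent_eq_iff[of f 0] by simp

lemma of_laurent_prod: "of_laurent (prod F A) = (\<Prod>a\<in>A. of_laurent (F a))"
  by (induction A rule: infinite_finite_induct) (simp_all add: of_laurent_mult)

lemma of_laurent_of_nat [simp]: "of_laurent (of_nat n) = of_nat n"
  by (induction n) (simp_all add: of_laurent_add)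

lemma of_laurent_of_int [simp]: "of_laurent (of_int k) = of_int k"
  by (cases k rule: int_diff_cases) (simp add: of_laurent_diff)

lemma Fract_conv: "b \<noteq> 0 \<Longrightarrow> Fraction_Field.Fract a b = of_laurent a / of_laurent b"
  by (simp add: of_laurent_def)

lemma rename_frac:
  assumes "inj \<rho>" "b \<noteq> 0"
  shows "rename \<rho> (of_laurent a / of_laurent b)
    = of_laurent (rename_laurent \<rho> a) / of_laurent (rename_laurent \<rho> b)"
  using rename_Fract[OF assms, of a] assms by (simp add: Fract_conv rename_laurent_eq_0_iff)

lemma frac_exists: "\<exists>a b. b \<noteq> 0 \<and> F = of_laurent a / of_laurent b"
proof -
  obtain a b where "F = Fraction_Field.Fract a b" "b \<noteq> 0" by (cases F)
  then show ?thesis using Fract_conv by blast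
qed

lemma rename_add:
  assumes "inj \<rho>"
  shows "rename \<rho> (F + G) = rename \<rho> F + rename \<rho> G"
proof -
  obtain a b where F: "b \<noteq> 0" "F = of_laurent a / of_laurent b" using frac_exists by blast
  obtain c d where G: "d \<noteq> 0" "G = of_laurent c / of_laurent d" using frac_exists by blast
  have FG: "F + G = of_laurent (a * d + c * b) / of_laurent (b * d)"
    using F G by (simp add: add_frac_eq of_laurent_add of_laurent_mult)
  have "b * d \<noteq> 0" using F(1) G(1) by simp
  then have "rename \<rho> (F + G)
      = of_laurent (rename_laurent \<rho> (a * d + c * b)) / of_laurent (rename_laurent \<rho> (b * d))"
    unfolding FG by (rule rename_frac[OF assms])
  also have "\<dots> = rename \<rho> F + rename \<rho> G"
    unfolding F(2) G(2) rename_frac[OF assms F(1)] rename_frac[OF assms G(1)]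
    using F(1) G(1) by (simp add: rename_laurent_add rename_laurent_mult of_laurent_add of_laurent_mult
        rename_laurent_eq_0_iff[OF assms] add_frac_eq)
  finally show ?thesis .
qed

lemma rename_0: "inj \<rho> \<Longrightarrow> rename \<rho> 0 = 0"
  using rename_frac[of \<rho> 1 0] by simp

section \<open>The common denominator of a bidegree\<close>

definition diff_prod :: "xyvar set \<Rightarrow> xyvar set \<Rightarrow> laurent"
  where "diff_prod A B = (\<Prod>a\<in>A. \<Prod>b\<in>B. lvar a - lvar b)"

definition vars_X :: "nat \<times> nat \<Rightarrow> xyvar set"
  where "vars_X d = {z\<in>vars d. is_X z}"

definition vars_Y :: "nat \<times> nat \<Rightarrow> xyvar set"
  where "vars_Y d = {z\<in>vars d. \<not> is_X z}"

lemma vars_XY_image: "vars_X d = XV ` {1..fst d}" "vars_Y d = YV ` {1..snd d}"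
  by (auto simp: vars_X_def vars_Y_def vars_def)

lemma finite_vars_XY [simp]: "finite (vars_X d)" "finite (vars_Y d)"
  by (simp_all add: vars_X_def vars_Y_def)

lemma vars_split: "vars d = vars_X d \<union> vars_Y d" "vars_X d \<inter> vars_Y d = {}"
  unfolding vars_X_def vars_Y_def by blast+

lemma vars_XY_add:
  "vars_X (d + e) = vars_X d \<union> shift d ` vars_X e" "vars_X d \<inter> shift d ` vars_X e = {}"
  "vars_Y (d + e) = vars_Y d \<union> shift d ` vars_Y e" "vars_Y d \<inter> shift d ` vars_Y e = {}"
  using vars_shift_disjoint[of d e] by (auto simp: vars_X_def vars_Y_def vars_add)

definition denom :: "nat \<times> nat \<Rightarrow> laurent"
  where "denom d = diff_prod (vars_X d) (vars_Y d)"

definition of_numerator :: "nat \<times> nat \<Rightarrow> laurent \<Rightarrow> ratfun"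
  where "of_numerator d f = of_laurent f / of_laurent (denom d)"

lemma rename_laurent_diff: "rename_laurent \<rho> (f - g) = rename_laurent \<rho> f - rename_laurent \<rho> g"
  using rename_laurent_add[of \<rho> f "- g"] by (simp add: rename_laurent_uminus)

lemma rename_diff_prod:
  assumes "inj \<rho>"
  shows "rename_laurent \<rho> (diff_prod A B) = diff_prod (\<rho> ` A) (\<rho> ` B)"
proof -
  have "inj_on \<rho> C" for C using assms inj_on_subset by blast
  then show ?thesis by (simp add: diff_prod_def rename_laurent_prod rename_laurent_diff prod.reindex)
qed

lemma lvar_inject: "lvar z = lvar z' \<longleftrightarrow> z = z'"
proof
  assume "lvar z = lvar z'"
  then have "lvars (lvar z) = lvars (lvar z')" by (rule arg_cong)
  then show "z = z'" by simp
qed simp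

lemma denom_neq_0: "denom d \<noteq> 0"
  unfolding denom_def diff_prod_def by (auto simp: lvar_inject vars_X_def vars_Y_def)

text \<open>The symmetry of the denominator makes skew-symmetry of a fraction a condition on its
  numerator alone.\<close>

lemma denom_perm:
  assumes "\<pi> \<in> type_perms (vars d)"
  shows "rename_laurent \<pi> (denom d) = denom d"
proof -
  have p: "\<pi> permutes vars d" "type_preserving \<pi>" using assms by (auto simp: type_perms_def)
  have "\<pi> ` vars_X d = {z\<in>\<pi> ` vars d. is_X z}" "\<pi> ` vars_Y d = {z\<in>\<pi> ` vars d. \<not> is_X z}"
    using p(2) by (auto simp: vars_X_def vars_Y_def)
  then have "\<pi> ` vars_X d = vars_X d" "\<pi> ` vars_Y d = vars_Y d"
    unfolding permutes_image[OF p(1)] by (simp_all add: vars_X_def vars_Y_def)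
  then show ?thesis by (simp add: denom_def rename_diff_prod[OF permutes_inj[OF p(1)]])
qed

lemma of_numerator_0 [simp]: "of_numerator d 0 = 0"
  and of_numerator_add: "of_numerator d (f + g) = of_numerator d f + of_numerator d g"
  and of_numerator_lconst: "of_numerator d (lconst c * f) = rat_const c * of_numerator d f"
  and of_numerator_of_int: "of_numerator d (of_int k * f) = of_int k * of_numerator d f"
  and of_numerator_eq_iff: "of_numerator d f = of_numerator d g \<longleftrightarrow> f = g"
  by (simp_all add: of_numerator_def of_laurent_add of_laurent_mult add_divide_distrib rat_const_def
      lconst_def denom_neq_0)

lemma of_numerator_sum: "of_numerator d (sum F A) = (\<Sum>a\<in>A. of_numerator d (F a))"
  by (induction A rule: infinite_finite_induct) (simp_all add: of_numerator_add)

lemma rename_of_numerator: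
  assumes "\<pi> \<in> type_perms (vars d)"
  shows "rename \<pi> (of_numerator d f) = of_numerator d (rename_laurent \<pi> f)"
proof -
  have "inj \<pi>" using assms permutes_inj[of \<pi> "vars d"] by (simp add: type_perms_def)
  then show ?thesis
    unfolding of_numerator_def by (simp only: rename_frac denom_neq_0 not_False_eq_True denom_perm[OF assms])
qed

section \<open>Pairs of index permutations as permutations of variables\<close>

definition xy_map :: "(nat \<Rightarrow> nat) \<Rightarrow> (nat \<Rightarrow> nat) \<Rightarrow> xyvar \<Rightarrow> xyvar"
  where "xy_map \<sigma> \<tau> z = (case z of XV i \<Rightarrow> XV (\<sigma> i) | YV j \<Rightarrow> YV (\<tau> j))"

lemma rename_xy_eq: "rename_xy \<sigma> \<tau> = rename (xy_map \<sigma> \<tau>)"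
  by (simp add: rename_xy_def xy_map_def[abs_def])

text \<open>Each of the two factors is a \<open>map_permutation\<close> along the constructor
  \<open>XV\<close> or \<open>YV\<close>, which preserves the sign; the sign is multiplicative over
  their composition.\<close>

lemma xy_map_perm:
  assumes "\<sigma> permutes {1..n}" "\<tau> permutes {1..m}"
  shows "xy_map \<sigma> \<tau> \<in> type_perms (vars (n, m))" "sign (xy_map \<sigma> \<tau>) = sign \<sigma> * sign \<tau>"
proof -
  have inj: "inj_on XV A" "inj_on YV A" for A by (auto simp: inj_on_def)
  have X: "xy_map \<sigma> id = map_permutation {1..n} XV \<sigma>"
  proof
    fix z
    have p: "map_permutation {1..n} XV \<sigma> permutes XV ` {1..n}"
      by (rule map_permutation_permutes[OF _ assms(1)]) (simp add: bij_betw_def inj)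
    show "xy_map \<sigma> id z = map_permutation {1..n} XV \<sigma> z"
    proof (cases z)
      case (XV i)
      show ?thesis
      proof (cases "i \<in> {1..n}")
        case True
        show ?thesis unfolding XV map_permutation_apply[OF inj(1) True] by (simp add: xy_map_def)
      next
        case False
        then have "\<sigma> i = i" "XV i \<notin> XV ` {1..n}" using permutes_not_in[OF assms(1)] by auto
        then show ?thesis using permutes_not_in[OF p, of z] XV by (simp add: xy_map_def)
      qed
    next
      case (YV j)
      then have "z \<notin> XV ` {1..n}" by auto
      then show ?thesis using permutes_not_in[OF p, of z] YV by (simp add: xy_map_def)
    qed
  qed
  have Y: "xy_map id \<tau> = map_permutation {1..m} YV \<tau>"
  proof
    fix z
    have p: "map_permutation {1..m} YV \<tau> permutes YV ` {1..m}"
      by (rule map_permutation_permutes[OF _ assms(2)]) (simp add: bij_betw_def inj)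
    show "xy_map id \<tau> z = map_permutation {1..m} YV \<tau> z"
    proof (cases z)
      case (YV i)
      show ?thesis
      proof (cases "i \<in> {1..m}")
        case True
        show ?thesis unfolding YV map_permutation_apply[OF inj(2) True] by (simp add: xy_map_def)
      next
        case False
        then have "\<tau> i = i" "YV i \<notin> YV ` {1..m}" using permutes_not_in[OF assms(2)] by auto
        then show ?thesis using permutes_not_in[OF p, of z] YV by (simp add: xy_map_def)
      qed
    next
      case (XV j)
      then have "z \<notin> YV ` {1..m}" by auto
      then show ?thesis using permutes_not_in[OF p, of z] XV by (simp add: xy_map_def)
    qed
  qed
  have comp: "xy_map \<sigma> \<tau> = xy_map \<sigma> id \<circ> xy_map id \<tau>"
    by (auto simp: fun_eq_iff xy_map_def split: xyvar.splits)
  have PX: "xy_map \<sigma> id permutes XV ` {1..n}"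
    unfolding X by (rule map_permutation_permutes[OF _ assms(1)]) (simp add: bij_betw_def inj)
  have PY: "xy_map id \<tau> permutes YV ` {1..m}"
    unfolding Y by (rule map_permutation_permutes[OF _ assms(2)]) (simp add: bij_betw_def inj)
  have "xy_map \<sigma> \<tau> permutes vars (n, m)"
    unfolding comp by (rule permutes_compose; rule permutes_subset[OF PX] permutes_subset[OF PY]) (auto simp: vars_def)
  then show "xy_map \<sigma> \<tau> \<in> type_perms (vars (n, m))"
    by (auto simp: type_perms_def type_preserving_def xy_map_def split: xyvar.splits)
  have "permutation (xy_map \<sigma> id)" "permutation (xy_map id \<tau>)"
    using PX PY unfolding permutation_permutes by blast+
  then show "sign (xy_map \<sigma> \<tau>) = sign \<sigma> * sign \<tau>"
    unfolding comp
    by (simp add: sign_compose) (simp add: X Y sign_map_permutation[OF inj(1) assms(1)] sign_map_permutation[OF inj(2) assms(2)] del: One_nat_def)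
qed

lemma xy_map_surj:
  assumes "\<pi> \<in> type_perms (vars (n, m))"
  obtains \<sigma> \<tau> where "\<sigma> permutes {1..n}" "\<tau> permutes {1..m}" "\<pi> = xy_map \<sigma> \<tau>"
proof -
  have p: "\<pi> permutes vars (n, m)" "type_preserving \<pi>" using assms by (auto simp: type_perms_def)
  \<comment> \<open>The default 0 is never attained, here and for \<open>\<tau>\<close>, because
    \<open>\<pi>\<close> preserves types.\<close>
  define \<sigma> where "\<sigma> i = (case \<pi> (XV i) of XV k \<Rightarrow> k | YV k \<Rightarrow> 0)" for i
  define \<tau> where "\<tau> i = (case \<pi> (YV i) of XV k \<Rightarrow> 0 | YV k \<Rightarrow> k)" for i
  have \<sigma>: "\<pi> (XV i) = XV (\<sigma> i)" for i
    using type_preservingD[OF p(2), of "XV i"] by (cases "\<pi> (XV i)") (simp_all add: \<sigma>_def)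
  have \<tau>: "\<pi> (YV i) = YV (\<tau> i)" for i
    using type_preservingD[OF p(2), of "YV i"] by (cases "\<pi> (YV i)") (simp_all add: \<tau>_def)
  note inj = injD[OF permutes_inj[OF p(1)]]
  have "\<sigma> permutes {1..n}"
  proof (rule inj_imp_permutes)
    show "inj_on \<sigma> {1..n}" by (rule inj_onI) (metis \<sigma> inj xyvar.inject(1))
    show "\<sigma> i \<in> {1..n}" if "i \<in> {1..n}" for i
      using permutes_in_image[OF p(1), of "XV i"] that \<sigma>[of i] by simp
    show "\<sigma> i = i" if "i \<notin> {1..n}" for i
      using permutes_not_in[OF p(1), of "XV i"] that \<sigma>[of i] by auto
  qed simp
  moreover have "\<tau> permutes {1..m}"
  proof (rule inj_imp_permutes)
    show "inj_on \<tau> {1..m}" by (rule inj_onI) (metis \<tau> inj xyvar.inject(2))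
    show "\<tau> i \<in> {1..m}" if "i \<in> {1..m}" for i
      using permutes_in_image[OF p(1), of "YV i"] that \<tau>[of i] by simp
    show "\<tau> i = i" if "i \<notin> {1..m}" for i
      using permutes_not_in[OF p(1), of "YV i"] that \<tau>[of i] by auto
  qed simp
  moreover have "\<pi> = xy_map \<sigma> \<tau>"
    by (auto simp: fun_eq_iff xy_map_def \<sigma> \<tau> split: xyvar.splits)
  ultimately show thesis by (rule that)
qed

lemma bij_betw_xy_map:
  "bij_betw (\<lambda>(\<sigma>, \<tau>). xy_map \<sigma> \<tau>) ({\<sigma>. \<sigma> permutes {1..n}} \<times> {\<tau>. \<tau> permutes {1..m}})
    (type_perms (vars (n, m)))"
proof (rule bij_betw_imageI)
  show "inj_on (\<lambda>(\<sigma>, \<tau>). xy_map \<sigma> \<tau>) ({\<sigma>. \<sigma> permutes {1..n}} \<times> {\<tau>. \<tau> permutes {1..m}})"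
  proof (rule inj_onI, clarify)
    fix \<sigma> \<tau> \<sigma>' \<tau>' assume eq: "xy_map \<sigma> \<tau> = xy_map \<sigma>' \<tau>'"
    have "\<sigma> i = \<sigma>' i" "\<tau> i = \<tau>' i" for i
      using fun_cong[OF eq, of "XV i"] fun_cong[OF eq, of "YV i"] by (simp_all add: xy_map_def)
    then show "\<sigma> = \<sigma>' \<and> \<tau> = \<tau>'" by (simp add: fun_eq_iff)
  qed
  show "(\<lambda>(\<sigma>, \<tau>). xy_map \<sigma> \<tau>) ` ({\<sigma>. \<sigma> permutes {1..n}} \<times> {\<tau>. \<tau> permutes {1..m}})
      = type_perms (vars (n, m))"
  proof (intro subset_antisym subsetI)
    fix \<pi> assume "\<pi> \<in> type_perms (vars (n, m))"
    then obtain \<sigma> \<tau> where "\<sigma> permutes {1..n}" "\<tau> permutes {1..m}" "\<pi> = xy_map \<sigma> \<tau>"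
      by (rule xy_map_surj)
    then show "\<pi> \<in> (\<lambda>(\<sigma>, \<tau>). xy_map \<sigma> \<tau>) ` ({\<sigma>. \<sigma> permutes {1..n}} \<times> {\<tau>. \<tau> permutes {1..m}})"
      by force
  qed (auto intro: xy_map_perm)
qed

text \<open>The symmetric denominator passes through every renaming, and n! m! is the order of the
  group averaged over in \<open>alternate\<close>.\<close>

lemma ASym_of_numerator: "ASym n m (of_numerator (n, m) f) = of_numerator (n, m) (alternate (vars (n, m)) f)"
proof -
  let ?T = "type_perms (vars (n, m))"
  have "card ?T = fact n * fact m"
    using bij_betw_same_card[OF bij_betw_xy_map[of n m]]
    by (simp add: card_cartesian_product card_permutations)
  moreover have "(\<Sum>\<sigma> | \<sigma> permutes {1..n}. \<Sum>\<tau> | \<tau> permutes {1..m}.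
       of_int (sign \<sigma>) * of_int (sign \<tau>) * rename_xy \<sigma> \<tau> (of_numerator (n, m) f))
     = (\<Sum>\<pi>\<in>?T. of_int (sign \<pi>) * rename \<pi> (of_numerator (n, m) f))"
    unfolding sum.cartesian_product
    by (subst sum.reindex_bij_betw[OF bij_betw_xy_map, symmetric])
      (auto intro!: sum.cong simp: rename_xy_eq xy_map_perm(2))
  moreover have "(\<Sum>\<pi>\<in>?T. of_int (sign \<pi>) * rename \<pi> (of_numerator (n, m) f))
     = of_numerator (n, m) (\<Sum>\<pi>\<in>?T. of_int (sign \<pi>) * rename_laurent \<pi> f)"
    by (simp add: of_numerator_sum of_numerator_of_int rename_of_numerator)
  moreover have "rat_const (inverse (of_nat k)) = inverse (of_nat k)" if "k \<noteq> 0" for k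
  proof -
    have "lconst (inverse (of_nat k)) * of_nat k = 1"
    proof -
      have "(of_nat k :: laurent) = lconst (of_nat k)" using lconst_of_int[of "int k"] by simp
      then show ?thesis using of_nat_Cv_neq_0[OF that] by (simp flip: lconst_mult)
    qed
    then have "of_laurent (lconst (inverse (of_nat k))) * of_nat k = 1"
      by (metis of_laurent_1 of_laurent_mult of_laurent_of_nat)
    then show ?thesis unfolding rat_const_def lconst_def by (metis inverse_unique mult.commute inverse_inverse_eq)
  qed
  ultimately show ?thesis
    by (simp add: ASym_def alternate_def of_numerator_lconst divide_inverse mult.commute del: of_nat_mult of_nat_fact)
qed

text \<open>The definition tests the two symmetric groups separately; since
  \<open>xy_map \<sigma> \<tau>\<close> is a composition of one element from each, this amounts to a
  condition on the whole product group.\<close>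

lemma skew_symmetric_of_numerator:
  "skew_symmetric n m (of_numerator (n, m) f)
    \<longleftrightarrow> (\<forall>\<pi>\<in>type_perms (vars (n, m)). rename_laurent \<pi> f = of_int (sign \<pi>) * f)"
proof -
  have eq: "rename_xy \<sigma> \<tau> (of_numerator (n, m) f) = of_int k * of_numerator (n, m) f
      \<longleftrightarrow> rename_laurent (xy_map \<sigma> \<tau>) f = of_int k * f"
    if "\<sigma> permutes {1..n}" "\<tau> permutes {1..m}" for \<sigma> \<tau> k
    by (simp add: rename_xy_eq rename_of_numerator xy_map_perm(1)[OF that] of_numerator_eq_iff
        flip: of_numerator_of_int)
  show ?thesis
  proof
    assume "\<forall>\<pi>\<in>type_perms (vars (n, m)). rename_laurent \<pi> f = of_int (sign \<pi>) * f"
    then show "skew_symmetric n m (of_numerator (n, m) f)"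
      using xy_map_perm[of _ n id m] xy_map_perm[of id n _ m]
      by (auto simp: skew_symmetric_def eq permutes_id simp del: One_nat_def)
  next
    assume "skew_symmetric n m (of_numerator (n, m) f)"
    then have X: "\<sigma> permutes {1..n} \<Longrightarrow> rename_laurent (xy_map \<sigma> id) f = of_int (sign \<sigma>) * f"
      and Y: "\<tau> permutes {1..m} \<Longrightarrow> rename_laurent (xy_map id \<tau>) f = of_int (sign \<tau>) * f" for \<sigma> \<tau>
      by (auto simp: skew_symmetric_def eq permutes_id simp del: One_nat_def)
    show "\<forall>\<pi>\<in>type_perms (vars (n, m)). rename_laurent \<pi> f = of_int (sign \<pi>) * f"
    proof
      fix \<pi> assume "\<pi> \<in> type_perms (vars (n, m))"
      then obtain \<sigma> \<tau> where p: "\<sigma> permutes {1..n}" "\<tau> permutes {1..m}" "\<pi> = xy_map \<sigma> \<tau>"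
        by (rule xy_map_surj)
      have "xy_map \<sigma> \<tau> = xy_map \<sigma> id \<circ> xy_map id \<tau>"
        by (auto simp: fun_eq_iff xy_map_def split: xyvar.splits)
      then have "rename_laurent \<pi> f = rename_laurent (xy_map \<sigma> id) (rename_laurent (xy_map id \<tau>) f)"
        by (simp add: p(3) rename_laurent_comp)
      then show "rename_laurent \<pi> f = of_int (sign \<pi>) * f"
        using p by (simp add: X Y rename_laurent_mult xy_map_perm(2) ac_simps)
    qed
  qed
qed

lemma Lambda_comp_eq:
  "Lambda_comp n m = of_numerator (n, m) ` {f. lvars f \<subseteq> vars (n, m) \<and>
    (\<forall>\<pi>\<in>type_perms (vars (n, m)). rename_laurent \<pi> f = of_int (sign \<pi>) * f)}"
proof -
  have inj: "inj_on XV A" "inj_on YV A" for A by (auto simp: inj_on_def)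
  have den: "(\<Prod>i\<in>{1..n}. \<Prod>j\<in>{1..m}. xvar i - yvar j) = of_laurent (denom (n, m))"
    by (simp add: denom_def diff_prod_def vars_XY_image prod.reindex inj of_laurent_prod of_laurent_diff rat_var_def lmon_def)
  have "F \<in> Lambda_comp n m \<longleftrightarrow> (\<exists>f. lvars f \<subseteq> vars (n, m) \<and> skew_symmetric n m F \<and> F = of_numerator (n, m) f)" for F
    unfolding Lambda_comp_def den of_numerator_def
    by (force simp: laurent_in_iff vars_def simp del: One_nat_def)
  then have "F \<in> Lambda_comp n m \<longleftrightarrow> (\<exists>f. lvars f \<subseteq> vars (n, m)
      \<and> (\<forall>\<pi>\<in>type_perms (vars (n, m)). rename_laurent \<pi> f = of_int (sign \<pi>) * f)
      \<and> F = of_numerator (n, m) f)" for F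
    using skew_symmetric_of_numerator by metis
  then show ?thesis by blast
qed

text \<open>Alternation projects onto the skew-symmetric numerators, so an element of a component
  can be given by any numerator in the right variables.\<close>

lemma Lambda_comp_alternate:
  "F \<in> Lambda_comp n m \<longleftrightarrow> (\<exists>f. lvars f \<subseteq> vars (n, m) \<and> F = of_numerator (n, m) (alternate (vars (n, m)) f))"
proof
  assume "F \<in> Lambda_comp n m"
  then obtain f where f: "lvars f \<subseteq> vars (n, m)" "F = of_numerator (n, m) f"
    "\<And>\<pi>. \<pi> \<in> type_perms (vars (n, m)) \<Longrightarrow> rename_laurent \<pi> f = of_int (sign \<pi>) * f"
    unfolding Lambda_comp_eq by blast
  have "alternate (vars (n, m)) f = f" by (rule alternate_skew[OF finite_vars f(3)])
  with f(1,2) show "\<exists>f. lvars f \<subseteq> vars (n, m) \<and> F = of_numerator (n, m) (alternate (vars (n, m)) f)"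
    by (intro exI[of _ f]) simp
next
  assume "\<exists>f. lvars f \<subseteq> vars (n, m) \<and> F = of_numerator (n, m) (alternate (vars (n, m)) f)"
  then obtain f where f: "lvars f \<subseteq> vars (n, m)" "F = of_numerator (n, m) (alternate (vars (n, m)) f)"
    by blast
  show "F \<in> Lambda_comp n m"
    unfolding Lambda_comp_eq f(2) by (intro imageI CollectI conjI ballI lvars_alternate f(1) rename_alternate) simp_all
qed

section \<open>The shuffle product on numerators\<close>

lemma cross_vars:
  "cross (vars d) (shift d ` vars e)
    = (\<Prod>x\<in>vars_X d. \<Prod>y\<in>shift d ` vars_Y e. kernel_xy x y)
      * (\<Prod>x\<in>shift d ` vars_X e. \<Prod>y\<in>vars_Y d. kernel_xy y x)"
proof -
  have same: "cross (vars_X d) (shift d ` vars_X e) = 1" "cross (vars_Y d) (shift d ` vars_Y e) = 1"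
    unfolding cross_def by (auto intro!: prod.neutral simp: kernel_xy_def vars_X_def vars_Y_def)
  have "cross (vars d) (shift d ` vars e)
      = cross (vars_X d) (shift d ` vars_X e) * cross (vars_X d) (shift d ` vars_Y e)
        * (cross (vars_Y d) (shift d ` vars_X e) * cross (vars_Y d) (shift d ` vars_Y e))"
  proof -
    have disj: "shift d ` vars_X e \<inter> shift d ` vars_Y e = {}"
      by (auto simp: vars_X_def vars_Y_def dest: injD[OF inj_shift])
    show ?thesis
      unfolding vars_split(1) image_Un
      by (simp add: cross_Un_left cross_Un_right vars_split(2) disj)
  qed
  also have "cross (vars_Y d) (shift d ` vars_X e) = (\<Prod>x\<in>shift d ` vars_X e. \<Prod>y\<in>vars_Y d. kernel_xy y x)"
    unfolding cross_def by (rule prod.swap)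
  finally show ?thesis by (simp add: same) (simp add: cross_def)
qed

text \<open>The last two factors are the denominators of the two kernel products in the shuffle
  product, so the denominators of operands and kernels combine exactly to that of the
  result.\<close>

lemma denom_add:
  "denom (d + e) = denom d * rename_laurent (shift d) (denom e)
    * (diff_prod (vars_X d) (shift d ` vars_Y e) * diff_prod (shift d ` vars_X e) (vars_Y d))"
  unfolding denom_def rename_diff_prod[OF inj_shift] vars_XY_add(1,3)
  unfolding diff_prod_def
  by (simp add: prod.union_disjoint vars_XY_add(2,4) prod.distrib ac_simps)

lemma shuffle_comp_of_numerator:
  "shuffle_comp d e (of_numerator d f) (of_numerator e g)
    = of_numerator (d + e) (alternate (vars (d + e)) (lprod d e f g))"
proof -
  obtain k1 l1 where d: "d = (k1, l1)" by (cases d)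
  obtain k2 l2 where e: "e = (k2, l2)" by (cases e)
  have inj: "inj_on XV A" "inj_on YV A" for A by (auto simp: inj_on_def)
  have SX: "shift d ` vars_X e = XV ` {k1<..k1 + k2}" and SY: "shift d ` vars_Y e = YV ` {l1<..l1 + l2}"
  proof -
    have "(\<lambda>i. k + i) ` {1..n} = {k<..k + n}" for k n :: nat
      using image_add_atLeastAtMost[of k 1 n] by (auto simp: atLeastSucAtMost_greaterThanAtMost)
    then show "shift d ` vars_X e = XV ` {k1<..k1 + k2}" "shift d ` vars_Y e = YV ` {l1<..l1 + l2}"
      by (simp_all add: d e vars_XY_image image_image flip: image_image[of XV "\<lambda>i. _ + i"] image_image[of YV "\<lambda>i. _ + i"] del: One_nat_def)
  qed
  have c: "rat_const (inverse v_indet) = of_laurent (lconst (inverse v_indet))"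
    by (simp add: rat_const_def lconst_def)
  have v: "rat_var z = of_laurent (lvar z)" for z by (simp add: rat_var_def lmon_def)
  have xy: "(xvar i + rat_const (inverse v_indet) * yvar j) / (xvar i - yvar j)
      = of_laurent (kernel_xy (XV i) (YV j)) / of_laurent (lvar (XV i) - lvar (YV j))" for i j
    by (simp add: kernel_xy_def c v of_laurent_add of_laurent_mult of_laurent_diff)
  \<comment> \<open>Reversing the denominator produces the sign built into \<open>kernel_xy\<close>
    for a first argument of type Y.\<close>
  have yx: "(yvar j + rat_const (inverse v_indet) * xvar i) / (yvar j - xvar i)
      = of_laurent (kernel_xy (YV j) (XV i)) / of_laurent (lvar (XV i) - lvar (YV j))" for i j
  proof -
    have "(yvar j + rat_const (inverse v_indet) * xvar i) / (yvar j - xvar i)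
        = - (yvar j + rat_const (inverse v_indet) * xvar i) / (xvar i - yvar j)"
      by (simp only: minus_diff_eq[of "xvar i", symmetric] divide_minus_right minus_divide_left)
    then show ?thesis
      by (simp add: kernel_xy_def c v of_laurent_add of_laurent_mult of_laurent_diff of_laurent_uminus)
  qed
  let ?K = "cross (vars d) (shift d ` vars e)"
  let ?D = "diff_prod (vars_X d) (shift d ` vars_Y e) * diff_prod (shift d ` vars_X e) (vars_Y d)"
  have kernels: "(\<Prod>i\<in>{1..k1}. \<Prod>j\<in>{l1<..l1 + l2}. (xvar i + rat_const (inverse v_indet) * yvar j) / (xvar i - yvar j))
      * (\<Prod>i\<in>{k1<..k1 + k2}. \<Prod>j\<in>{1..l1}. (yvar j + rat_const (inverse v_indet) * xvar i) / (yvar j - xvar i))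
    = of_laurent ?K / of_laurent ?D"
    unfolding cross_vars SX SY xy yx
    by (simp add: d e diff_prod_def vars_XY_image prod.reindex inj prod_dividef of_laurent_prod of_laurent_mult)
  have "rename_xy (\<lambda>i. k1 + i) (\<lambda>j. l1 + j) = rename (shift d)"
    unfolding rename_xy_def by (rule arg_cong[of _ _ rename]) (auto simp: fun_eq_iff shift_def d split: xyvar.splits)
  then have "of_numerator d f * rename_xy (\<lambda>i. k1 + i) (\<lambda>j. l1 + j) (of_numerator e g) * (of_laurent ?K / of_laurent ?D)
      = of_numerator (d + e) (lprod d e f g)"
    by (simp add: of_numerator_def rename_frac[OF inj_shift denom_neq_0] denom_add[of d e] lprod_def of_laurent_mult)
  then show ?thesis
    using ASym_of_numerator[of "k1 + k2" "l1 + l2"] kernels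
    by (simp add: shuffle_comp_def d e mult.assoc)
qed

section \<open>The morphism on the free algebra\<close>

lemma rename_xy_add:
  assumes "inj \<sigma>" "inj \<tau>"
  shows "rename_xy \<sigma> \<tau> (F + G) = rename_xy \<sigma> \<tau> F + rename_xy \<sigma> \<tau> G"
    and rename_xy_0: "rename_xy \<sigma> \<tau> 0 = 0"
proof -
  have "inj (xy_map \<sigma> \<tau>)"
    by (rule injI) (auto simp: xy_map_def split: xyvar.split_asm dest: injD[OF assms(1)] injD[OF assms(2)])
  then show "rename_xy \<sigma> \<tau> (F + G) = rename_xy \<sigma> \<tau> F + rename_xy \<sigma> \<tau> G" "rename_xy \<sigma> \<tau> 0 = 0"
    by (simp_all add: rename_xy_eq rename_add rename_0)
qed

lemma ASym_add: "ASym n m (F + G) = ASym n m F + ASym n m G"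
proof -
  have "rename_xy \<sigma> \<tau> (F + G) = rename_xy \<sigma> \<tau> F + rename_xy \<sigma> \<tau> G"
    if "\<sigma> permutes {1..n}" "\<tau> permutes {1..m}" for \<sigma> \<tau>
    by (rule rename_xy_add) (use that permutes_inj in blast)+
  then show ?thesis
    by (simp add: ASym_def distrib_left sum.distrib add_divide_distrib del: One_nat_def)
qed

lemma shuffle_comp_add_left: "shuffle_comp d e (F + F') G = shuffle_comp d e F G + shuffle_comp d e F' G"
  and shuffle_comp_add_right: "shuffle_comp d e F (G + G') = shuffle_comp d e F G + shuffle_comp d e F G'"
  by (auto simp: shuffle_comp_def distrib_left distrib_right rename_xy_add ASym_add split: prod.splits)

lemma shuffle_comp_0 [simp]: "shuffle_comp d e 0 G = 0" "shuffle_comp d e F 0 = 0"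
  using shuffle_comp_add_left[of d e 0 0 G] shuffle_comp_add_right[of d e F 0 0]
  by (simp_all only: add_0 add_cancel_right_right)

lemma shuffle_superset:
  assumes "finite A" "finite B" "Poly_Mapping.keys F \<subseteq> A" "Poly_Mapping.keys G \<subseteq> B"
  shows "F \<star> G = (\<Sum>d\<in>A. \<Sum>e\<in>B. Poly_Mapping.single (d + e)
    (shuffle_comp d e (Poly_Mapping.lookup F d) (Poly_Mapping.lookup G e)))"
proof -
  have "F \<star> G = (\<Sum>d\<in>Poly_Mapping.keys F. \<Sum>e\<in>B. Poly_Mapping.single (d + e)
    (shuffle_comp d e (Poly_Mapping.lookup F d) (Poly_Mapping.lookup G e)))"
    unfolding shuffle_def
    by (intro sum.cong refl sum.mono_neutral_left) (use assms in \<open>auto simp: in_keys_iff\<close>)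
  also have "\<dots> = (\<Sum>d\<in>A. \<Sum>e\<in>B. Poly_Mapping.single (d + e)
    (shuffle_comp d e (Poly_Mapping.lookup F d) (Poly_Mapping.lookup G e)))"
    by (intro sum.mono_neutral_left) (use assms in \<open>auto simp: in_keys_iff\<close>)
  finally show ?thesis .
qed

lemma shuffle_add_left: "(F + F') \<star> G = F \<star> G + F' \<star> G"
proof -
  let ?A = "Poly_Mapping.keys F \<union> Poly_Mapping.keys F'" and ?B = "Poly_Mapping.keys G"
  have "Poly_Mapping.keys (F + F') \<subseteq> ?A" by (rule Poly_Mapping.keys_add)
  then show ?thesis
    by (simp add: shuffle_superset[of ?A ?B] lookup_add shuffle_comp_add_left single_add sum.distrib)
qed

lemma shuffle_add_right: "F \<star> (G + G') = F \<star> G + F \<star> G'"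
proof -
  let ?A = "Poly_Mapping.keys F" and ?B = "Poly_Mapping.keys G \<union> Poly_Mapping.keys G'"
  have "Poly_Mapping.keys (G + G') \<subseteq> ?B" by (rule Poly_Mapping.keys_add)
  then show ?thesis
    by (simp add: shuffle_superset[of ?A ?B] lookup_add shuffle_comp_add_right single_add sum.distrib)
qed

lemma shuffle_0 [simp]: "0 \<star> G = 0" "F \<star> 0 = 0"
  by (simp_all add: shuffle_def)

lemma shuffle_single:
  "Poly_Mapping.single d F \<star> Poly_Mapping.single e G = Poly_Mapping.single (d + e) (shuffle_comp d e F G)"
  using shuffle_superset[of "{d}" "{e}" "Poly_Mapping.single d F" "Poly_Mapping.single e G"] by simp

text \<open>The image of a word is one alternated labelled product rather than an iterated shuffle
  product; multiplicativity then follows from \<open>lword_append\<close>, that is, from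
  associativity of \<open>lprod\<close>, together with \<open>alternate_lprod\<close>.\<close>

definition phi_word :: "Cv \<Rightarrow> word \<Rightarrow> graded"
  where "phi_word c w = Poly_Mapping.single (word_deg (letters w))
    (of_numerator (word_deg (letters w))
      (lconst c * alternate (vars (word_deg (letters w))) (lword (letters w))))"

definition phi :: "free \<Rightarrow> graded"
  where "phi a = (\<Sum>w\<in>Poly_Mapping.keys a. phi_word (Poly_Mapping.lookup a w) w)"

lemma phi_word_0: "phi_word 0 w = 0"
  and phi_word_add: "phi_word (c + c') w = phi_word c w + phi_word c' w"
  by (simp_all add: phi_word_def lconst_add distrib_right of_numerator_add single_add)

lemma phi_superset:
  assumes "finite S" "Poly_Mapping.keys a \<subseteq> S"
  shows "phi a = (\<Sum>w\<in>S. phi_word (Poly_Mapping.lookup a w) w)"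
  unfolding phi_def
  by (rule sum.mono_neutral_left) (use assms in \<open>auto simp: in_keys_iff phi_word_0\<close>)

lemma phi_add: "phi (a + b) = phi a + phi b"
proof -
  let ?S = "Poly_Mapping.keys a \<union> Poly_Mapping.keys b"
  have "Poly_Mapping.keys (a + b) \<subseteq> ?S" by (rule Poly_Mapping.keys_add)
  then show ?thesis
    by (simp add: phi_superset[of ?S] lookup_add phi_word_add sum.distrib)
qed

lemma phi_0 [simp]: "phi 0 = 0"
  by (simp add: phi_def)

lemma phi_uminus: "phi (- a) = - phi a"
  using phi_add[of a "- a"] by (simp add: eq_neg_iff_add_eq_0 add.commute)

lemma phi_diff: "phi (a - b) = phi a - phi b"
  using phi_add[of a "- b"] by (simp add: phi_uminus)

lemma phi_single: "phi (Poly_Mapping.single w c) = phi_word c w"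
  by (simp add: phi_def phi_word_0)

lemma free_induct [case_names add single]:
  assumes "\<And>a b. P a \<Longrightarrow> P b \<Longrightarrow> P (a + b)" "\<And>w c. P (Poly_Mapping.single w c)"
  shows "P (a :: free)"
proof -
  have "P 0" using assms(2)[of 0 0] by simp
  then have "P (\<Sum>w\<in>A. Poly_Mapping.single w (Poly_Mapping.lookup a w))" for A
    by (induction A rule: infinite_finite_induct) (auto intro: assms)
  moreover have "(\<Sum>w\<in>Poly_Mapping.keys a. Poly_Mapping.single w (Poly_Mapping.lookup a w)) = a"
    using push_keys_id[of a] by (simp add: push_keys_def)
  ultimately show ?thesis by metis
qed

lemma phi_word_mult: "phi_word c u \<star> phi_word c' w = phi_word (c * c') (u + w)"
proof -
  let ?d = "word_deg (letters u)" and ?e = "word_deg (letters w)"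
  let ?f = "lword (letters u)" and ?g = "lword (letters w)"
  have "shuffle_comp ?d ?e (of_numerator ?d (lconst c * alternate (vars ?d) ?f))
      (of_numerator ?e (lconst c' * alternate (vars ?e) ?g))
    = of_numerator (?d + ?e) (alternate (vars (?d + ?e))
        (lprod ?d ?e (alternate (vars ?d) (lconst c * ?f)) (alternate (vars ?e) (lconst c' * ?g))))"
    by (simp add: shuffle_comp_of_numerator alternate_lconst)
  also have "\<dots> = of_numerator (?d + ?e) (alternate (vars (?d + ?e)) (lprod ?d ?e (lconst c * ?f) (lconst c' * ?g)))"
    by (rule arg_cong[OF alternate_lprod]) (simp_all add: lvars_mult_le lvars_lword)
  also have "lprod ?d ?e (lconst c * ?f) (lconst c' * ?g) = lconst (c * c') * lword (letters (u + w))"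
    by (simp add: plus_word_def lword_append lprod_def rename_laurent_mult lconst_mult ac_simps)
  finally show ?thesis
    by (simp add: phi_word_def shuffle_single plus_word_def word_deg_append alternate_lconst)
qed

lemma phi_mult: "phi (a * b) = phi a \<star> phi b"
proof (induction a rule: free_induct)
  case (add a a')
  then show ?case by (simp add: distrib_right phi_add shuffle_add_left)
next
  case (single u c)
  show ?case
  proof (induction b rule: free_induct)
    case (add b b')
    then show ?case by (simp add: distrib_left phi_add shuffle_add_right)
  next
    case (single w c')
    show ?case by (simp add: mult_single phi_single phi_word_mult)
  qed
qed

definition scale :: "Cv \<Rightarrow> graded \<Rightarrow> graded"
  where "scale c = Poly_Mapping.map (\<lambda>F. rat_const c * F)"

lemma lookup_scale: "Poly_Mapping.lookup (scale c F) d = rat_const c * Poly_Mapping.lookup F d"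
  by (simp add: scale_def Poly_Mapping.map.rep_eq when_def)

lemma scale_add: "scale c (F + G) = scale c F + scale c G"
  by (rule poly_mapping_eqI) (simp add: lookup_scale lookup_add distrib_left)

lemma scale_phi: "phi (free_scalar c * a) = scale c (phi a)"
proof (induction a rule: free_induct)
  case (add a b)
  then show ?case by (simp add: distrib_left phi_add scale_add)
next
  case (single w c')
  have "scale c (phi_word c' w) = phi_word (c * c') w"
    by (rule poly_mapping_eqI)
      (simp add: lookup_scale phi_word_def lookup_single when_def lconst_mult mult.assoc of_numerator_lconst)
  then show ?case by (simp add: free_scalar_def mult_single phi_single)
qed

lemma phi_in_Lambda: "phi a \<in> carrier Lambda"
proof -
  have comp_add: "F + G \<in> Lambda_comp n m" if FG: "F \<in> Lambda_comp n m" "G \<in> Lambda_comp n m" for F G n m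
  proof -
    from FG obtain f g where "lvars f \<subseteq> vars (n, m)" "F = of_numerator (n, m) (alternate (vars (n, m)) f)"
      "lvars g \<subseteq> vars (n, m)" "G = of_numerator (n, m) (alternate (vars (n, m)) g)"
      unfolding Lambda_comp_alternate by blast
    then show ?thesis
      unfolding Lambda_comp_alternate
      by (intro exI[of _ "f + g"]) (simp add: alternate_add of_numerator_add lvars_add_le)
  qed
  have comp_0: "0 \<in> Lambda_comp n m" for n m
    unfolding Lambda_comp_alternate by (intro exI[of _ 0]) simp
  have word: "phi_word c w \<in> carrier Lambda" for c w
  proof -
    have "of_numerator (n, m) (lconst c * alternate (vars (n, m)) (lword (letters w))) \<in> Lambda_comp n m"
      if "word_deg (letters w) = (n, m)" for n m
      unfolding Lambda_comp_alternate
      by (intro exI[of _ "lconst c * lword (letters w)"])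
        (use lvars_lword[of "letters w"] that in \<open>simp add: alternate_lconst lvars_mult_le\<close>)
    then show ?thesis
      by (auto simp: Lambda_def phi_word_def lookup_single when_def comp_0)
  qed
  show ?thesis
  proof (induction a rule: free_induct)
    case (add a b)
    then show ?case by (simp add: Lambda_def phi_add lookup_add comp_add)
  next
    case (single w c)
    then show ?case by (simp add: phi_single word)
  qed
qed

lemma phi_surj:
  assumes "F \<in> carrier Lambda"
  shows "F \<in> range phi"
proof -
  have range_add: "F + G \<in> range phi" if "F \<in> range phi" "G \<in> range phi" for F G
    using that by (auto simp flip: phi_add)
  have "0 \<in> range phi" by (rule image_eqI[of _ _ 0]) simp_all
  then have sum: "(\<And>d. d \<in> A \<Longrightarrow> H d \<in> range phi) \<Longrightarrow> sum H A \<in> range phi" for H and A :: "(nat \<times> nat) set"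
    by (induction A rule: infinite_finite_induct) (auto intro: range_add)
  have span: "Poly_Mapping.single d (of_numerator d f) \<in> range phi" if "f \<in> word_span d" for d f
    using that
  proof (induction rule: word_span.induct)
    case (word w c)
    have "phi (Poly_Mapping.single (Word w) c) = Poly_Mapping.single d (of_numerator d (lconst c * alternate (vars d) (lword w)))"
      by (simp add: phi_single phi_word_def word)
    then show ?case by (metis rangeI)
  next
    case (add f g)
    then show ?case by (simp add: of_numerator_add single_add range_add)
  qed
  have "Poly_Mapping.single d (Poly_Mapping.lookup F d) \<in> range phi" for d
  proof -
    obtain n m where d: "d = (n, m)" by (cases d)
    have "Poly_Mapping.lookup F (n, m) \<in> Lambda_comp n m" using assms by (simp add: Lambda_def)
    then obtain f where "lvars f \<subseteq> vars d" "Poly_Mapping.lookup F d = of_numerator d (alternate (vars d) f)"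
      unfolding Lambda_comp_alternate d by blast
    then show ?thesis using span[OF alternate_in_word_span] by simp
  qed
  then have "(\<Sum>d\<in>Poly_Mapping.keys F. Poly_Mapping.single d (Poly_Mapping.lookup F d)) \<in> range phi"
    by (rule sum)
  then show ?thesis using push_keys_id[of F] by (simp add: push_keys_def)
qed

section \<open>Images of the generators and of the relators\<close>

lemma type_perms_singleton: "type_perms {z} = {id}"
  by (auto simp: type_perms_def type_preserving_def permutes_sing)

lemma phi_letter:
  "phi (Poly_Mapping.single (Word [a]) 1)
    = Poly_Mapping.single (letter_deg a) (rat_var (letter_var a) powi letter_exp a)"
proof -
  have "of_laurent (lmon (Poly_Mapping.single z i)) = rat_var z powi i" for z i
  proof -
    have nat: "of_laurent (lmon (Poly_Mapping.single z (int n))) = rat_var z ^ n" for n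
    proof (induction n)
      case (Suc n)
      have "lmon (Poly_Mapping.single z (int (Suc n))) = lvar z * lmon (Poly_Mapping.single z (int n))"
        by (simp flip: lmon_add single_add)
      then show ?case using Suc by (simp add: of_laurent_mult) (simp add: rat_var_def lmon_def)
    qed simp
    show ?thesis
    proof (cases "i \<ge> 0")
      case True
      then show ?thesis using nat[of "nat i"] by (simp add: power_int_def)
    next
      case False
      then have "lmon (Poly_Mapping.single z i) * lmon (Poly_Mapping.single z (int (nat (- i)))) = 1"
        by (simp flip: lmon_add single_add)
      then have "of_laurent (lmon (Poly_Mapping.single z i)) * rat_var z ^ nat (- i) = 1"
        by (metis nat of_laurent_1 of_laurent_mult)
      then have "of_laurent (lmon (Poly_Mapping.single z i)) = inverse (rat_var z ^ nat (- i))"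
        by (metis inverse_unique mult.commute)
      then show ?thesis using False by (simp add: power_int_def power_inverse)
    qed
  qed
  moreover have "denom (letter_deg a) = 1"
    by (cases a) (simp_all add: denom_def diff_prod_def vars_XY_image)
  moreover have "lprod (letter_deg a) 0 (letter a) 1 = letter a"
    by (simp add: lprod_def)
  moreover have "alternate {letter_var a} f = f" for f
    by (simp add: alternate_def type_perms_singleton)
  ultimately show ?thesis
    by (simp add: phi_single phi_word_def of_numerator_def vars_letter) (simp add: letter_def)
qed

lemma phi_p: "phi (p_free i) = Lambda_x i"
  using phi_letter[of "Pgen i"] by (simp add: p_free_def Lambda_x_def)

lemma phi_q: "phi (q_free j) = Lambda_y j"
  using phi_letter[of "Qgen j"] by (simp add: q_free_def Lambda_y_def)

lemma phi_one: "phi 1 = Poly_Mapping.single (0, 0) 1"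
proof -
  have "type_perms {} = {id}"
    by (auto simp: type_perms_def type_preserving_def permutes_empty)
  moreover have "denom 0 = 1" by (simp add: denom_def diff_prod_def vars_X_def)
  moreover have "phi 1 = phi (Poly_Mapping.single 0 1)" by simp
  ultimately show ?thesis
    by (simp add: phi_single phi_word_def zero_word_def of_numerator_def alternate_def del: single_one)
      (simp add: zero_prod_def)
qed

text \<open>For equal types the kernel is 1, and exchanging the two variables turns the numerator of
  one word into that of the other; alternation makes them opposite.\<close>

lemma phi_anticommute:
  assumes "letter_deg a = letter_deg b"
  shows "phi (Poly_Mapping.single (Word [a, b]) 1 + Poly_Mapping.single (Word [b, a]) 1) = 0"
proof -
  let ?d = "letter_deg a" and ?z = "letter_var a"
  let ?z' = "shift ?d ?z"
  have z: "letter_var b = ?z" using assms by (cases a; cases b) auto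
  have vars2: "vars (?d + ?d) = {?z, ?z'}"
    by (auto simp: vars_add vars_letter)
  have ty: "is_X ?z' = is_X ?z" by simp
  have l: "lword [c, c'] = lmon (Poly_Mapping.single ?z (letter_exp c)) * lmon (Poly_Mapping.single ?z' (letter_exp c'))"
    if "letter_var c = ?z" "letter_var c' = ?z" "letter_deg c = ?d" "letter_deg c' = ?d" for c c'
    using that vars_letter[of c] ty
    by (simp add: lprod_def letter_def rename_laurent_lmon vars_letter cross_def kernel_xy_def)
  let ?t = "transpose ?z ?z'"
  have t: "?t \<in> type_perms (vars (?d + ?d))"
    by (rule transpose_type_perms) (simp_all add: vars2)
  have ne: "?z \<noteq> ?z'" by (cases a) auto
  have "rename_laurent ?t (lword [a, b]) = lword [b, a]"
    using z assms by (simp only: l) (simp add: rename_laurent_mult rename_laurent_lmon mult.commute)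
  then have "alternate (vars (?d + ?d)) (lword [b, a]) = - alternate (vars (?d + ?d)) (lword [a, b])"
    using alternate_rename[OF t finite_vars, of "lword [a, b]"] ne by (simp add: sign_swap_id)
  then show ?thesis
    using assms by (simp add: phi_add phi_single phi_word_def del: lword.simps flip: single_add of_numerator_add)
qed

text \<open>The four numerators cancel already before alternation; apart from multiplying out, the
  only input is v * (1/v) = 1.\<close>

lemma phi_mixed:
  "phi (Poly_Mapping.single (Word [Pgen (i + 1), Qgen j]) 1
      + Poly_Mapping.single (Word [Qgen j, Pgen (i + 1)]) v_indet
      + Poly_Mapping.single (Word [Pgen i, Qgen (j + 1)]) v_indet
      + Poly_Mapping.single (Word [Qgen (j + 1), Pgen i]) 1) = 0"
proof -
  let ?x = "lvar (XV 1)" and ?y = "lvar (YV 1)" and ?v = "lconst v_indet" and ?w = "lconst (inverse v_indet)"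
  let ?M = "lmon (Poly_Mapping.single (XV 1) i) * lmon (Poly_Mapping.single (YV 1) j)"
  have "v_indet \<noteq> 0" by (simp add: v_indet_def Zero_fract_def eq_fract)
  then have vw: "?v * ?w = 1" by (simp flip: lconst_mult)
  have pq: "lword [Pgen a, Qgen b] = lmon (Poly_Mapping.single (XV 1) a) * lmon (Poly_Mapping.single (YV 1) b)
      * (?x + ?w * ?y)" for a b
    by (simp add: lprod_def letter_def rename_laurent_lmon vars_def cross_def kernel_xy_def)
  have qp: "lword [Qgen b, Pgen a] = - (lmon (Poly_Mapping.single (XV 1) a) * lmon (Poly_Mapping.single (YV 1) b)
      * (?y + ?w * ?x))" for a b
    by (simp add: lprod_def letter_def rename_laurent_lmon vars_def cross_def kernel_xy_def algebra_simps)
  have x: "lmon (Poly_Mapping.single (XV 1) (i + 1)) = ?x * lmon (Poly_Mapping.single (XV 1) i)"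
    and y: "lmon (Poly_Mapping.single (YV 1) (j + 1)) = ?y * lmon (Poly_Mapping.single (YV 1) j)"
    by (simp_all add: single_add lmon_add mult.commute)
  have "lword [Pgen (i + 1), Qgen j] + ?v * lword [Qgen j, Pgen (i + 1)]
      + ?v * lword [Pgen i, Qgen (j + 1)] + lword [Qgen (j + 1), Pgen i]
    = ?M * ((?x * (?x + ?w * ?y) - (?v * ?y + (?v * ?w) * ?x) * ?x) + (?v * ?x + (?v * ?w) * ?y) * ?y - ?y * (?y + ?w * ?x))"
    unfolding pq qp x y by (simp add: algebra_simps)
  also have "\<dots> = 0" unfolding vw by (simp add: algebra_simps)
  finally have "alternate (vars (1, 1)) (lword [Pgen (i + 1), Qgen j]) + ?v * alternate (vars (1, 1)) (lword [Qgen j, Pgen (i + 1)])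
      + ?v * alternate (vars (1, 1)) (lword [Pgen i, Qgen (j + 1)]) + alternate (vars (1, 1)) (lword [Qgen (j + 1), Pgen i]) = 0"
    by (simp only: alternate_0 flip: alternate_add alternate_lconst)
  then have "of_numerator (1, 1) (alternate (vars (1, 1)) (lword [Pgen (i + 1), Qgen j]) + ?v * alternate (vars (1, 1)) (lword [Qgen j, Pgen (i + 1)])
      + ?v * alternate (vars (1, 1)) (lword [Pgen i, Qgen (j + 1)]) + alternate (vars (1, 1)) (lword [Qgen (j + 1), Pgen i])) = 0"
    by simp
  moreover have deg: "word_deg [Pgen a, Qgen b] = (1, 1)" "word_deg [Qgen b, Pgen a] = (1, 1)" for a b
    by (simp_all add: zero_prod_def)
  ultimately show ?thesis
    unfolding phi_add phi_single phi_word_def word.sel deg single_add[symmetric] of_numerator_add[symmetric]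
    by (simp del: lword.simps)
qed

lemma phi_relators:
  assumes "r \<in> relators"
  shows "phi r = 0"
proof -
  have w: "p_free i * q_free j = Poly_Mapping.single (Word [Pgen i, Qgen j]) 1"
    "q_free j * p_free i = Poly_Mapping.single (Word [Qgen j, Pgen i]) 1"
    "p_free i * p_free j = Poly_Mapping.single (Word [Pgen i, Pgen j]) 1"
    "q_free i * q_free j = Poly_Mapping.single (Word [Qgen i, Qgen j]) 1" for i j
    by (simp_all add: p_free_def q_free_def mult_single plus_word_def)
  have s: "free_scalar c * Poly_Mapping.single w 1 = Poly_Mapping.single w c" for c w
    by (simp add: free_scalar_def mult_single)
  consider (p) i j where "r = p_free i * p_free j + p_free j * p_free i"
    | (q) i j where "r = q_free i * q_free j + q_free j * q_free i"
    | (pq) i j where "r = (p_free (i + 1) * q_free j + free_scalar v_indet * (q_free j * p_free (i + 1)))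
      - (- free_scalar v_indet * (p_free i * q_free (j + 1)) - q_free (j + 1) * p_free i)"
    using assms unfolding relators_def by blast
  then show ?thesis
  proof cases
    case p
    then show ?thesis using phi_anticommute[of "Pgen i" "Pgen j"] by (simp add: w)
  next
    case q
    then show ?thesis using phi_anticommute[of "Qgen i" "Qgen j"] by (simp add: w)
  next
    case pq
    have "r = p_free (i + 1) * q_free j + free_scalar v_indet * (q_free j * p_free (i + 1))
      + free_scalar v_indet * (p_free i * q_free (j + 1)) + q_free (j + 1) * p_free i"
      by (simp add: pq)
    then show ?thesis using phi_mixed[of i j] by (simp only: w s)
  qed
qed

text \<open>The elements killed by \<open>phi\<close> form a two-sided ideal containing the
  relators, and \<open>relation_ideal\<close> is the least such ideal.\<close>

lemma relation_idealD:
  assumes "a \<in> relation_ideal"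
  shows "phi a = 0"
proof -
  have "ideal {a. phi a = 0} free_algebra"
  proof (rule idealI[OF ring_free_algebra])
    show "subgroup {a. phi a = 0} (add_monoid free_algebra)"
    proof (rule group.subgroupI)
      show "group (add_monoid free_algebra)"
        using ring.is_abelian_group[OF ring_free_algebra] abelian_group.a_group by blast
      show "{a. phi a = 0} \<noteq> {}" using phi_0 by blast
      fix a assume a: "a \<in> {a. phi a = 0}"
      have "inv\<^bsub>add_monoid free_algebra\<^esub> a = - a"
        by (rule group.inv_equality[OF \<open>group (add_monoid free_algebra)\<close>]) (simp_all add: free_algebra_def)
      with a show "inv\<^bsub>add_monoid free_algebra\<^esub> a \<in> {a. phi a = 0}" by (simp add: phi_uminus)
    qed (auto simp: free_algebra_def phi_add)
  qed (auto simp: free_algebra_def phi_mult)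
  moreover have "relators \<subseteq> {a. phi a = 0}" using phi_relators by blast
  ultimately have "relation_ideal \<subseteq> {a. phi a = 0}"
    unfolding relation_ideal_def by (rule ring.genideal_minimal[OF ring_free_algebra])
  with assms show ?thesis by blast
qed

section \<open>The quotient as a type, and injectivity\<close>

lemma relation_ideal_closed:
  "0 \<in> relation_ideal"
  "a \<in> relation_ideal \<Longrightarrow> b \<in> relation_ideal \<Longrightarrow> a + b \<in> relation_ideal"
  "a \<in> relation_ideal \<Longrightarrow> - a \<in> relation_ideal"
  "a \<in> relation_ideal \<Longrightarrow> x * a \<in> relation_ideal"
  "a \<in> relation_ideal \<Longrightarrow> a * x \<in> relation_ideal"
proof -
  interpret ideal relation_ideal free_algebra by (rule ideal_relation_ideal)
  show "0 \<in> relation_ideal" 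
    using additive_subgroup.zero_closed[OF ideal.axioms(1)[OF ideal_relation_ideal]]
    by (simp add: free_algebra_def)
  show "a \<in> relation_ideal \<Longrightarrow> b \<in> relation_ideal \<Longrightarrow> a + b \<in> relation_ideal"
    using additive_subgroup.a_closed[OF ideal.axioms(1)[OF ideal_relation_ideal], of a b]
    by (simp add: free_algebra_def)
  show *: "a \<in> relation_ideal \<Longrightarrow> x * a \<in> relation_ideal" for a x
    using I_l_closed[of a x] by (simp add: free_algebra_def)
  show "a \<in> relation_ideal \<Longrightarrow> a * x \<in> relation_ideal"
    using I_r_closed[of a x] by (simp add: free_algebra_def)
  show "a \<in> relation_ideal \<Longrightarrow> - a \<in> relation_ideal"
    using *[of a "- 1"] by simp
qed

lemma relation_ideal_diff: "a \<in> relation_ideal \<Longrightarrow> b \<in> relation_ideal \<Longrightarrow> a - b \<in> relation_ideal"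
  using relation_ideal_closed(2)[of a "- b"] relation_ideal_closed(3) by simp

\<comment> \<open>The same quotient as \<open>U_pos\<close>, but as a type:
  \<open>odd_generators\<close> takes its target to be a type of class \<open>ring_1\<close>,
  whereas \<open>U_pos\<close> is a record carried by cosets.\<close>
quotient_type U_quot = free / "\<lambda>a b. a - b \<in> relation_ideal"
proof (rule equivpI)
  show "reflp (\<lambda>a b. a - b \<in> relation_ideal)"
    by (rule reflpI) (simp add: relation_ideal_closed)
  show "symp (\<lambda>a b. a - b \<in> relation_ideal)"
    by (rule sympI) (use relation_ideal_closed(3) in fastforce)
  show "transp (\<lambda>a b. a - b \<in> relation_ideal)"
    by (rule transpI) (use relation_ideal_closed(2) in fastforce)
qed

instantiation U_quot :: ring_1
begin

lift_definition zero_U_quot :: U_quot is 0 .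
lift_definition one_U_quot :: U_quot is 1 .
lift_definition plus_U_quot :: "U_quot \<Rightarrow> U_quot \<Rightarrow> U_quot" is plus
  using relation_ideal_closed(2) by (simp add: add_diff_add)
lift_definition uminus_U_quot :: "U_quot \<Rightarrow> U_quot" is uminus
  using relation_ideal_closed(3) by fastforce
lift_definition minus_U_quot :: "U_quot \<Rightarrow> U_quot \<Rightarrow> U_quot" is minus
proof -
  fix a a' b b' :: free assume "a - a' \<in> relation_ideal" "b - b' \<in> relation_ideal"
  from relation_ideal_diff[OF this] show "a - b - (a' - b') \<in> relation_ideal" by (simp add: algebra_simps)
qed
lift_definition times_U_quot :: "U_quot \<Rightarrow> U_quot \<Rightarrow> U_quot" is times
proof -
  fix a a' b b' :: free assume "a - a' \<in> relation_ideal" "b - b' \<in> relation_ideal"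
  then have "(a - a') * b + a' * (b - b') \<in> relation_ideal"
    by (intro relation_ideal_closed)
  then show "a * b - a' * b' \<in> relation_ideal" by (simp add: algebra_simps)
qed

instance
proof
  \<comment> \<open>That 1 lies outside the ideal is seen through \<open>phi\<close>, which sends it
    to a nonzero element.\<close>
  show "(0::U_quot) \<noteq> 1"
  proof (transfer, rule notI)
    assume "0 - 1 \<in> relation_ideal"
    then have "phi (- 1) = 0" by (simp add: relation_idealD)
    then have "phi 1 = 0" by (simp add: phi_uminus)
    then show False
      by (metis phi_one lookup_single_eq lookup_zero one_neq_zero)
  qed
qed (transfer; simp add: algebra_simps relation_ideal_closed(1))+

end

section \<open>The quotient as an algebra satisfying the relations\<close>

lift_definition U_scalar :: "Cv \<Rightarrow> U_quot" is free_scalar .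
lift_definition U_gen_p :: "int \<Rightarrow> U_quot" is p_free .
lift_definition U_gen_q :: "int \<Rightarrow> U_quot" is q_free .

lemma free_scalar_central: "free_scalar c * a = a * free_scalar c"
proof (induction a rule: free_induct)
  case (add a b)
  then show ?case by (simp add: algebra_simps)
next
  case (single w c')
  show ?case by (simp add: free_scalar_def mult_single mult.commute)
qed

lemma relators_in_ideal: "relators \<subseteq> relation_ideal"
  unfolding relation_ideal_def
  by (rule ring.genideal_self[OF ring_free_algebra]) (simp add: free_algebra_def)

interpretation U: odd_generators U_scalar U_gen_p U_gen_q
proof
  show "U_scalar (c + d) = U_scalar c + U_scalar d" for c d
    by transfer (simp add: free_scalar_def single_add relation_ideal_closed(1))
  show "U_scalar (c * d) = U_scalar c * U_scalar d" for c d
    by transfer (simp add: free_scalar_def mult_single relation_ideal_closed(1))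
  show "U_scalar 1 = 1"
    by transfer (simp add: free_scalar_def relation_ideal_closed(1))
  show "U_scalar c * a = a * U_scalar c" for c a
    by transfer (simp add: free_scalar_central relation_ideal_closed(1))
  show "U_gen_p i * U_gen_p j = - (U_gen_p j * U_gen_p i)" for i j
  proof transfer
    fix i j
    have "p_free i * p_free j + p_free j * p_free i \<in> relators" unfolding relators_def by blast
    then show "p_free i * p_free j - - (p_free j * p_free i) \<in> relation_ideal"
      using relators_in_ideal by auto
  qed
  show "U_gen_q i * U_gen_q j = - (U_gen_q j * U_gen_q i)" for i j
  proof transfer
    fix i j
    have "q_free i * q_free j + q_free j * q_free i \<in> relators" unfolding relators_def by blast
    then show "q_free i * q_free j - - (q_free j * q_free i) \<in> relation_ideal"
      using relators_in_ideal by auto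
  qed
  show "U_gen_p (i + 1) * U_gen_q j + U_scalar v_indet * (U_gen_q j * U_gen_p (i + 1))
      = - (U_scalar v_indet * (U_gen_p i * U_gen_q (j + 1))) - U_gen_q (j + 1) * U_gen_p i" for i j
  proof transfer
    fix i j
    have "(p_free (i + 1) * q_free j + free_scalar v_indet * (q_free j * p_free (i + 1)))
      - (- free_scalar v_indet * (p_free i * q_free (j + 1)) - q_free (j + 1) * p_free i) \<in> relators"
      unfolding relators_def by blast
    then show "p_free (i + 1) * q_free j + free_scalar v_indet * (q_free j * p_free (i + 1))
      - (- (free_scalar v_indet * (p_free i * q_free (j + 1))) - q_free (j + 1) * p_free i) \<in> relation_ideal"
      using relators_in_ideal by auto
  qed
qed

lemma U_word_val: "abs_U_quot (Poly_Mapping.single (Word w) 1) = U.word_val w"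
proof (induction w)
  case Nil
  have "Poly_Mapping.single (Word []) 1 = (1 :: free)" by (simp flip: zero_word_def)
  then show ?case by (simp add: one_U_quot.abs_eq)
next
  case (Cons a w)
  have "abs_U_quot (Poly_Mapping.single (Word [a]) 1) = U.letter_val a"
    by (cases a) (simp_all add: U_gen_p.abs_eq U_gen_q.abs_eq p_free_def q_free_def)
  moreover have "Poly_Mapping.single (Word (a # w)) 1
      = Poly_Mapping.single (Word [a]) 1 * (Poly_Mapping.single (Word w) 1 :: free)"
    by (simp add: mult_single plus_word_def)
  ultimately show ?case using Cons by (simp flip: times_U_quot.abs_eq)
qed

lemma abs_U_quot_expand:
  "abs_U_quot a = (\<Sum>w\<in>Poly_Mapping.keys a. U_scalar (Poly_Mapping.lookup a w) * U.word_val (letters w))"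
proof -
  have sum: "abs_U_quot (sum F A) = (\<Sum>w\<in>A. abs_U_quot (F w))" for F and A :: "word set"
    by (induction A rule: infinite_finite_induct)
      (simp_all add: zero_U_quot.abs_eq flip: plus_U_quot.abs_eq)
  have single: "abs_U_quot (Poly_Mapping.single w c) = U_scalar c * U.word_val (letters w)" for w c
  proof -
    have "Poly_Mapping.single w c = free_scalar c * Poly_Mapping.single (Word (letters w)) 1"
      by (simp add: free_scalar_def mult_single)
    then show ?thesis by (simp add: U_scalar.abs_eq U_word_val[symmetric] times_U_quot.abs_eq)
  qed
  have "a = (\<Sum>w\<in>Poly_Mapping.keys a. Poly_Mapping.single w (Poly_Mapping.lookup a w))"
    using push_keys_id[of a] by (simp add: push_keys_def)
  then have "abs_U_quot a = abs_U_quot (\<Sum>w\<in>Poly_Mapping.keys a. Poly_Mapping.single w (Poly_Mapping.lookup a w))"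
    by (rule arg_cong)
  then show ?thesis by (simp add: sum single)
qed

text \<open>The bidegree components of \<open>phi a\<close> vanish separately, and pairing each
  numerator with the dual family over the quotient returns the class of the corresponding part of
  \<open>a\<close>. Hence the class of \<open>a\<close> is 0.\<close>

theorem phi_kernel:
  assumes "phi a = 0"
  shows "a \<in> relation_ideal"
proof -
  let ?K = "Poly_Mapping.keys a" and ?D = "\<lambda>w. word_deg (letters w)"
  let ?t = "\<lambda>w. lconst (Poly_Mapping.lookup a w) * alternate (vars (?D w)) (lword (letters w))"
  have zero: "(\<Sum>w\<in>{w\<in>?K. ?D w = d}. ?t w) = 0" for d
  proof -
    have "Poly_Mapping.lookup (phi a) d = (\<Sum>w\<in>?K. of_numerator d (?t w) when ?D w = d)"
      by (simp add: phi_def phi_word_def lookup_sum lookup_single when_def cong: if_cong sum.cong)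
    also have "\<dots> = of_numerator d (\<Sum>w\<in>{w\<in>?K. ?D w = d}. ?t w)"
      by (simp add: of_numerator_sum when_def flip: sum.inter_filter)
    finally show ?thesis using assms of_numerator_eq_iff[of d _ 0] by simp
  qed
  have "abs_U_quot a = (\<Sum>w\<in>?K. U.pairing (vars (?D w)) (?t w))"
    unfolding abs_U_quot_expand
    by (rule sum.cong) (simp_all add: U.pairing_lconst U.pairing_alternate U.pairing_lword)
  also have "\<dots> = (\<Sum>d\<in>?D ` ?K. \<Sum>w\<in>{w\<in>?K. ?D w = d}. U.pairing (vars (?D w)) (?t w))"
    by (rule sum.group[symmetric]) auto
  also have "\<dots> = (\<Sum>d\<in>?D ` ?K. U.pairing (vars d) (\<Sum>w\<in>{w\<in>?K. ?D w = d}. ?t w))"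
    by (intro sum.cong refl) (simp add: U.pairing_sum)
  also have "\<dots> = 0" by (simp only: zero U.pairing_0 sum.neutral_const)
  finally have "abs_U_quot a = abs_U_quot 0" by (simp add: zero_U_quot.abs_eq)
  then show ?thesis using U_quot.abs_eq_iff[of a 0] by simp
qed

section \<open>The isomorphism\<close>

abbreviation U_class :: "free \<Rightarrow> free set"
  where "U_class a \<equiv> relation_ideal +>\<^bsub>free_algebra\<^esub> a"

text \<open>Any representative serves, because \<open>phi\<close> vanishes on the ideal and is
  therefore constant on cosets.\<close>

definition phi_U :: "free set \<Rightarrow> graded"
  where "phi_U C = phi (SOME a. a \<in> C)"

lemma U_class_iff: "b \<in> U_class a \<longleftrightarrow> b - a \<in> relation_ideal"
proof -
  have "U_class a = {h + a | h. h \<in> relation_ideal}"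
    by (auto simp: a_r_coset_def' free_algebra_def)
  then show ?thesis by (auto intro: exI[of _ "b - a"])
qed

lemma phi_U_class: "phi_U (U_class a) = phi a"
proof -
  have "a \<in> U_class a" by (simp add: U_class_iff relation_ideal_closed(1))
  then have "(SOME b. b \<in> U_class a) \<in> U_class a" by (rule someI)
  then have "phi ((SOME b. b \<in> U_class a) - a) = 0"
    unfolding U_class_iff by (rule relation_idealD)
  then show ?thesis by (simp add: phi_U_def phi_diff)
qed

lemma U_class_eq_iff: "U_class a = U_class b \<longleftrightarrow> a - b \<in> relation_ideal"
proof
  assume "U_class a = U_class b"
  moreover have "a \<in> U_class a" by (simp add: U_class_iff relation_ideal_closed(1))
  ultimately show "a - b \<in> relation_ideal" by (simp add: U_class_iff)
next
  assume ab: "a - b \<in> relation_ideal"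
  have "x - a \<in> relation_ideal \<longleftrightarrow> x - b \<in> relation_ideal" for x
    using relation_ideal_closed(2)[OF _ ab, of "x - a"] relation_ideal_diff[OF _ ab, of "x - b"] by auto
  then show "U_class a = U_class b" by (auto simp: U_class_iff)
qed

lemma carrier_U_pos: "carrier U_pos = range U_class"
  by (auto simp: U_pos_def quotient_algebra_def FactRing_def A_RCOSETS_def' free_algebra_def)

lemma U_pos_ops:
  "U_class a \<otimes>\<^bsub>U_pos\<^esub> U_class b = U_class (a * b)"
  "U_class a \<oplus>\<^bsub>U_pos\<^esub> U_class b = U_class (a + b)"
  "\<one>\<^bsub>U_pos\<^esub> = U_class 1"
  "c \<odot>\<^bsub>U_pos\<^esub> U_class a = U_class (free_scalar c * a)"
proof -
  interpret ideal relation_ideal free_algebra by (rule ideal_relation_ideal)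
  show "U_class a \<otimes>\<^bsub>U_pos\<^esub> U_class b = U_class (a * b)"
    using rcoset_mult_add[of a b] by (simp add: U_pos_def quotient_algebra_def FactRing_def) (simp add: free_algebra_def)
  show "U_class a \<oplus>\<^bsub>U_pos\<^esub> U_class b = U_class (a + b)"
    using a_rcos_sum[of a b] by (simp add: U_pos_def quotient_algebra_def FactRing_def) (simp add: free_algebra_def)
  show "\<one>\<^bsub>U_pos\<^esub> = U_class 1"
    by (simp add: U_pos_def quotient_algebra_def FactRing_def) (simp add: free_algebra_def)
  \<comment> \<open>The union defining the scalar action runs over all representatives; each
    contributes the same coset.\<close>
  have "U_class (free_scalar c * x) = U_class (free_scalar c * a)" if "x \<in> U_class a" for x
    using relation_ideal_closed(4)[of "x - a" "free_scalar c"] that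
    by (simp add: U_class_eq_iff U_class_iff right_diff_distrib)
  moreover have "a \<in> U_class a" by (simp add: U_class_iff relation_ideal_closed(1))
  ultimately have "(\<Union>x\<in>U_class a. U_class (free_scalar c * x)) = U_class (free_scalar c * a)" by blast
  then show "c \<odot>\<^bsub>U_pos\<^esub> U_class a = U_class (free_scalar c * a)"
    by (simp add: U_pos_def quotient_algebra_def) (simp add: free_algebra_def)
qed

lemma Lambda_simps:
  "mult Lambda = shuffle" "add Lambda = plus" "one Lambda = Poly_Mapping.single (0, 0) 1"
  "smult Lambda = scale"
  by (simp_all add: Lambda_def scale_def[abs_def])

lemma phi_U_hom: "phi_U \<in> algebra_hom U_pos Lambda"
  unfolding algebra_hom_def ring_hom_def carrier_U_pos
  by (auto simp: U_pos_ops phi_U_class Lambda_simps phi_in_Lambda phi_mult phi_add phi_one)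
    (metis phi_mult scale_phi)

theorem phi_U_bij: "bij_betw phi_U (carrier U_pos) (carrier Lambda)"
proof (rule bij_betw_imageI)
  show "inj_on phi_U (carrier U_pos)"
  proof (rule inj_onI)
    fix C D assume "C \<in> carrier U_pos" "D \<in> carrier U_pos" and eq: "phi_U C = phi_U D"
    then obtain a b where ab: "C = U_class a" "D = U_class b" by (auto simp: carrier_U_pos)
    with eq have "phi (a - b) = 0" by (simp add: phi_U_class phi_diff)
    then show "C = D" by (simp add: ab U_class_eq_iff phi_kernel)
  qed
  show "phi_U ` carrier U_pos = carrier Lambda"
    using phi_in_Lambda phi_surj by (force simp: carrier_U_pos phi_U_class image_iff)
qed

text \<open>Words span the free algebra, and both maps are multiplicative with the same values on
  single letters.\<close>

lemma algebra_hom_unique: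
  assumes \<psi>: "\<psi> \<in> algebra_hom U_pos Lambda"
    and p: "\<And>i. \<psi> (U_p i) = Lambda_x i" and q: "\<And>j. \<psi> (U_q j) = Lambda_y j"
  shows "\<psi> (U_class a) = phi a"
proof -
  have hom: "\<psi> (U_class (a * b)) = \<psi> (U_class a) \<star> \<psi> (U_class b)"
    "\<psi> (U_class (a + b)) = \<psi> (U_class a) + \<psi> (U_class b)"
    "\<psi> (U_class 1) = Poly_Mapping.single (0, 0) 1"
    "\<psi> (U_class (free_scalar c * a)) = scale c (\<psi> (U_class a))" for a b c
  proof -
    have "\<psi> (U_class a \<otimes>\<^bsub>U_pos\<^esub> U_class b) = \<psi> (U_class a) \<star> \<psi> (U_class b)"
      "\<psi> (U_class a \<oplus>\<^bsub>U_pos\<^esub> U_class b) = \<psi> (U_class a) + \<psi> (U_class b)"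
      "\<psi> \<one>\<^bsub>U_pos\<^esub> = Poly_Mapping.single (0, 0) 1"
      "\<psi> (c \<odot>\<^bsub>U_pos\<^esub> U_class a) = scale c (\<psi> (U_class a))"
      using \<psi> unfolding algebra_hom_def ring_hom_def carrier_U_pos Lambda_simps by auto
    then show "\<psi> (U_class (a * b)) = \<psi> (U_class a) \<star> \<psi> (U_class b)"
      "\<psi> (U_class (a + b)) = \<psi> (U_class a) + \<psi> (U_class b)"
      "\<psi> (U_class 1) = Poly_Mapping.single (0, 0) 1"
      "\<psi> (U_class (free_scalar c * a)) = scale c (\<psi> (U_class a))"
      by (simp_all only: U_pos_ops)
  qed
  have word: "\<psi> (U_class (Poly_Mapping.single (Word w) 1)) = phi (Poly_Mapping.single (Word w) 1)" for w
  proof (induction w)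
    case Nil
    have "Poly_Mapping.single (Word []) 1 = (1 :: free)" by (simp flip: zero_word_def)
    then show ?case by (simp only: hom(3) phi_one)
  next
    case (Cons a w)
    have "\<psi> (U_class (Poly_Mapping.single (Word [a]) 1)) = phi (Poly_Mapping.single (Word [a]) 1)"
      using p q phi_p phi_q by (cases a) (simp_all add: U_p_def U_q_def p_free_def q_free_def)
    moreover have "Poly_Mapping.single (Word (a # w)) 1
        = Poly_Mapping.single (Word [a]) 1 * (Poly_Mapping.single (Word w) 1 :: free)"
      by (simp add: mult_single plus_word_def)
    ultimately show ?case using Cons by (simp only: hom(1) phi_mult)
  qed
  show ?thesis
  proof (induction a rule: free_induct)
    case (add a b)
    then show ?case by (simp only: hom(2) phi_add)
  next
    case (single w c)
    have "Poly_Mapping.single w c = free_scalar c * Poly_Mapping.single (Word (letters w)) 1"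
      by (simp add: free_scalar_def mult_single)
    then show ?case using word[of "letters w"] by (simp only: hom(4) scale_phi)
  qed
qed

theorem theorem2p12:
  shows "\<exists>\<phi>. \<phi> \<in> algebra_hom U_pos Lambda
    \<and> (\<forall>i. \<phi> (U_p i) = Lambda_x i) \<and> (\<forall>j. \<phi> (U_q j) = Lambda_y j)
    \<and> (\<forall>\<psi>. \<psi> \<in> algebra_hom U_pos Lambda
          \<and> (\<forall>i. \<psi> (U_p i) = Lambda_x i) \<and> (\<forall>j. \<psi> (U_q j) = Lambda_y j)
          \<longrightarrow> (\<forall>u\<in>carrier U_pos. \<psi> u = \<phi> u))
    \<and> \<phi> \<in> algebra_iso U_pos Lambda"
proof (intro exI[of _ phi_U] conjI allI impI ballI)
  show "phi_U \<in> algebra_hom U_pos Lambda" by (rule phi_U_hom)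
  then show "phi_U \<in> algebra_iso U_pos Lambda"
    using phi_U_bij by (simp add: algebra_iso_def)
  show "phi_U (U_p i) = Lambda_x i" for i by (simp add: U_p_def phi_U_class phi_p)
  show "phi_U (U_q j) = Lambda_y j" for j by (simp add: U_q_def phi_U_class phi_q)
  fix \<psi> u
  assume "\<psi> \<in> algebra_hom U_pos Lambda \<and> (\<forall>i. \<psi> (U_p i) = Lambda_x i) \<and> (\<forall>j. \<psi> (U_q j) = Lambda_y j)"
    and "u \<in> carrier U_pos"
  then show "\<psi> u = phi_U u"
    using algebra_hom_unique[of \<psi>] by (auto simp: carrier_U_pos phi_U_class)
qed

end
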